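(* (i) Let $q\in\overline{\mathcal U}$. (a) If $q=M+1$, then $\mathcal V_q=\overline{\mathcal U_q}=[0,1]$ is a perfect set. (b) If $q\in\overline{\mathcal U}\setminus\{M+1\}$, then $\mathcal V_q=\overline{\mathcal U_q}$ is a Cantor set. (ii) Consider the connected component $(1,q_{KL})$ of $(1,M+1]\setminus\overline{\mathcal U}$ with associated sequence $q_1<q_2<\cdots$. (a) If $q\in(1,q_1]$, then $\mathcal U_q$ is a two-point set. (b) If $q\in(q_n,q_{n+1}]$ for some $n\ge1$, then $\mathcal U_q$ is countably infinite; its accumulation points form the set $\pi_q(\mathcal U'_{q_n})$ and its isolated points form the set $\pi_q(\mathcal V'_{q_n}\setminus\mathcal U'_{q_n})$; and the isolated points of $\mathcal U_q$ form a dense subset of $\mathcal U_q$. (iii) Consider a connected component $(q_0,q_0^* )$ of $(1,M+1]\setminus\overline{\mathcal U}$ with $q_0\in\overline{\mathcal U}\setminus\mathcal U$, with associated sequence $q_1<q_2<\cdots$. (a) If $q\in(q_0,q_1]$, then $\mathcal U_q=\overline{\mathcal U_q}$ is a Cantor set, and $\pi_q(\mathcal V'_{q_0}\setminus\mathcal U'_{q_0})$ is dense in $\mathcal U_q$. (b) If $q\in(q_n,q_{n+1}]$ for some $n\ge1$, then the condensation points of $\mathcal U_q$ form the set $\pi_q(\mathcal V'_{q_0})$, the accumulation points of $\mathcal U_q$ that are not condensation points form the set $\pi_q(\mathcal U'_{q_n}\setminus\mathcal V'_{q_0})$, and the isolated points of $\mathcal U_q$ form the set $\pi_q(\mathcal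 V'_{q_n}\setminus\mathcal U'_{q_n})$; moreover the isolated points of $\mathcal U_q$ form a dense subset of $\mathcal U_q$.
   Context: Fix a positive integer $M$ and $A=\{0,1,\dots,M\}$. A sequence in $A^{\mathbb N}$ is finite if it has a last nonzero digit, infinite otherwise; doubly infinite if both it and $(M-c_i)$ are infinite. For $q\in(1,M+1]$ and $(c_i)\in A^{\mathbb N}$ let $\pi_q((c_i))=\sum_{i\ge1}c_iq^{-i}$; an expansion of $x$ in base $q$ is $(c_i)$ with $\pi_q((c_i))=x$; $J_q=[0,M/(q-1)]$. The quasi-greedy expansion $a(x,q)$ is the lexicographically largest infinite expansion of $x$. $\mathcal U$ (resp. $\mathcal V$) is the set of $q>1$ such that $1$ has a unique expansion (resp. a unique doubly infinite expansion) in base $q$; $\overline{\mathcal U}$ is the closure of $\mathcal U$. $\mathcal U_q$ is the set of $x\in J_q$ with a unique expansion; for $q<M+1$, $\mathcal V_q$ is the set of $x\in J_q$ with a unique doubly infinite expansion, $\mathcal V_{M+1}=[0,1]$; $\mathcal U_q'$, $\mathcal V_q'$ are the sets of quasi-greedy expansions of elements of $\mathcal U_q$, $\mathcal V_q$. Known facts used to set notation: $q_{KL}:=\min\mathcal U$ exists; the connected components of $(1,M+1]\setminus\overline{\mathcal U}$ are intervals $(q_0,q_0^* )$ with $q_0\in\{1\}\cup(\overline{\mathcal U}\setminus\mathcal U)$ and $q_0^*\in\mathcal U$, one of them being $(1,q_{KL})$; for each such component, $\mathcal V\cap(q_0,q_0^* )$ consists of a strictly increasing sequence $q_1<q_2<\cdots$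 converging to $q_0^*$ (the associated sequence). A Cantor set is a nonempty closed set with neither interior points nor isolated points; a perfect set is a nonempty closed set without isolated points; $x$ is a condensation point of $F\subseteq\mathbb R$ if every neighborhood of $x$ contains uncountably many elements of $F$. *)

theory Defs
  imports "HOL-Analysis.Analysis" "HOL-Library.Fun_Lexorder"
begin

section \<open>Sequences and expansions\<close>

text \<open>A sequence \<open>(c\<^sub>i)\<close>, indexed by \<open>i \<ge> 1\<close>, over the alphabet \<open>{0, \<dots>, M}\<close> is represented by
  a function \<open>c :: nat \<Rightarrow> nat\<close>, where \<open>c i\<close> is the digit with index \<open>i + 1\<close>.\<close>

definition digit_seqs :: "nat \<Rightarrow> (nat \<Rightarrow> nat) set" where
  "digit_seqs M = {c. \<forall>i. c i \<le> M}"

definition finite_seq :: "(nat \<Rightarrow> nat) \<Rightarrow> bool" where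
  "finite_seq c \<longleftrightarrow> (\<exists>n. c n \<noteq> 0 \<and> (\<forall>m>n. c m = 0))"

text \<open>The zero sequence has no last nonzero digit, so it counts as infinite.\<close>

definition infinite_seq :: "(nat \<Rightarrow> nat) \<Rightarrow> bool" where
  "infinite_seq c \<longleftrightarrow> \<not> finite_seq c"

definition doubly_infinite :: "nat \<Rightarrow> (nat \<Rightarrow> nat) \<Rightarrow> bool" where
  "doubly_infinite M c \<longleftrightarrow> infinite_seq c \<and> infinite_seq (\<lambda>i. M - c i)"

definition seq_value :: "real \<Rightarrow> (nat \<Rightarrow> nat) \<Rightarrow> real" where
  "seq_value q c = (\<Sum>i. real (c i) / q ^ Suc i)"

definition is_expansion :: "nat \<Rightarrow> real \<Rightarrow> real \<Rightarrow> (nat \<Rightarrow> nat) \<Rightarrow> bool" where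
  "is_expansion M q x c \<longleftrightarrow> c \<in> digit_seqs M \<and> seq_value q c = x"

definition J :: "nat \<Rightarrow> real \<Rightarrow> real set" where
  "J M q = {0 .. real M / (q - 1)}"

text \<open>\<^const>\<open>less_fun\<close> is the strict lexicographic order.\<close>

definition quasi_greedy :: "nat \<Rightarrow> real \<Rightarrow> real \<Rightarrow> (nat \<Rightarrow> nat)" where
  "quasi_greedy M q x =
     (THE c. is_expansion M q x c \<and> infinite_seq c \<and>
        (\<forall>d. is_expansion M q x d \<and> infinite_seq d \<longrightarrow> d = c \<or> less_fun d c))"

section \<open>Univoque bases and univoque sets\<close>

definition U_bases :: "nat \<Rightarrow> real set" where
  "U_bases M = {q. q > 1 \<and> (\<exists>!c. is_expansion M q 1 c)}"

definition V_bases :: "nat \<Rightarrow> real set" where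
  "V_bases M = {q. q > 1 \<and> (\<exists>!c. is_expansion M q 1 c \<and> doubly_infinite M c)}"

definition q_KL :: "nat \<Rightarrow> real" where
  "q_KL M = (LEAST q. q \<in> U_bases M)"

definition U_set :: "nat \<Rightarrow> real \<Rightarrow> real set" where
  "U_set M q = {x \<in> J M q. \<exists>!c. is_expansion M q x c}"

definition V_set :: "nat \<Rightarrow> real \<Rightarrow> real set" where
  "V_set M q =
     (if q = real M + 1 then {0..1}
      else {x \<in> J M q. \<exists>!c. is_expansion M q x c \<and> doubly_infinite M c})"

definition U_seqs :: "nat \<Rightarrow> real \<Rightarrow> (nat \<Rightarrow> nat) set" where
  "U_seqs M q = quasi_greedy M q ` U_set M q"

definition V_seqs :: "nat \<Rightarrow> real \<Rightarrow> (nat \<Rightarrow> nat) set" where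
  "V_seqs M q = quasi_greedy M q ` V_set M q"

definition base_component :: "nat \<Rightarrow> real \<Rightarrow> real \<Rightarrow> bool" where
  "base_component M a b \<longleftrightarrow>
     {a<..<b} \<in> components ({1<..real M + 1} - closure (U_bases M))"

text \<open>The sequence is indexed from 1; the value \<open>Q 0\<close> is irrelevant.\<close>

definition associated_sequence :: "nat \<Rightarrow> real \<Rightarrow> real \<Rightarrow> (nat \<Rightarrow> real) \<Rightarrow> bool" where
  "associated_sequence M a b Q \<longleftrightarrow>
     strict_mono_on {1..} Q \<and> Q ` {1..} = V_bases M \<inter> {a<..<b} \<and> Q \<longlonglongrightarrow> b"

section \<open>Topological notions on the real line\<close>

definition perfect_set :: "real set \<Rightarrow> bool" where
  "perfect_set S \<longleftrightarrow> S \<noteq> {} \<and> closed S \<and> (\<forall>x. \<not> x isolated_in S)"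

definition cantor_set :: "real set \<Rightarrow> bool" where
  "cantor_set S \<longleftrightarrow> S \<noteq> {} \<and> closed S \<and> interior S = {} \<and> (\<forall>x. \<not> x isolated_in S)"

definition accumulation_points :: "real set \<Rightarrow> real set" where
  "accumulation_points S = {x. x islimpt S}"

definition isolated_points :: "real set \<Rightarrow> real set" where
  "isolated_points S = {x. x isolated_in S}"

definition condensation_points :: "real set \<Rightarrow> real set" where
  "condensation_points S = {x. \<forall>T. open T \<and> x \<in> T \<longrightarrow> uncountable (S \<inter> T)}"

definition dense_subset_of :: "real set \<Rightarrow> real set \<Rightarrow> bool" where
  "dense_subset_of D S \<longleftrightarrow> D \<subseteq> S \<and> S \<subseteq> closure D"

end

theory Submission
  imports Defs
begin

text \<open>Let \<open>a\<close> be the quasi-greedy expansion of \<open>1\<close> in base \<open>q\<close>. By Parry's argument the expansions of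
  the points of \<open>V_set M q\<close> (\<open>U_set M q\<close>) are the sequences whose relevant tails and reflected tails
  are at most (strictly below) \<open>a\<close>, and on these sequences agreement of long prefixes amounts to
  closeness of the values. The lexicographic supremum of the relevant tails of such a nonconstant
  sequence is again a quasi-greedy expansion of \<open>1\<close>, in a base belonging to \<open>V_bases M\<close>; hence
  \<open>U_set M q\<close> carries the same sequences as \<open>V_set M p\<close> if no element of \<open>V_bases M\<close> lies
  strictly between \<open>p\<close> and \<open>q\<close>.

  Everything then depends on whether some tail of \<open>a\<close> is the reflection of \<open>a\<close>. If so, a sequence
  that contains a certain finite prefix of \<open>a\<close> is forced to continue like \<open>a\<close>, so that the points of
  \<open>V_set M q - U_set M q\<close> are isolated; they are always dense. If not, then \<open>a\<close> is a limit from below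
  of sequences \<open>u u' u u' \<dots>\<close>, where \<open>u\<close> is a prefix of \<open>a\<close> and \<open>u'\<close> its reflection. This makes
  \<open>U_set M q\<close> dense in \<open>V_set M q\<close> and \<open>q\<close> a left limit point of \<open>V_bases M\<close>. The first case
  therefore occurs for the bases of an associated sequence, and the second one for \<open>q\<close> in the
  closure of \<open>U_bases M\<close>.\<close>

section \<open>Digit sequences and the lexicographic order\<close>

text \<open>Isolation and countability have one source. Suppose \<open>tail k a\<close> is the
  reflection of \<open>a\<close>. Once a relevant tail starts with the first \<open>k\<close> digits
  of \<open>a\<close>, the bound on tails keeps what follows at most the reflection of
  \<open>a\<close>, and the bound on reflected tails keeps it at least that; nothing is free. The
  same squeeze shows that a supremum of relevant tails equal to such an \<open>a\<close> is
  attained. Hence a sequence with this supremum ends in \<open>a\<close> or in its reflection, and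
  countably many such bases yield countably many sequences. So the sequences that appear after
  \<open>q0\<close> create no condensation points, and a sequence whose relevant tails stay strictly
  below \<open>alpha M q\<close> cannot have \<open>alpha M q\<close> as their supremum when a gap
  of \<open>V_bases M\<close> ends at \<open>q\<close>.

  The obstacle at the closure of \<open>U_bases M\<close> is that strict inequalities become weak in
  the limit. Equality would give the limit a tail that is its own reflection, and an expansion of 1
  in a univoque base cannot share its first \<open>2 * k\<close> digits with such a
  sequence.\<close>

abbreviation lex_less :: "(nat \<Rightarrow> nat) \<Rightarrow> (nat \<Rightarrow> nat) \<Rightarrow> bool" (infix "\<sqsubset>" 50)
  where "c \<sqsubset> d \<equiv> less_fun c d"

definition lex_le :: "(nat \<Rightarrow> nat) \<Rightarrow> (nat \<Rightarrow> nat) \<Rightarrow> bool" (infix "\<sqsubseteq>" 50)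
  where "c \<sqsubseteq> d \<longleftrightarrow> c \<sqsubset> d \<or> c = d"

definition agree :: "nat \<Rightarrow> (nat \<Rightarrow> nat) \<Rightarrow> (nat \<Rightarrow> nat) \<Rightarrow> bool"
  where "agree n c d \<longleftrightarrow> (\<forall>i<n. c i = d i)"

definition tail :: "nat \<Rightarrow> (nat \<Rightarrow> nat) \<Rightarrow> (nat \<Rightarrow> nat)"
  where "tail n c = (\<lambda>i. c (n + i))"

definition refl_seq :: "nat \<Rightarrow> (nat \<Rightarrow> nat) \<Rightarrow> (nat \<Rightarrow> nat)"
  where "refl_seq M c = (\<lambda>i. M - c i)"

definition glue :: "nat \<Rightarrow> (nat \<Rightarrow> nat) \<Rightarrow> (nat \<Rightarrow> nat) \<Rightarrow> (nat \<Rightarrow> nat)"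
  where "glue n u s = (\<lambda>i. if i < n then u i else s (i - n))"

lemma agreeD: "agree n c d \<Longrightarrow> i < n \<Longrightarrow> c i = d i"
  by (simp add: agree_def)

lemma agree_refl [simp]: "agree n c c"
  by (simp add: agree_def)

lemma agree_sym: "agree n c d \<Longrightarrow> agree n d c"
  by (simp add: agree_def)

lemma agree_trans: "agree n c d \<Longrightarrow> agree n d e \<Longrightarrow> agree n c e"
  by (simp add: agree_def)

lemma agree_mono: "agree n c d \<Longrightarrow> m \<le> n \<Longrightarrow> agree m c d"
  by (simp add: agree_def)

lemma agree_tail: "agree (n + m) c d \<Longrightarrow> agree m (tail n c) (tail n d)"
  by (simp add: agree_def tail_def)

lemma agree_refl_seq: "agree n c d \<Longrightarrow> agree n (refl_seq M c) (refl_seq M d)"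
  by (simp add: agree_def refl_seq_def)

lemma agree_glue [simp]: "agree n (glue n u s) u"
  by (simp add: agree_def glue_def)

lemma agree_glue_cong: "agree n u u' \<Longrightarrow> agree m s s' \<Longrightarrow> agree (n + m) (glue n u s) (glue n u' s')"
  by (auto simp: agree_def glue_def)

lemma tail_tail [simp]: "tail n (tail m c) = tail (m + n) c"
  by (simp add: tail_def ac_simps)

lemma tail_0 [simp]: "tail 0 c = c"
  by (simp add: tail_def)

lemma tail_apply: "tail n c i = c (n + i)"
  by (simp add: tail_def)

lemma tail_glue [simp]: "tail n (glue n u s) = s"
  by (simp add: tail_def glue_def)

lemma tail_glue_ge: "n \<le> m \<Longrightarrow> tail m (glue n u s) = tail (m - n) s"
  by (auto simp: tail_def glue_def fun_eq_iff)

lemma glue_tail [simp]: "glue n c (tail n c) = c"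
  by (auto simp: tail_apply glue_def fun_eq_iff)

lemma agree_tail_eqI: "agree n c d \<Longrightarrow> tail n c = tail n d \<Longrightarrow> c = d"
  by (metis agree_def ext le_add_diff_inverse not_le tail_apply)

lemma tail_refl_seq: "tail n (refl_seq M c) = refl_seq M (tail n c)"
  by (simp add: tail_def refl_seq_def)

lemma digit_seqs_le: "c \<in> digit_seqs M \<Longrightarrow> c i \<le> M"
  by (simp add: digit_seqs_def)

lemma digit_seqs_tail [simp]: "c \<in> digit_seqs M \<Longrightarrow> tail n c \<in> digit_seqs M"
  by (simp add: tail_apply digit_seqs_def)

lemma digit_seqs_refl_seq [simp]: "refl_seq M c \<in> digit_seqs M"
  by (simp add: digit_seqs_def refl_seq_def)

lemma digit_seqs_glue: "c \<in> digit_seqs M \<Longrightarrow> d \<in> digit_seqs M \<Longrightarrow> glue n c d \<in> digit_seqs M"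
  by (simp add: digit_seqs_def glue_def)

lemma refl_seq_refl_seq [simp]: "c \<in> digit_seqs M \<Longrightarrow> refl_seq M (refl_seq M c) = c"
  by (simp add: digit_seqs_def refl_seq_def)

lemma first_difference:
  assumes "c \<noteq> (d :: nat \<Rightarrow> nat)"
  obtains n where "agree n c d" "c n \<noteq> d n"
proof -
  have "\<exists>n. c n \<noteq> d n" using assms by auto
  then have "c (LEAST n. c n \<noteq> d n) \<noteq> d (LEAST n. c n \<noteq> d n)" by (rule LeastI_ex)
  moreover have "agree (LEAST n. c n \<noteq> d n) c d"
    using not_less_Least by (auto simp: agree_def)
  ultimately show ?thesis using that by blast
qed

lemma lex_less_iff: "c \<sqsubset> d \<longleftrightarrow> (\<exists>n. agree n c d \<and> c n < d n)"
  by (auto simp: less_fun_def agree_def)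

lemma lex_lessI: "agree n c d \<Longrightarrow> c n < d n \<Longrightarrow> c \<sqsubset> d"
  using lex_less_iff by blast

lemma lex_lessE:
  assumes "c \<sqsubset> d"
  obtains n where "agree n c d" "c n < d n"
  using assms lex_less_iff by blast

lemma lex_less_agree_iff: "agree n c d \<Longrightarrow> c n \<noteq> d n \<Longrightarrow> c \<sqsubset> d \<longleftrightarrow> c n < d n"
  by (metis agree_sym less_fun_asym lex_lessI linorder_neqE_nat)

lemma lex_less_linear: "c \<sqsubset> d \<or> c = d \<or> d \<sqsubset> c"
  by (metis agree_sym first_difference lex_lessI linorder_neqE_nat)

lemma lex_less_irrefl [simp]: "(c \<sqsubset> c) = False"
  using less_fun_irrefl by blast

lemma lex_less_imp_le: "c \<sqsubset> d \<Longrightarrow> c \<sqsubseteq> d"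
  by (simp add: lex_le_def)

lemma lex_le_refl [simp]: "c \<sqsubseteq> c"
  by (simp add: lex_le_def)

lemma not_lex_less [simp]: "\<not> c \<sqsubset> d \<longleftrightarrow> d \<sqsubseteq> c"
  unfolding lex_le_def using lex_less_linear less_fun_asym less_fun_irrefl by metis

lemma not_lex_le [simp]: "\<not> c \<sqsubseteq> d \<longleftrightarrow> d \<sqsubset> c"
  using not_lex_less by blast

lemma lex_le_antisym: "c \<sqsubseteq> d \<Longrightarrow> d \<sqsubseteq> c \<Longrightarrow> c = d"
  unfolding lex_le_def using less_fun_asym by blast

lemma lex_le_trans: "c \<sqsubseteq> d \<Longrightarrow> d \<sqsubseteq> e \<Longrightarrow> c \<sqsubseteq> e"
  unfolding lex_le_def using less_fun_trans by blast

lemma lex_less_le_trans: "c \<sqsubset> d \<Longrightarrow> d \<sqsubseteq> e \<Longrightarrow> c \<sqsubset> e"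
  unfolding lex_le_def using less_fun_trans by blast

lemma lex_le_less_trans: "c \<sqsubseteq> d \<Longrightarrow> d \<sqsubset> e \<Longrightarrow> c \<sqsubset> e"
  unfolding lex_le_def using less_fun_trans by blast

lemma lex_less_tail_iff:
  assumes "agree n c d"
  shows "c \<sqsubset> d \<longleftrightarrow> tail n c \<sqsubset> tail n d"
proof (cases "c = d")
  case False
  then obtain m where m: "agree m c d" "c m \<noteq> d m" by (rule first_difference)
  have "n \<le> m" using assms m(2) by (meson agree_def not_le)
  then have "agree (m - n) (tail n c) (tail n d)" "tail n c (m - n) = c m" "tail n d (m - n) = d m"
    using m(1) by (auto simp: tail_apply agree_def)
  then show ?thesis using m by (simp add: lex_less_agree_iff)
qed (auto dest: less_fun_asym)

lemma lex_le_tail_iff: "agree n c d \<Longrightarrow> c \<sqsubseteq> d \<longleftrightarrow> tail n c \<sqsubseteq> tail n d"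
  using lex_less_tail_iff[of n d c] agree_sym[of n c d] not_lex_less by metis

lemma lex_le_agree_le: "c \<sqsubseteq> d \<Longrightarrow> agree n c d \<Longrightarrow> c n \<le> d n"
  by (metis agree_sym lex_lessI not_le not_lex_le)

lemma lex_le_const: "c \<in> digit_seqs M \<Longrightarrow> c \<sqsubseteq> (\<lambda>_. M)"
  by (metis digit_seqs_le lex_lessE not_le not_lex_le)

text \<open>The first difference decides, so strict inequalities are open conditions in the topology
  of prefixes. Dually, weak ones are closed, which is \<open>lex_le_closed\<close>.\<close>

lemma lex_less_locally_constant:
  assumes "c \<sqsubset> d"
  obtains N where "\<And>c' d'. agree N c' c \<Longrightarrow> agree N d' d \<Longrightarrow> c' \<sqsubset> d'"
proof -
  obtain n where n: "agree n c d" "c n < d n" using assms by (rule lex_lessE)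
  have "c' \<sqsubset> d'" if "agree (Suc n) c' c" "agree (Suc n) d' d" for c' d'
    using that n by (intro lex_lessI[of n]) (auto simp: agree_def)
  then show ?thesis using that by blast
qed

lemma lex_le_closed:
  assumes "\<And>N. \<exists>c' d'. agree N c' c \<and> agree N d' d \<and> c' \<sqsubseteq> d'"
  shows "c \<sqsubseteq> d"
proof (rule ccontr)
  assume "\<not> c \<sqsubseteq> d"
  then have "d \<sqsubset> c" by simp
  then show False
  proof (rule lex_less_locally_constant)
    fix N assume "\<And>d' c'. agree N d' d \<Longrightarrow> agree N c' c \<Longrightarrow> d' \<sqsubset> c'"
    then show False using assms[of N] by (metis not_lex_le)
  qed
qed

lemma refl_seq_less_iff:
  assumes "c \<in> digit_seqs M" "d \<in> digit_seqs M"
  shows "refl_seq M c \<sqsubset> refl_seq M d \<longleftrightarrow> d \<sqsubset> c"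
proof -
  have *: "refl_seq M c \<sqsubset> refl_seq M d"
    if dc: "d \<sqsubset> c" and c: "c \<in> digit_seqs M" for c d
  proof -
    obtain n where n: "agree n d c" "d n < c n" using dc by (rule lex_lessE)
    show ?thesis
    proof (rule lex_lessI[of n])
      show "agree n (refl_seq M c) (refl_seq M d)" using n(1) by (simp add: agree_refl_seq agree_sym)
      show "refl_seq M c n < refl_seq M d n"
        using n(2) digit_seqs_le[OF c, of n] by (simp add: refl_seq_def)
    qed
  qed
  show ?thesis using *[where c = c and d = d] *[where c = "refl_seq M d" and d = "refl_seq M c"] assms by auto
qed

lemma refl_seq_le_iff:
  assumes "c \<in> digit_seqs M" "d \<in> digit_seqs M"
  shows "refl_seq M c \<sqsubseteq> refl_seq M d \<longleftrightarrow> d \<sqsubseteq> c"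
  using refl_seq_less_iff[of d M c] assms not_lex_less by metis

lemma refl_seq_swap:
  assumes "c \<in> digit_seqs M" "d \<in> digit_seqs M"
  shows "refl_seq M c \<sqsubset> d \<longleftrightarrow> refl_seq M d \<sqsubset> c"
    and "refl_seq M c \<sqsubseteq> d \<longleftrightarrow> refl_seq M d \<sqsubseteq> c"
  using refl_seq_less_iff[of c M "refl_seq M d"] refl_seq_le_iff[of c M "refl_seq M d"] assms
  by auto

text \<open>Koenig's lemma: the digit sequences form a compact space.\<close>

lemma cluster_sequence:
  assumes "\<And>j. X j \<in> digit_seqs M"
  shows "\<exists>\<gamma>\<in>digit_seqs M. \<forall>N. infinite {j :: nat. agree N (X j) \<gamma>}"
proof -
  have ex: "\<exists>v\<le>M. infinite {j \<in> S. X j n = v}" if "infinite S" for S n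
  proof (rule ccontr)
    assume "\<not> ?thesis"
    then have "finite (\<Union>v\<in>{..M}. {j \<in> S. X j n = v})" by auto
    moreover have "(\<Union>v\<in>{..M}. {j \<in> S. X j n = v}) = S"
      using assms by (auto simp: digit_seqs_def)
    ultimately show False using that by simp
  qed
  define v where "v = (\<lambda>S n. SOME v. v \<le> M \<and> infinite {j \<in> S. X j n = v})"
  have v: "v S n \<le> M \<and> infinite {j \<in> S. X j n = v S n}" if "infinite S" for S n
    unfolding v_def by (rule someI_ex) (use ex[OF that] in blast)
  define S where "S = rec_nat UNIV (\<lambda>n S. {j \<in> S. X j n = v S n})"
  have S0: "S 0 = UNIV" and SS: "S (Suc n) = {j \<in> S n. X j n = v (S n) n}" for n
    by (simp_all add: S_def)
  have inf: "infinite (S n)" for n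
    by (induction n) (use v in \<open>auto simp: S0 SS\<close>)
  define \<gamma> where "\<gamma> = (\<lambda>n. v (S n) n)"
  have agr: "S n \<subseteq> {j. agree n (X j) \<gamma>}" for n
    by (induction n) (auto simp: S0 SS agree_def less_Suc_eq \<gamma>_def)
  show ?thesis
  proof (intro bexI allI)
    show "\<gamma> \<in> digit_seqs M" using v inf by (auto simp: digit_seqs_def \<gamma>_def)
    show "infinite {j. agree N (X j) \<gamma>}" for N
      using inf[of N] agr[of N] infinite_super by blast
  qed
qed

text \<open>Digits are maximised one at a time: \<open>S n\<close> keeps the members of
  \<open>T\<close> whose first \<open>n\<close> digits are the best possible. The supremum need not
  lie in \<open>T\<close>, but every prefix of it occurs in a member.\<close>

lemma lex_supremum:
  assumes "T \<noteq> {}" "T \<subseteq> digit_seqs M"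
  obtains \<beta> where "\<beta> \<in> digit_seqs M" "\<And>d. d \<in> T \<Longrightarrow> d \<sqsubseteq> \<beta>" "\<And>N. \<exists>d\<in>T. agree N d \<beta>"
proof -
  have fin: "finite ((\<lambda>d. d n) ` S)" if "S \<subseteq> T" for S n
    by (rule finite_subset[of _ "{..M}"]) (use that assms(2) in \<open>auto simp: digit_seqs_def\<close>)
  define S where "S = rec_nat T (\<lambda>n S. {d \<in> S. d n = Max ((\<lambda>d. d n) ` S)})"
  have S0: "S 0 = T" and SS: "S (Suc n) = {d \<in> S n. d n = Max ((\<lambda>d. d n) ` S n)}" for n
    by (simp_all add: S_def)
  have sub: "S n \<subseteq> T" for n by (induction n) (auto simp: S0 SS)
  have ne: "S n \<noteq> {}" for n
  proof (induction n)
    case (Suc n)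
    have "Max ((\<lambda>d. d n) ` S n) \<in> (\<lambda>d. d n) ` S n"
      using fin[OF sub] Suc by (intro Max_in) auto
    then show ?case by (auto simp: SS)
  qed (use assms in \<open>simp add: S0\<close>)
  define \<beta> where "\<beta> = (\<lambda>n. Max ((\<lambda>d. d n) ` S n))"
  have S_eq: "S n = {d \<in> T. agree n d \<beta>}" for n
    by (induction n) (auto simp: S0 SS agree_def less_Suc_eq \<beta>_def)
  show ?thesis
  proof (rule that[of \<beta>])
    show ex: "\<exists>d\<in>T. agree N d \<beta>" for N using ne[of N] by (auto simp: S_eq)
    show "\<beta> \<in> digit_seqs M"
      unfolding digit_seqs_def
    proof safe
      fix i
      obtain d where "d \<in> T" "agree (Suc i) d \<beta>" using ex by blast
      then show "\<beta> i \<le> M" using assms(2) by (metis agreeD digit_seqs_le lessI subsetD)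
    qed
    show "d \<sqsubseteq> \<beta>" if "d \<in> T" for d
    proof (rule ccontr)
      assume "\<not> d \<sqsubseteq> \<beta>"
      then obtain n where n: "agree n \<beta> d" "\<beta> n < d n" by (auto elim: lex_lessE)
      then have "d \<in> S n" using that agree_sym by (simp add: S_eq)
      then have "d n \<le> \<beta> n" unfolding \<beta>_def using fin[OF sub] by (intro Max_ge) auto
      then show False using n by simp
    qed
  qed
qed

text \<open>A sequence with a prescribed tail is determined by a finite prefix.\<close>

lemma countable_eventually:
  fixes \<beta> :: "nat \<Rightarrow> nat"
  shows "countable {c. \<exists>n. tail n c = \<beta>}"
proof (rule countable_subset)
  show "{c. \<exists>n. tail n c = \<beta>} \<subseteq> range (\<lambda>u. glue (length u) (\<lambda>i. u ! i) \<beta>)"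
  proof safe
    fix c n assume "\<beta> = tail n c"
    then have "c = glue (length (map c [0..<n])) (\<lambda>i. map c [0..<n] ! i) (tail n c)"
      by (auto simp: tail_apply glue_def fun_eq_iff)
    then show "c \<in> range (\<lambda>u. glue (length u) (\<lambda>i. u ! i) (tail n c))" by blast
  qed
qed simp

lemma countable_eventually_refl:
  fixes \<beta> :: "nat \<Rightarrow> nat"
  shows "countable {c \<in> digit_seqs M. \<exists>n. refl_seq M (tail n c) = \<beta>}"
  by (rule countable_subset[OF _ countable_eventually[of "refl_seq M \<beta>"]]) fastforce

lemma infinite_seq_iff: "infinite_seq c \<longleftrightarrow> (\<forall>n. c n \<noteq> 0 \<longrightarrow> (\<exists>m>n. c m \<noteq> 0))"
  unfolding infinite_seq_def finite_seq_def by metis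

lemma infinite_seq_tail: "infinite_seq c \<Longrightarrow> infinite_seq (tail n c)"
  unfolding infinite_seq_iff
proof (intro allI impI)
  fix m assume c: "\<forall>n. c n \<noteq> 0 \<longrightarrow> (\<exists>m>n. c m \<noteq> 0)" and "tail n c m \<noteq> 0"
  then obtain k where "k > n + m" "c k \<noteq> 0" by (auto simp: tail_apply)
  then have "k - n > m \<and> tail n c (k - n) \<noteq> 0" by (simp add: tail_apply)
  then show "\<exists>k>m. tail n c k \<noteq> 0" by blast
qed

section \<open>Values of digit sequences\<close>

lemma summable_value:
  assumes "q > 1" "c \<in> digit_seqs M"
  shows "summable (\<lambda>i. real (c i) / q ^ Suc i)"
proof (rule summable_comparison_test')
  have "summable (\<lambda>i. real M / q * (1 / q) ^ i)"
    using assms by (intro summable_mult summable_geometric) auto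
  then show "summable (\<lambda>i. real M / q ^ Suc i)" by (simp add: power_one_over field_simps)
  show "norm (real (c i) / q ^ Suc i) \<le> real M / q ^ Suc i" for i
    using assms by (simp add: divide_right_mono digit_seqs_le)
qed

lemma value_nonneg: "q > 1 \<Longrightarrow> c \<in> digit_seqs M \<Longrightarrow> 0 \<le> seq_value q c"
  unfolding seq_value_def by (intro suminf_nonneg summable_value) auto

lemma value_pos: "q > 1 \<Longrightarrow> c \<in> digit_seqs M \<Longrightarrow> c i > 0 \<Longrightarrow> 0 < seq_value q c"
  unfolding seq_value_def by (rule suminf_pos2[of _ i]) (auto simp del: power_Suc intro: summable_value)

lemma value_step:
  assumes "q > 1" "c \<in> digit_seqs M"
  shows "seq_value q c = (real (c 0) + seq_value q (tail 1 c)) / q"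
proof -
  have "seq_value q c = real (c 0) / q + (\<Sum>i. real (c (Suc i)) / q ^ Suc (Suc i))"
    unfolding seq_value_def using suminf_split_head[OF summable_value[OF assms]] by simp
  also have "(\<Sum>i. real (c (Suc i)) / q ^ Suc (Suc i)) = (\<Sum>i. real (tail 1 c i) / q ^ Suc i / q)"
    by (simp add: field_simps tail_apply)
  also have "\<dots> = seq_value q (tail 1 c) / q"
    unfolding seq_value_def
    by (rule suminf_divide) (use assms in \<open>auto simp del: power_Suc intro!: summable_value digit_seqs_tail\<close>)
  finally show ?thesis by (simp add: add_divide_distrib)
qed

lemma value_tail_Suc:
  assumes "q > 1" "c \<in> digit_seqs M"
  shows "seq_value q (tail (Suc n) c) = q * seq_value q (tail n c) - real (c n)"
  using value_step[of q "tail n c" M] assms by (simp add: tail_apply)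

lemma value_const: "q > 1 \<Longrightarrow> seq_value q (\<lambda>_. m) = real m / (q - 1)"
  using value_step[of q "\<lambda>_. m" m] by (simp add: digit_seqs_def tail_def field_simps)

lemma value_refl_seq:
  assumes "q > 1" "c \<in> digit_seqs M"
  shows "seq_value q (refl_seq M c) = real M / (q - 1) - seq_value q c"
proof -
  have "(\<lambda>i. real (refl_seq M c i) / q ^ Suc i) = (\<lambda>i. real M / q ^ Suc i - real (c i) / q ^ Suc i)"
    using digit_seqs_le[OF assms(2)] by (simp add: refl_seq_def of_nat_diff diff_divide_distrib)
  then have "seq_value q (refl_seq M c) = seq_value q (\<lambda>_. M) - seq_value q c"
    unfolding seq_value_def
    using suminf_diff[OF summable_value[of q "\<lambda>_. M" M] summable_value[OF assms]] assms
    by (simp add: digit_seqs_def)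
  then show ?thesis using assms by (simp add: value_const)
qed

lemma value_le: "q > 1 \<Longrightarrow> c \<in> digit_seqs M \<Longrightarrow> seq_value q c \<le> real M / (q - 1)"
  using value_nonneg[of q "refl_seq M c" M] value_refl_seq[of q c M] by simp

lemma value_diff_agree:
  assumes "q > 1" "c \<in> digit_seqs M" "d \<in> digit_seqs M" "agree n c d"
  shows "seq_value q c - seq_value q d = (seq_value q (tail n c) - seq_value q (tail n d)) / q ^ n"
  using assms(4)
proof (induction n)
  case (Suc n)
  then have "agree n c d" "c n = d n" by (auto simp: agree_def)
  with Suc.IH show ?case
    using assms(1) by (simp add: value_tail_Suc[OF assms(1,2)] value_tail_Suc[OF assms(1,3)]
        right_diff_distrib[symmetric])
qed simp

lemma value_less_agree_iff:
  assumes "q > 1" "c \<in> digit_seqs M" "d \<in> digit_seqs M" "agree n c d"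
  shows "seq_value q c < seq_value q d \<longleftrightarrow> seq_value q (tail n c) < seq_value q (tail n d)"
    and "seq_value q c = seq_value q d \<longleftrightarrow> seq_value q (tail n c) = seq_value q (tail n d)"
proof -
  have "q ^ n > 0" using assms by simp
  then have "(seq_value q (tail n c) - seq_value q (tail n d)) / q ^ n < 0
      \<longleftrightarrow> seq_value q (tail n c) < seq_value q (tail n d)"
    "(seq_value q (tail n c) - seq_value q (tail n d)) / q ^ n = 0
      \<longleftrightarrow> seq_value q (tail n c) = seq_value q (tail n d)"
    using assms(1) by (auto simp: divide_less_0_iff)
  then show "seq_value q c < seq_value q d \<longleftrightarrow> seq_value q (tail n c) < seq_value q (tail n d)"
    and "seq_value q c = seq_value q d \<longleftrightarrow> seq_value q (tail n c) = seq_value q (tail n d)"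
    using value_diff_agree[OF assms] by linarith+
qed

lemma value_near:
  assumes "q > 1" "e > 0"
  obtains N where "\<And>c d. c \<in> digit_seqs M \<Longrightarrow> d \<in> digit_seqs M \<Longrightarrow> agree N c d \<Longrightarrow>
    \<bar>seq_value q c - seq_value q d\<bar> < e"
proof -
  have "(\<lambda>N. real M / (q - 1) * (1 / q) ^ N) \<longlonglongrightarrow> real M / (q - 1) * 0"
    using assms by (intro tendsto_intros LIMSEQ_power_zero) auto
  then have "eventually (\<lambda>N. real M / (q - 1) * (1 / q) ^ N < e) sequentially"
    using assms order_tendstoD(2) by fastforce
  then obtain N where N: "real M / (q - 1) / q ^ N < e"
    by (auto simp: eventually_sequentially power_one_over)
  have "\<bar>seq_value q c - seq_value q d\<bar> < e"
    if cd: "c \<in> digit_seqs M" "d \<in> digit_seqs M" "agree N c d" for c d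
  proof -
    have "\<bar>seq_value q (tail N c) - seq_value q (tail N d)\<bar> \<le> real M / (q - 1)"
      using value_nonneg[of q "tail N c" M] value_nonneg[of q "tail N d" M]
        value_le[of q "tail N c" M] value_le[of q "tail N d" M] cd assms by auto
    then have "\<bar>seq_value q c - seq_value q d\<bar> \<le> real M / (q - 1) / q ^ N"
      using value_diff_agree[of q c M d N] cd assms
      by (simp add: divide_right_mono del: divide_divide_eq_left)
    then show ?thesis using N by simp
  qed
  then show ?thesis using that by blast
qed

text \<open>The recursion expands by the factor \<open>q\<close>, so a deviation from the true
  remainders would grow like \<open>q ^ n\<close>; boundedness leaves only deviation 0.\<close>

lemma value_unique:
  assumes "q > 1" "c \<in> digit_seqs M"
    and step: "\<And>n. r (Suc n) = q * r n - real (c n)" and B: "\<And>n. \<bar>r n\<bar> \<le> B"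
  shows "seq_value q c = r 0"
proof -
  have D: "seq_value q (tail n c) - r n = q ^ n * (seq_value q c - r 0)" for n
  proof (induction n)
    case (Suc n)
    have "seq_value q (tail (Suc n) c) - r (Suc n) = q * (seq_value q (tail n c) - r n)"
      by (simp add: step value_tail_Suc[OF assms(1,2)] right_diff_distrib)
    then show ?case by (simp add: Suc)
  qed simp
  have "\<bar>seq_value q c - r 0\<bar> \<le> (real M / (q - 1) + B) * (1 / q) ^ n" for n
  proof -
    have "\<bar>seq_value q (tail n c) - r n\<bar> \<le> real M / (q - 1) + B"
      using value_nonneg[of q "tail n c" M] value_le[of q "tail n c" M] assms(1,2) B[of n] by auto
    then have "q ^ n * \<bar>seq_value q c - r 0\<bar> \<le> real M / (q - 1) + B"
      unfolding D using assms(1) by (simp add: abs_mult)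
    then show ?thesis using assms(1) by (simp add: field_simps power_one_over)
  qed
  moreover have "(\<lambda>n. (real M / (q - 1) + B) * (1 / q) ^ n) \<longlonglongrightarrow> (real M / (q - 1) + B) * 0"
    using assms(1) by (intro tendsto_intros LIMSEQ_power_zero) auto
  ultimately have "\<bar>seq_value q c - r 0\<bar> \<le> 0"
    by (metis LIMSEQ_le_const mult_zero_right)
  then show ?thesis by simp
qed

lemma value_base_mono:
  assumes "1 < p" "p \<le> q" "c \<in> digit_seqs M"
  shows "seq_value q c \<le> seq_value p c"
  unfolding seq_value_def
proof (rule suminf_le)
  show "real (c n) / q ^ Suc n \<le> real (c n) / p ^ Suc n" for n
    using assms by (intro divide_left_mono power_mono mult_pos_pos) auto
qed (use assms in \<open>auto simp del: power_Suc intro: summable_value\<close>)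

lemma value_base_strict_mono:
  assumes "1 < p" "p < q" "c \<in> digit_seqs M" "c i > 0"
  shows "seq_value q c < seq_value p c"
proof -
  have q: "q > 1" using assms by simp
  have "0 < (\<Sum>i. real (c i) / p ^ Suc i - real (c i) / q ^ Suc i)"
  proof (rule suminf_pos2[of _ i])
    show "summable (\<lambda>i. real (c i) / p ^ Suc i - real (c i) / q ^ Suc i)"
      using assms q by (intro summable_diff summable_value) auto
    show "0 \<le> real (c n) / p ^ Suc n - real (c n) / q ^ Suc n" for n
      using assms by (simp del: power_Suc, intro divide_left_mono power_mono mult_pos_pos) auto
    have "p ^ Suc i < q ^ Suc i" using assms by (intro power_strict_mono) auto
    then show "0 < real (c i) / p ^ Suc i - real (c i) / q ^ Suc i"
      using assms q by (simp del: power_Suc add: divide_strict_left_mono)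
  qed
  then show ?thesis
    unfolding seq_value_def
    using suminf_diff[OF summable_value[OF assms(1,3)] summable_value[OF q assms(3)]] by simp
qed

text \<open>In the variable \<open>1 / t\<close> the value is a power series. A base
  \<open>p\<close> strictly between 1 and \<open>q\<close> is a point of convergence farther out
  than \<open>1 / q\<close>.\<close>

lemma value_isCont_base:
  assumes "q > 1" "c \<in> digit_seqs M"
  shows "isCont (\<lambda>q. seq_value q c) q"
proof -
  define p where "p = (1 + q) / 2"
  have p: "1 < p" "p < q" using assms by (auto simp: p_def)
  have summ: "summable (\<lambda>i. real (c i) * (1 / t) ^ i)" if "t > 1" for t
    using summable_mult2[OF summable_value[OF that assms(2)], of t] that
    by (simp add: power_one_over)
  note s = summ[OF p(1)]
  have eq: "seq_value t c = (1 / t) * (\<Sum>i. real (c i) * (1 / t) ^ i)" if "t > 1" for t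
    using suminf_mult[OF summ[OF that], of "1 / t"]
    unfolding seq_value_def by (simp add: power_one_over mult.commute)
  have "isCont (\<lambda>t. (1 / t) * (\<Sum>i. real (c i) * (1 / t) ^ i)) q"
  proof (intro isCont_mult isCont_powser'[OF _ s])
    show "isCont (\<lambda>t. 1 / t) q" "isCont (\<lambda>t. 1 / t) q" using assms by (auto intro!: continuous_intros)
    show "norm (1 / q) < norm (1 / p)" using p by (simp add: field_simps)
  qed
  moreover have "eventually (\<lambda>t. (1 / t) * (\<Sum>i. real (c i) * (1 / t) ^ i) = seq_value t c) (nhds q)"
  proof (rule eventually_mono)
    show "eventually (\<lambda>t. t \<in> {1<..}) (nhds q)"
      using assms(1) by (intro eventually_nhds_in_open) auto
  qed (metis eq greaterThan_iff)
  ultimately show ?thesis by (rule isCont_cong[THEN iffD1, rotated])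
qed

section \<open>Quasi-greedy expansions\<close>

lemma infinite_seq_tail_pos:
  assumes "q > 1" "c \<in> digit_seqs M" "infinite_seq c" "c n > 0"
  shows "seq_value q (tail (Suc n) c) > 0"
proof -
  obtain m where "m > n" "c m > 0" using assms by (auto simp: infinite_seq_iff)
  then have "tail (Suc n) c (m - Suc n) > 0" by (simp add: tail_apply)
  then show ?thesis using value_pos assms digit_seqs_tail by blast
qed

text \<open>The bound by 1 on remainders after a digit below \<open>M\<close> is what later
  identifies the quasi-greedy expansion. For \<open>x > 0\<close> all remainders of the algorithm
  stay positive, which makes the expansion infinite; \<open>x = 0\<close> has the zero
  sequence.\<close>

lemma quasi_greedy_exists:
  assumes "1 < q" "q \<le> real M + 1" "x \<in> J M q"
  obtains c where "is_expansion M q x c" "infinite_seq c"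
    "\<And>n. c n < M \<Longrightarrow> seq_value q (tail (Suc n) c) \<le> 1"
proof (cases "x = 0")
  case True
  show ?thesis
    by (rule that[of "\<lambda>_. 0"])
      (use True assms value_const[of q 0] in
        \<open>auto simp: is_expansion_def digit_seqs_def infinite_seq_iff tail_def\<close>)
next
  case False
  define K where "K = real M / (q - 1)"
  have K1: "1 \<le> K" using assms by (simp add: K_def field_simps)
  \<comment> \<open>\<open>\<lceil>q * r\<rceil> - 1\<close> is the largest integer strictly below
    \<open>q * r\<close>, so the next remainder is positive even when \<open>q * r\<close> is an
    integer.\<close>
  define a where "a = (\<lambda>r. min M (nat (\<lceil>q * r\<rceil> - 1)))"
  define r where "r = rec_nat x (\<lambda>_ r. q * r - real (a r))"
  have r0: "r 0 = x" and rS: "r (Suc n) = q * r n - real (a (r n))" for n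
    by (simp_all add: r_def)
  have step: "0 < q * s - real (a s) \<and> q * s - real (a s) \<le> K
      \<and> (a s < M \<longrightarrow> q * s - real (a s) \<le> 1)" if s: "0 < s" "s \<le> K" for s
  proof -
    have qs: "q * s > 0" using s assms by simp
    have c1: "real (nat (\<lceil>q * s\<rceil> - 1)) < q * s" and c2: "q * s \<le> real (nat (\<lceil>q * s\<rceil> - 1)) + 1"
    proof -
      have "\<lceil>q * s\<rceil> \<ge> 1" using qs by simp
      then have "real (nat (\<lceil>q * s\<rceil> - 1)) = real_of_int \<lceil>q * s\<rceil> - 1" by simp
      then show "real (nat (\<lceil>q * s\<rceil> - 1)) < q * s" "q * s \<le> real (nat (\<lceil>q * s\<rceil> - 1)) + 1"
        using ceiling_correct[of "q * s"] by linarith+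
    qed
    show ?thesis
    proof (cases "nat (\<lceil>q * s\<rceil> - 1) < M")
      case True
      then have "a s = nat (\<lceil>q * s\<rceil> - 1)" by (simp add: a_def)
      then show ?thesis using c1 c2 K1 by linarith
    next
      case F: False
      then have "a s = M" by (simp add: a_def)
      moreover have "q * s - real M \<le> K"
      proof -
        have "q * s \<le> q * K" using s assms by simp
        also have "q * K = K + real M" using assms(1) by (simp add: K_def field_simps)
        finally show ?thesis by simp
      qed
      ultimately show ?thesis using c1 F by auto
    qed
  qed
  have x: "0 < x" "x \<le> K" using assms False by (auto simp: J_def K_def)
  have r: "0 < r n \<and> r n \<le> K" for n
    by (induction n) (use step x in \<open>auto simp: r0 rS\<close>)
  define c where "c = (\<lambda>n. a (r n))"
  have cM: "c \<in> digit_seqs M" by (auto simp: digit_seqs_def c_def a_def)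
  have val: "seq_value q (tail n c) = r n" for n
  proof -
    have "seq_value q (tail n c) = r (n + 0)"
      by (rule value_unique[where B = K and M = M and r = "\<lambda>i. r (n + i)"])
        (use r assms(1) cM in \<open>auto simp: rS c_def tail_apply less_imp_le digit_seqs_def\<close>)
    then show ?thesis by simp
  qed
  show ?thesis
  proof (rule that[of c])
    show "is_expansion M q x c" using val[of 0] cM by (simp add: is_expansion_def r0)
    show "infinite_seq c"
      unfolding infinite_seq_iff
    proof (intro allI impI, rule ccontr)
      fix n assume "\<not> (\<exists>m>n. c m \<noteq> 0)"
      then have "tail (Suc n) c = (\<lambda>_. 0)" by (auto simp: tail_def)
      then have "r (Suc n) = 0" using val[of "Suc n"] value_const[of q 0] assms(1) by simp
      then show False using r[of "Suc n"] by simp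
    qed
    show "seq_value q (tail (Suc n) c) \<le> 1" if "c n < M" for n
      using that step[of "r n"] r[of n] unfolding val rS by (auto simp: c_def)
  qed
qed

text \<open>An infinite competitor with a larger digit at the first difference has a positive
  remainder there, so equal values would force the remainder of \<open>c\<close> above 1.\<close>

lemma quasi_greedy_maximal:
  assumes "q > 1" "is_expansion M q x c"
    and c: "\<And>n. c n < M \<Longrightarrow> seq_value q (tail (Suc n) c) \<le> 1"
    and d: "is_expansion M q x d" "infinite_seq d"
  shows "d \<sqsubseteq> c"
proof (rule ccontr)
  assume "\<not> d \<sqsubseteq> c"
  then obtain n where n: "agree n c d" "c n < d n" by (auto elim: lex_lessE)
  have D: "c \<in> digit_seqs M" "d \<in> digit_seqs M" using assms by (auto simp: is_expansion_def)
  have "seq_value q (tail n c) = seq_value q (tail n d)"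
    using value_less_agree_iff(2)[OF assms(1) D n(1)] assms by (simp add: is_expansion_def)
  moreover have "seq_value q (tail (Suc n) d) > 0"
    using infinite_seq_tail_pos[of q d M n] assms(1) D d n by simp
  moreover have "seq_value q (tail (Suc n) c) \<le> 1"
    using c[of n] n digit_seqs_le[OF D(2), of n] by simp
  moreover have "real (c n) + 1 \<le> real (d n)" using n by simp
  ultimately show False
    using value_tail_Suc[OF assms(1) D(1), of n] value_tail_Suc[OF assms(1) D(2), of n] by simp
qed

lemma quasi_greedy_eqI:
  assumes "q > 1" "is_expansion M q x c" "infinite_seq c"
    and "\<And>n. c n < M \<Longrightarrow> seq_value q (tail (Suc n) c) \<le> 1"
  shows "quasi_greedy M q x = c"
  unfolding quasi_greedy_def
proof (rule the_equality)
  show "is_expansion M q x c \<and> infinite_seq c \<and>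
      (\<forall>d. is_expansion M q x d \<and> infinite_seq d \<longrightarrow> d = c \<or> less_fun d c)"
    using quasi_greedy_maximal[OF assms(1,2,4)] assms by (auto simp: lex_le_def)
  fix c'
  assume "is_expansion M q x c' \<and> infinite_seq c' \<and>
      (\<forall>d. is_expansion M q x d \<and> infinite_seq d \<longrightarrow> d = c' \<or> less_fun d c')"
  then show "c' = c"
    using quasi_greedy_maximal[OF assms(1,2,4)] assms by (metis lex_le_def less_fun_asym)
qed

lemma quasi_greedy_props:
  assumes "1 < q" "q \<le> real M + 1" "x \<in> J M q"
  shows "is_expansion M q x (quasi_greedy M q x)" "infinite_seq (quasi_greedy M q x)"
    "quasi_greedy M q x n < M \<Longrightarrow> seq_value q (tail (Suc n) (quasi_greedy M q x)) \<le> 1"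
proof -
  obtain c where c: "is_expansion M q x c" "infinite_seq c"
    "\<And>n. c n < M \<Longrightarrow> seq_value q (tail (Suc n) c) \<le> 1"
    using quasi_greedy_exists[OF assms] by blast
  then have "quasi_greedy M q x = c" using quasi_greedy_eqI assms(1) by blast
  then show "is_expansion M q x (quasi_greedy M q x)" "infinite_seq (quasi_greedy M q x)"
    "quasi_greedy M q x n < M \<Longrightarrow> seq_value q (tail (Suc n) (quasi_greedy M q x)) \<le> 1"
    using c by auto
qed

section \<open>Lexicographic characterisations\<close>

abbreviation alpha :: "nat \<Rightarrow> real \<Rightarrow> (nat \<Rightarrow> nat)"
  where "alpha M q \<equiv> quasi_greedy M q 1"

text \<open>Usually only the tails starting directly after a digit below \<open>M\<close> (above \<open>0\<close>) are constrained.
  Constraining all later tails as well is equivalent for the sequences \<open>a\<close> considered here, and it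
  makes the set of constrained tails closed under shifts.\<close>

definition V_adm :: "nat \<Rightarrow> (nat \<Rightarrow> nat) \<Rightarrow> (nat \<Rightarrow> nat) set"
  where "V_adm M a = {c \<in> digit_seqs M. \<forall>n.
    ((\<exists>i<n. c i < M) \<longrightarrow> tail n c \<sqsubseteq> a) \<and> ((\<exists>i<n. c i > 0) \<longrightarrow> refl_seq M (tail n c) \<sqsubseteq> a)}"

definition U_adm :: "nat \<Rightarrow> (nat \<Rightarrow> nat) \<Rightarrow> (nat \<Rightarrow> nat) set"
  where "U_adm M a = {c \<in> digit_seqs M. \<forall>n.
    ((\<exists>i<n. c i < M) \<longrightarrow> tail n c \<sqsubset> a) \<and> ((\<exists>i<n. c i > 0) \<longrightarrow> refl_seq M (tail n c) \<sqsubset> a)}"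

lemma V_admD:
  assumes "c \<in> V_adm M a"
  shows "c \<in> digit_seqs M" "i < n \<Longrightarrow> c i < M \<Longrightarrow> tail n c \<sqsubseteq> a"
    "i < n \<Longrightarrow> 0 < c i \<Longrightarrow> refl_seq M (tail n c) \<sqsubseteq> a"
  using assms by (auto simp: V_adm_def)

lemma U_admD:
  assumes "c \<in> U_adm M a"
  shows "c \<in> digit_seqs M" "i < n \<Longrightarrow> c i < M \<Longrightarrow> tail n c \<sqsubset> a"
    "i < n \<Longrightarrow> 0 < c i \<Longrightarrow> refl_seq M (tail n c) \<sqsubset> a"
  using assms by (auto simp: U_adm_def)

lemma V_admI:
  assumes "c \<in> digit_seqs M" "\<And>n i. i < n \<Longrightarrow> c i < M \<Longrightarrow> tail n c \<sqsubseteq> a"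
    "\<And>n i. i < n \<Longrightarrow> 0 < c i \<Longrightarrow> refl_seq M (tail n c) \<sqsubseteq> a"
  shows "c \<in> V_adm M a"
  using assms by (auto simp: V_adm_def)

lemma U_admI:
  assumes "c \<in> digit_seqs M" "\<And>n i. i < n \<Longrightarrow> c i < M \<Longrightarrow> tail n c \<sqsubset> a"
    "\<And>n i. i < n \<Longrightarrow> 0 < c i \<Longrightarrow> refl_seq M (tail n c) \<sqsubset> a"
  shows "c \<in> U_adm M a"
  using assms by (auto simp: U_adm_def)

lemma U_adm_subset_V_adm: "U_adm M a \<subseteq> V_adm M a"
  by (auto simp: U_adm_def V_adm_def lex_less_imp_le)

lemma V_adm_mono: "a \<sqsubseteq> b \<Longrightarrow> V_adm M a \<subseteq> V_adm M b"
  by (auto simp: V_adm_def intro: lex_le_trans[of _ a b])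

lemma V_adm_subset_U_adm: "a \<sqsubset> b \<Longrightarrow> V_adm M a \<subseteq> U_adm M b"
  by (auto simp: V_adm_def U_adm_def intro: lex_le_less_trans[of _ a b])

lemma refl_seq_less_iff_pos:
  "c \<in> digit_seqs M \<Longrightarrow> refl_seq M c i < M \<longleftrightarrow> 0 < c i"
  "c \<in> digit_seqs M \<Longrightarrow> 0 < refl_seq M c i \<longleftrightarrow> c i < M"
  using digit_seqs_le[of c M i] by (auto simp: refl_seq_def)

lemma refl_seq_in_V_adm [simp]: "c \<in> V_adm M a \<Longrightarrow> refl_seq M c \<in> V_adm M a"
  by (auto simp: V_adm_def tail_refl_seq refl_seq_less_iff_pos)

lemma refl_seq_in_U_adm [simp]: "c \<in> U_adm M a \<Longrightarrow> refl_seq M c \<in> U_adm M a"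
  by (auto simp: U_adm_def tail_refl_seq refl_seq_less_iff_pos)

lemma V_adm_closed:
  assumes "\<And>N. \<exists>d \<in> V_adm M a. agree N d c"
  shows "c \<in> V_adm M a"
proof (rule V_admI)
  have ex: "\<exists>d \<in> V_adm M a. (\<forall>i<n. d i = c i) \<and> agree N (tail n d) (tail n c)" for n N
    using assms[of "n + N"] agree_tail agree_mono[of "n + N" _ c n] by (metis agree_def le_add1)
  show "c \<in> digit_seqs M"
    unfolding digit_seqs_def
  proof safe
    fix i
    obtain d where "d \<in> V_adm M a" "agree (Suc i) d c" using assms by blast
    then show "c i \<le> M" using V_admD(1) digit_seqs_le by (metis agreeD lessI)
  qed
  fix n i :: nat assume i: "i < n"
  show "tail n c \<sqsubseteq> a" if "c i < M"
  proof (rule lex_le_closed)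
    show "\<exists>c' d'. agree N c' (tail n c) \<and> agree N d' a \<and> c' \<sqsubseteq> d'" for N
      using ex[of n N] that i V_admD(2) by (metis agree_refl)
  qed
  show "refl_seq M (tail n c) \<sqsubseteq> a" if "c i > 0"
  proof (rule lex_le_closed)
    show "\<exists>c' d'. agree N c' (refl_seq M (tail n c)) \<and> agree N d' a \<and> c' \<sqsubseteq> d'" for N
      using ex[of n N] that i V_admD(3) agree_refl_seq by (metis agree_refl)
  qed
qed

lemma value_less_of_digit_less:
  assumes "q > 1" "c \<in> digit_seqs M" "d \<in> digit_seqs M" "agree n c d" "c n < d n"
    "seq_value q (tail (Suc n) c) < 1 + seq_value q (tail (Suc n) d)"
  shows "seq_value q c < seq_value q d"
proof -
  have "real (c n) + 1 \<le> real (d n)" using assms by simp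
  then have "q * seq_value q (tail n c) < q * seq_value q (tail n d)"
    using value_tail_Suc[OF assms(1,2), of n] value_tail_Suc[OF assms(1,3), of n] assms(6) by linarith
  then show ?thesis
    using value_less_agree_iff(1)[OF assms(1-4)] assms(1) by simp
qed

text \<open>The supremum \<open>S\<close> of the values of the relevant tails satisfies \<open>S \<le> 1 + (S - 1) / q\<close>
  as soon as \<open>S > 1\<close>.\<close>

lemma parry_le_1:
  assumes "q > 1" "c \<in> digit_seqs M" "b \<in> digit_seqs M" "seq_value q b \<le> 1"
    and le: "\<And>n i. i < n \<Longrightarrow> c i < M \<Longrightarrow> tail n c \<sqsubseteq> b"
    and n: "i < n" "c i < M"
  shows "seq_value q (tail n c) \<le> 1"
proof (rule ccontr)
  assume gt: "\<not> ?thesis"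
  define A where "A = {seq_value q (tail n c) |n. \<exists>i<n. c i < M}"
  define S where "S = Sup A"
  have A: "seq_value q (tail n c) \<in> A" using n by (auto simp: A_def)
  have bdd: "bdd_above A"
    using value_le[OF assms(1) digit_seqs_tail[OF assms(2)]] by (auto simp: A_def bdd_above_def)
  have S1: "S > 1" using cSup_upper[OF A bdd] gt by (simp add: S_def)
  have "S \<le> 1 + (S - 1) / q"
    unfolding S_def
  proof (rule cSup_least)
    show "A \<noteq> {}" using A by auto
    fix a assume "a \<in> A"
    then obtain m j where m: "a = seq_value q (tail m c)" "j < m" "c j < M" by (auto simp: A_def)
    let ?s = "tail m c"
    have "?s \<sqsubseteq> b" using le m by blast
    show "a \<le> 1 + (Sup A - 1) / q"
    proof (cases "?s = b")
      case True
      then show ?thesis using assms(1,4) m(1) S1 by (simp add: S_def add_increasing2)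
    next
      case False
      then obtain k where k: "agree k ?s b" "?s k < b k"
        using \<open>?s \<sqsubseteq> b\<close> by (auto simp: lex_le_def elim: lex_lessE)
      have sM: "?s \<in> digit_seqs M" using assms(2) by simp
      \<comment> \<open>A digit below one of \<open>b\<close> is below \<open>M\<close>, so the tail
        after it is again among those whose supremum is \<open>S\<close>.\<close>
      have ck: "c (m + k) < M" using k(2) digit_seqs_le[OF assms(3), of k] by (simp add: tail_apply)
      then have "seq_value q (tail (Suc k) ?s) \<in> A" by (auto simp: A_def)
      then have "seq_value q (tail (Suc k) ?s) \<le> S" unfolding S_def using bdd by (rule cSup_upper)
      moreover have "seq_value q (tail (Suc k) b) \<ge> 0"
        using value_nonneg[OF assms(1) digit_seqs_tail[OF assms(3)]] .
      moreover have "real (?s k) + 1 \<le> real (b k)" using k(2) by simp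
      ultimately have "q * (seq_value q (tail k ?s) - seq_value q (tail k b)) \<le> S - 1"
        using value_tail_Suc[OF assms(1) sM, of k] value_tail_Suc[OF assms(1,3), of k]
        unfolding right_diff_distrib by linarith
      then have "seq_value q (tail k ?s) - seq_value q (tail k b) \<le> (S - 1) / q"
        using assms(1) by (simp add: field_simps)
      then have "seq_value q ?s - seq_value q b \<le> (S - 1) / q / q ^ k"
        unfolding value_diff_agree[OF assms(1) sM assms(3) k(1)]
        using assms(1) by (intro divide_right_mono) auto
      also have "\<dots> \<le> (S - 1) / q / 1"
        using S1 assms(1) by (intro divide_left_mono) auto
      finally show ?thesis using assms(4) m(1) by (simp add: S_def)
    qed
  qed
  then have "(S - 1) * q \<le> S - 1" using assms(1) by (simp add: field_simps)
  then show False using S1 assms(1) by (simp add: mult_le_cancel_left1)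
qed

text \<open>With all relevant remainders at most 1, one unit gained by \<open>b\<close> at the first
  difference pays for the rest of the tail. Infiniteness of \<open>b\<close> adds a positive
  remainder and hence strictness.\<close>

lemma parry:
  assumes "q > 1" "c \<in> digit_seqs M" "b \<in> digit_seqs M" "seq_value q b \<le> 1"
    and le: "\<And>n i. i < n \<Longrightarrow> c i < M \<Longrightarrow> tail n c \<sqsubseteq> b"
    and n: "i < n" "c i < M"
  shows "seq_value q (tail n c) \<le> seq_value q b"
    and "infinite_seq b \<Longrightarrow> tail n c \<sqsubset> b \<Longrightarrow> seq_value q (tail n c) < seq_value q b"
proof -
  have less: "seq_value q (tail (Suc k) (tail n c)) \<le> 1" if "tail n c k < b k" for k
  proof -
    have "c (n + k) < M" using that digit_seqs_le[OF assms(3), of k] by (simp add: tail_apply)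
    then show ?thesis using parry_le_1[OF assms(1-4) le, where n = "n + Suc k" and i = "n + k"] by simp
  qed
  show lt: "seq_value q (tail n c) < seq_value q b" if "infinite_seq b" "tail n c \<sqsubset> b"
  proof -
    obtain k where k: "agree k (tail n c) b" "tail n c k < b k" using \<open>tail n c \<sqsubset> b\<close> by (rule lex_lessE)
    then show ?thesis
      using less[OF k(2)] infinite_seq_tail_pos[OF assms(1,3) that(1), of k] assms(1-3)
      by (intro value_less_of_digit_less[of q _ M _ k]) auto
  qed
  show "seq_value q (tail n c) \<le> seq_value q b"
  proof (cases "tail n c = b")
    case False
    then obtain k where k: "agree k (tail n c) b" "tail n c k < b k"
      using le[OF n] by (auto simp: lex_le_def elim: lex_lessE)
    have "real (tail n c k) + 1 \<le> real (b k)" using k(2) by simp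
    moreover have "seq_value q (tail (Suc k) b) \<ge> 0"
        using value_nonneg[OF assms(1) digit_seqs_tail[OF assms(3)]] .
    ultimately have "q * seq_value q (tail k (tail n c)) \<le> q * seq_value q (tail k b)"
      using value_tail_Suc[OF assms(1), of "tail n c" M k] value_tail_Suc[OF assms(1,3), of k]
        assms(2) less[OF k(2)] by (simp del: tail_tail)
    then have "seq_value q (tail k (tail n c)) \<le> seq_value q (tail k b)" using assms(1) by simp
    then have "(seq_value q (tail k (tail n c)) - seq_value q (tail k b)) / q ^ k \<le> 0"
      using assms(1) by (simp add: divide_le_0_iff)
    then show ?thesis
      using value_diff_agree[OF assms(1) _ assms(3) k(1)] assms(2) by simp
  qed simp
qed

lemma infinite_seq_refl_iff:
  assumes "c \<in> digit_seqs M"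
  shows "infinite_seq (refl_seq M c) \<longleftrightarrow> (\<forall>n. c n < M \<longrightarrow> (\<exists>m>n. c m < M))"
  using refl_seq_less_iff_pos(2)[OF assms] unfolding infinite_seq_iff by simp

lemma doubly_infinite_iff: "doubly_infinite M c \<longleftrightarrow> infinite_seq c \<and> infinite_seq (refl_seq M c)"
  by (simp add: doubly_infinite_def refl_seq_def)

lemma doubly_infinite_refl_seq:
  "c \<in> digit_seqs M \<Longrightarrow> doubly_infinite M c \<Longrightarrow> doubly_infinite M (refl_seq M c)"
  by (simp add: doubly_infinite_iff)

lemma is_expansion_refl_seq:
  "q > 1 \<Longrightarrow> is_expansion M q x c \<Longrightarrow> is_expansion M q (real M / (q - 1) - x) (refl_seq M c)"
  by (auto simp: is_expansion_def value_refl_seq)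

lemma is_expansion_in_J: "q > 1 \<Longrightarrow> is_expansion M q x c \<Longrightarrow> x \<in> J M q"
  using value_le value_nonneg by (auto simp: is_expansion_def J_def)

text \<open>A digit \<open>M\<close> preserves the bound: it turns a remainder below 1 into one
  below \<open>q - M\<close>, which is at most 1. This carries the bound from the tails directly
  after a digit below \<open>M\<close> to all later ones.\<close>

lemma tail_value_less_1:
  assumes "1 < q" "q \<le> real M + 1" "c \<in> digit_seqs M"
    and "\<And>n. c n < M \<Longrightarrow> seq_value q (tail (Suc n) c) < 1" "i < n" "c i < M"
  shows "seq_value q (tail n c) < 1"
  using assms(5)
proof (induction n)
  case (Suc n)
  show ?case
  proof (cases "c n < M")
    case False
    then have "c n = M" "i < n" using digit_seqs_le[OF assms(3), of n] Suc.prems assms(6)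
      by (auto simp: less_Suc_eq)
    then have "q * seq_value q (tail n c) < q" using Suc.IH assms(1) by simp
    then show ?thesis using \<open>c n = M\<close> value_tail_Suc[OF assms(1,3), of n] assms(2) by simp
  qed (use assms(4) in blast)
qed simp

lemma tail_value_le_1:
  assumes "1 < q" "q \<le> real M + 1" "c \<in> digit_seqs M"
    and "\<And>n. c n < M \<Longrightarrow> seq_value q (tail (Suc n) c) \<le> 1" "i < n" "c i < M"
  shows "seq_value q (tail n c) \<le> 1"
  using assms(5)
proof (induction n)
  case (Suc n)
  show ?case
  proof (cases "c n < M")
    case False
    then have "c n = M" "i < n" using digit_seqs_le[OF assms(3), of n] Suc.prems assms(6)
      by (auto simp: less_Suc_eq)
    then have "q * seq_value q (tail n c) \<le> q" using Suc.IH assms(1) by simp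
    then show ?thesis using \<open>c n = M\<close> value_tail_Suc[OF assms(1,3), of n] assms(2) by simp
  qed (use assms(4) in blast)
qed simp

section \<open>Values versus lexicographic bounds\<close>

locale base =
  fixes M :: nat and q :: real
  assumes q: "1 < q" "q \<le> real M + 1"
begin

lemma M_pos: "M > 0"
  using q by (cases M) auto

lemma one_in_J: "1 \<in> J M q"
  using q by (simp add: J_def field_simps)

lemma alpha_digits [simp]: "alpha M q \<in> digit_seqs M"
  and alpha_value [simp]: "seq_value q (alpha M q) = 1"
  and alpha_infinite: "infinite_seq (alpha M q)"
  using quasi_greedy_props[OF q one_in_J] by (auto simp: is_expansion_def)

lemma alpha_tail_value: "seq_value q (tail n (alpha M q)) \<le> 1"
proof (induction n)
  case (Suc n)
  show ?case
  proof (cases "alpha M q n < M")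
    case True
    then show ?thesis using quasi_greedy_props(3)[OF q one_in_J] by blast
  next
    case False
    then have "alpha M q n = M" using digit_seqs_le[OF alpha_digits, of n] by simp
    moreover have "q * seq_value q (tail n (alpha M q)) \<le> q" using Suc q by simp
    ultimately show ?thesis using value_tail_Suc[OF q(1) alpha_digits, of n] q(2) by simp
  qed
qed simp

text \<open>A sequence above \<open>alpha M q\<close> is a unit ahead at the first difference and
  has a positive remainder, against a remainder of at most 1 on the other side; its value would
  exceed 1.\<close>

lemma le_alphaI:
  assumes "s \<in> digit_seqs M" "infinite_seq s" "seq_value q s \<le> 1"
  shows "s \<sqsubseteq> alpha M q"
proof (rule ccontr)
  assume "\<not> ?thesis"
  then have "alpha M q \<sqsubset> s" by simp
  then obtain k where k: "agree k (alpha M q) s" "alpha M q k < s k" by (rule lex_lessE)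
  have "seq_value q (alpha M q) < seq_value q s"
    using infinite_seq_tail_pos[OF q(1) assms(1,2), of k] alpha_tail_value[of "Suc k"] k q(1) assms(1)
    by (intro value_less_of_digit_less[of q _ M _ k]) auto
  then show False using assms(3) by simp
qed

lemma alpha_tail_le: "tail n (alpha M q) \<sqsubseteq> alpha M q"
  by (intro le_alphaI) (auto simp: alpha_tail_value alpha_infinite infinite_seq_tail)

lemma alpha_0_pos: "alpha M q 0 > 0"
proof (rule ccontr)
  assume "\<not> ?thesis"
  then have "seq_value q (tail (Suc 0) (alpha M q)) = q"
    using value_tail_Suc[OF q(1) alpha_digits, of 0] by simp
  then show False using alpha_tail_value[of "Suc 0"] q by simp
qed

text \<open>Being maximal among its own tails gives \<open>b\<close> the value bounds, by
  \<open>parry_le_1\<close> with \<open>b\<close> in both roles.\<close>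

lemma alpha_eqI:
  assumes "b \<in> digit_seqs M" "infinite_seq b" "seq_value q b = 1" "\<And>n. tail n b \<sqsubseteq> b"
  shows "alpha M q = b"
proof (rule quasi_greedy_eqI)
  show "seq_value q (tail (Suc n) b) \<le> 1" if "b n < M" for n
    using parry_le_1[OF q(1) assms(1,1), of n "Suc n"] that assms by simp
qed (use assms q in \<open>auto simp: is_expansion_def\<close>)

lemma V_adm_value:
  assumes "c \<in> V_adm M (alpha M q)"
  shows "i < n \<Longrightarrow> c i < M \<Longrightarrow> seq_value q (tail n c) \<le> 1"
    and "i < n \<Longrightarrow> 0 < c i \<Longrightarrow> seq_value q (refl_seq M (tail n c)) \<le> 1"
proof -
  have *: "seq_value q (tail n c) \<le> 1" if "i < n" "c i < M" "c \<in> V_adm M (alpha M q)" for n i c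
    using that by (intro parry_le_1[OF q(1) _ alpha_digits, where c = c and i = i])
      (auto dest: V_admD)
  show "i < n \<Longrightarrow> c i < M \<Longrightarrow> seq_value q (tail n c) \<le> 1" using * assms by blast
  show "i < n \<Longrightarrow> 0 < c i \<Longrightarrow> seq_value q (refl_seq M (tail n c)) \<le> 1"
    using *[of i n "refl_seq M c"] assms refl_seq_less_iff_pos(1)[of c M i]
    by (simp add: V_admD(1) tail_refl_seq)
qed

lemma U_adm_value:
  assumes "c \<in> U_adm M (alpha M q)"
  shows "i < n \<Longrightarrow> c i < M \<Longrightarrow> seq_value q (tail n c) < 1"
    and "i < n \<Longrightarrow> 0 < c i \<Longrightarrow> seq_value q (refl_seq M (tail n c)) < 1"
proof -
  have *: "seq_value q (tail n c) < 1" if c: "i < n" "c i < M" "c \<in> U_adm M (alpha M q)" for n i c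
    using parry(2)[OF q(1) U_admD(1)[OF c(3)] alpha_digits _ _ c(1,2) alpha_infinite] U_admD[OF c(3)]
      c(1,2) by (simp add: lex_less_imp_le)
  show "i < n \<Longrightarrow> c i < M \<Longrightarrow> seq_value q (tail n c) < 1" using * assms by blast
  show "i < n \<Longrightarrow> 0 < c i \<Longrightarrow> seq_value q (refl_seq M (tail n c)) < 1"
    using *[of i n "refl_seq M c"] assms refl_seq_less_iff_pos(1)[of c M i]
    by (simp add: U_admD(1) tail_refl_seq)
qed

lemma V_adm_of_value:
  assumes "c \<in> digit_seqs M" "doubly_infinite M c"
    and "\<And>n. c n < M \<Longrightarrow> seq_value q (tail (Suc n) c) \<le> 1"
    and "\<And>n. 0 < c n \<Longrightarrow> seq_value q (refl_seq M (tail (Suc n) c)) \<le> 1"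
  shows "c \<in> V_adm M (alpha M q)"
proof (rule V_admI)
  fix n i :: nat assume i: "i < n"
  show "tail n c \<sqsubseteq> alpha M q" if "c i < M"
    using tail_value_le_1[OF q assms(1,3) i that] assms
    by (intro le_alphaI) (auto simp: doubly_infinite_iff infinite_seq_tail)
  show "refl_seq M (tail n c) \<sqsubseteq> alpha M q" if "c i > 0"
    using tail_value_le_1[OF q digit_seqs_refl_seq _ i, of c] assms that
    by (intro le_alphaI)
      (auto simp: doubly_infinite_iff refl_seq_less_iff_pos tail_refl_seq[symmetric] infinite_seq_tail)
qed fact

text \<open>After the last nonzero digit the reflected tail is constantly \<open>M\<close>, of value
  \<open>M / (q - 1) \<ge> 1\<close>. Strict value bounds therefore force infiniteness by
  themselves.\<close>

lemma not_infinite_value: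
  assumes "\<not> infinite_seq c"
  obtains n where "c n > 0" "seq_value q (refl_seq M (tail (Suc n) c)) \<ge> 1"
proof -
  obtain n where n: "c n \<noteq> 0" "\<not> (\<exists>m>n. c m \<noteq> 0)" using assms by (auto simp: infinite_seq_iff)
  then have "refl_seq M (tail (Suc n) c) = (\<lambda>_. M)" by (auto simp: refl_seq_def tail_def)
  then have "seq_value q (refl_seq M (tail (Suc n) c)) = real M / (q - 1)" using value_const q by simp
  also have "\<dots> \<ge> 1" using q by (simp add: field_simps)
  finally show ?thesis using n that[of n] by simp
qed

lemma U_adm_of_value:
  assumes "c \<in> digit_seqs M"
    and less: "\<And>n. c n < M \<Longrightarrow> seq_value q (tail (Suc n) c) < 1"
    and less': "\<And>n. 0 < c n \<Longrightarrow> seq_value q (refl_seq M (tail (Suc n) c)) < 1"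
  shows "c \<in> U_adm M (alpha M q)"
proof (rule U_admI)
  have inf: "infinite_seq c"
  proof (rule ccontr)
    assume "\<not> ?thesis"
    then obtain n where "c n > 0" "seq_value q (refl_seq M (tail (Suc n) c)) \<ge> 1"
      by (rule not_infinite_value)
    then show False using less'[of n] by simp
  qed
  have inf': "infinite_seq (refl_seq M c)"
  proof (rule ccontr)
    assume "\<not> ?thesis"
    then obtain n where "refl_seq M c n > 0" "seq_value q (refl_seq M (tail (Suc n) (refl_seq M c))) \<ge> 1"
      by (rule not_infinite_value)
    then show False using less[of n] assms(1) by (simp add: tail_refl_seq refl_seq_less_iff_pos)
  qed
  have lt: "s \<sqsubset> alpha M q" if "s \<in> digit_seqs M" "infinite_seq s" "seq_value q s < 1" for s
    using le_alphaI[of s] that alpha_value by (auto simp: lex_le_def)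
  fix n i :: nat assume i: "i < n"
  show "tail n c \<sqsubset> alpha M q" if "c i < M"
    using tail_value_less_1[OF q assms(1) less i that] assms
    by (intro lt) (auto simp: inf infinite_seq_tail)
  show "refl_seq M (tail n c) \<sqsubset> alpha M q" if "c i > 0"
    using tail_value_less_1[OF q digit_seqs_refl_seq _ i, of c] assms that
    by (intro lt) (auto simp: inf' refl_seq_less_iff_pos tail_refl_seq[symmetric] infinite_seq_tail)
qed fact

text \<open>A remainder of at least 1 would allow a second expansion: raise digit \<open>n\<close>
  by one and expand the remainder minus 1 anew.\<close>

lemma unique_expansion_bound:
  assumes "is_expansion M q x c" "\<And>d. is_expansion M q x d \<Longrightarrow> d = c" "c n < M"
  shows "seq_value q (tail (Suc n) c) < 1"
proof (rule ccontr)
  assume "\<not> ?thesis"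
  then have ge: "seq_value q (tail (Suc n) c) \<ge> 1" by simp
  have cM: "c \<in> digit_seqs M" using assms(1) by (simp add: is_expansion_def)
  have "seq_value q (tail (Suc n) c) - 1 \<in> J M q"
    using ge value_le[OF q(1), of "tail (Suc n) c" M] cM by (simp add: J_def)
  then obtain e where e: "e \<in> digit_seqs M" "seq_value q e = seq_value q (tail (Suc n) c) - 1"
    using quasi_greedy_props(1)[OF q] unfolding is_expansion_def by blast
  define u where "u = c(n := Suc (c n))"
  define d where "d = glue (Suc n) u e"
  have dM: "d \<in> digit_seqs M"
    unfolding d_def using cM assms(3) e(1) by (intro digit_seqs_glue) (auto simp: digit_seqs_def u_def)
  have dn: "d n = Suc (c n)" by (simp add: d_def glue_def u_def)
  have agr: "agree n d c" by (auto simp: agree_def d_def glue_def u_def)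
  have "tail (Suc n) d = e" by (simp add: d_def)
  then have "q * seq_value q (tail n d) = q * seq_value q (tail n c)"
    using value_tail_Suc[OF q(1) dM, of n] value_tail_Suc[OF q(1) cM, of n] e(2) dn by auto
  then have "seq_value q d = seq_value q c"
    using value_less_agree_iff(2)[OF q(1) dM cM agr] q(1) by simp
  then have "is_expansion M q x d" using assms(1) dM by (simp add: is_expansion_def)
  then have "d = c" by (rule assms(2))
  then show False using dn by simp
qed

text \<open>Reflection exchanges the expansions of \<open>x\<close> with those of
  \<open>M / (q - 1) - x\<close>, so each one-sided argument serves twice. Conversely, at a first
  difference either \<open>c\<close> or its reflection has the smaller digit, and a remainder below
  1 cannot compensate for it.\<close>

lemma unique_expansion_iff:
  assumes c: "is_expansion M q x c"
  shows "(\<exists>!c. is_expansion M q x c) \<longleftrightarrow> c \<in> U_adm M (alpha M q)"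
proof
  have cM: "c \<in> digit_seqs M" using c by (simp add: is_expansion_def)
  assume ex1: "\<exists>!c. is_expansion M q x c"
  then have uniq: "d = c" if "is_expansion M q x d" for d using c that by blast
  have uniq': "d = refl_seq M c" if "is_expansion M q (real M / (q - 1) - x) d" for d
    using uniq[of "refl_seq M d"] is_expansion_refl_seq[OF q(1) that] that
    by (metis add_diff_cancel_left' diff_add_cancel is_expansion_def refl_seq_refl_seq)
  show "c \<in> U_adm M (alpha M q)"
  proof (rule U_adm_of_value)
    show "seq_value q (tail (Suc n) c) < 1" if "c n < M" for n
      using unique_expansion_bound[OF c uniq that] by blast
    show "seq_value q (refl_seq M (tail (Suc n) c)) < 1" if "0 < c n" for n
      using unique_expansion_bound[OF is_expansion_refl_seq[OF q(1) c] uniq', of n] that cM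
      by (simp add: refl_seq_less_iff_pos tail_refl_seq)
  qed (use c in \<open>simp add: is_expansion_def\<close>)
next
  assume U: "c \<in> U_adm M (alpha M q)"
  have nl: "\<not> (agree n c d \<and> c n < d n)"
    if "c \<in> U_adm M (alpha M q)" "d \<in> digit_seqs M" "seq_value q d = seq_value q c" for c d n
    using value_less_of_digit_less[OF q(1) U_admD(1)[OF that(1)] that(2), of n]
      U_adm_value(1)[OF that(1), of n "Suc n"] digit_seqs_le[OF that(2), of n] that(3)
      value_nonneg[OF q(1) digit_seqs_tail[OF that(2)], of "Suc n"]
    by fastforce
  show "\<exists>!c. is_expansion M q x c"
  proof (rule ex1I[of _ c])
    fix d assume d: "is_expansion M q x d"
    have D: "c \<in> digit_seqs M" "d \<in> digit_seqs M" "seq_value q d = seq_value q c"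
      using c d by (auto simp: is_expansion_def)
    show "d = c"
    proof (rule ccontr)
      assume "d \<noteq> c"
      then obtain n where n: "agree n c d" "c n \<noteq> d n" by (metis first_difference)
      have "\<not> c n < d n" using nl[OF U D(2,3), of n] n by blast
      then have "refl_seq M c n < refl_seq M d n"
        using n(2) digit_seqs_le[OF D(1), of n] by (auto simp: refl_seq_def)
      moreover have "seq_value q (refl_seq M d) = seq_value q (refl_seq M c)"
        using D q by (simp add: value_refl_seq)
      ultimately show False
        using nl[OF refl_seq_in_U_adm[OF U] digit_seqs_refl_seq, of d n] n agree_refl_seq by blast
    qed
  qed (fact c)
qed

lemma U_set_eq: "U_set M q = seq_value q ` U_adm M (alpha M q)"
proof (intro subset_antisym subsetI)
  fix x assume x: "x \<in> U_set M q"
  then obtain c where "is_expansion M q x c" by (auto simp: U_set_def)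
  then show "x \<in> seq_value q ` U_adm M (alpha M q)"
    using x unique_expansion_iff by (auto simp: U_set_def is_expansion_def)
next
  fix x assume "x \<in> seq_value q ` U_adm M (alpha M q)"
  then obtain c where c: "c \<in> U_adm M (alpha M q)" "x = seq_value q c" by blast
  then have "is_expansion M q x c" by (auto simp: is_expansion_def dest: U_admD)
  then show "x \<in> U_set M q"
    using unique_expansion_iff c is_expansion_in_J q(1) by (auto simp: U_set_def)
qed

lemma U_bases_alpha:
  assumes "q \<in> U_bases M" "k \<ge> 1"
  shows "refl_seq M (tail k (alpha M q)) \<sqsubset> alpha M q"
proof -
  have "is_expansion M q 1 (alpha M q)" by (simp add: is_expansion_def)
  then have "alpha M q \<in> U_adm M (alpha M q)"
    using assms unique_expansion_iff by (simp add: U_bases_def)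
  then show ?thesis using U_admD(3)[of _ M _ 0 k] alpha_0_pos assms(2) by simp
qed

end

text \<open>In the larger base \<open>q\<close> the sequence \<open>alpha M p\<close> has value
  below 1. If it were an upper bound for \<open>alpha M q\<close>, Parry's inequality would push the
  value of \<open>alpha M q\<close> below 1 as well.\<close>

lemma alpha_strict_mono:
  assumes "1 < p" "p < q" "q \<le> real M + 1"
  shows "alpha M p \<sqsubset> alpha M q"
proof (rule ccontr)
  interpret p: base M p using assms by unfold_locales auto
  interpret q: base M q using assms by unfold_locales auto
  assume "\<not> ?thesis"
  then have le: "alpha M q \<sqsubseteq> alpha M p" by simp
  have lt: "seq_value q (alpha M p) < 1"
    using value_base_strict_mono[OF assms(1,2) p.alpha_digits p.alpha_0_pos] by simp
  \<comment> \<open>The leading 0 is a digit below \<open>M\<close>, so that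
    \<open>alpha M q\<close> itself becomes a constrained tail.\<close>
  define c where "c = glue 1 (\<lambda>_. 0) (alpha M q)"
  have tl: "tail n c = tail (n - 1) (alpha M q)" if "n > 0" for n
    using that tail_glue_ge[of 1 n] by (simp add: c_def)
  have "seq_value q (tail 1 c) \<le> seq_value q (alpha M p)"
  proof (rule parry(1)[OF q.q(1) _ p.alpha_digits])
    show "c \<in> digit_seqs M" by (auto simp: c_def digit_seqs_def intro!: digit_seqs_glue)
        (auto simp: glue_def digit_seqs_le[OF q.alpha_digits])
    show "tail n c \<sqsubseteq> alpha M p" if "i < n" for n i
      using that tl[of n] q.alpha_tail_le le lex_le_trans by auto
    show "c 0 < M" using q.M_pos by (simp add: c_def glue_def)
  qed (use lt in auto)
  then show False using lt tl[of 1] by simp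
qed

lemma alpha_le_iff:
  assumes "1 < p" "1 < q" "p \<le> real M + 1" "q \<le> real M + 1"
  shows "alpha M p \<sqsubseteq> alpha M q \<longleftrightarrow> p \<le> q"
  using alpha_strict_mono[of p q M] alpha_strict_mono[of q p M] assms
  by (metis lex_le_def less_eq_real_def not_le not_lex_le)

text \<open>Below \<open>M + 1\<close> the sequence \<open>alpha M q\<close> is not constantly
  \<open>M\<close>, which makes every member of \<open>V_adm M (alpha M q)\<close> doubly infinite.
  At \<open>M + 1\<close> this fails, and \<open>V_set\<close> is fixed by convention.\<close>

locale small_base = base +
  assumes q_less: "q < real M + 1"
begin

lemma alpha_neq_const: "alpha M q \<noteq> (\<lambda>_. M)"
proof
  assume "alpha M q = (\<lambda>_. M)"
  then have "real M / (q - 1) = 1" using alpha_value value_const[OF q(1), of M] by simp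
  then show False using q_less q by (simp add: field_simps)
qed

lemma const_not_le_alpha: "\<not> (\<lambda>_. M) \<sqsubseteq> alpha M q"
  using alpha_neq_const lex_le_const[OF alpha_digits] lex_le_antisym by blast

lemma V_adm_infinite:
  assumes "c \<in> V_adm M (alpha M q)"
  shows "infinite_seq c"
  unfolding infinite_seq_iff
proof (intro allI impI, rule ccontr)
  fix n assume n: "c n \<noteq> 0" "\<not> (\<exists>m>n. c m \<noteq> 0)"
  then have "refl_seq M (tail (Suc n) c) = (\<lambda>_. M)" by (auto simp: refl_seq_def tail_def)
  then show False using V_admD(3)[OF assms, of n "Suc n"] n const_not_le_alpha by simp
qed

lemma V_adm_doubly_infinite:
  assumes "c \<in> V_adm M (alpha M q)"
  shows "doubly_infinite M c"
  using assms V_adm_infinite by (simp add: doubly_infinite_iff)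

lemma quasi_greedy_doubly_infinite:
  assumes "x \<in> J M q"
  shows "doubly_infinite M (quasi_greedy M q x)"
proof -
  let ?g = "quasi_greedy M q x"
  note g = quasi_greedy_props[OF q assms]
  have gM: "?g \<in> digit_seqs M" using g(1) by (simp add: is_expansion_def)
  have "infinite_seq (refl_seq M ?g)"
    unfolding infinite_seq_refl_iff[OF gM]
  proof (intro allI impI, rule ccontr)
    fix n assume n: "?g n < M" "\<not> (\<exists>m>n. ?g m < M)"
    have "?g m = M" if "m > n" for m
      using n(2) that digit_seqs_le[OF gM, of m] by (meson le_neq_implies_less)
    then have "tail (Suc n) ?g = (\<lambda>_. M)" by (auto simp: tail_def)
    then have "real M / (q - 1) \<le> 1" using g(3)[OF n(1)] value_const q by simp
    then show False using q q_less by (simp add: field_simps)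
  qed
  then show ?thesis using g(2) by (simp add: doubly_infinite_iff)
qed

text \<open>The bounds on \<open>c\<close> are only weak here; strictness comes from the positive
  remainder of the infinite competitor.\<close>

lemma V_adm_unique:
  assumes c: "c \<in> V_adm M (alpha M q)"
    and d: "d \<in> digit_seqs M" "doubly_infinite M d" "seq_value q d = seq_value q c"
  shows "d = c"
proof (rule ccontr)
  have nl: "\<not> (agree n c d \<and> c n < d n)"
    if c: "c \<in> V_adm M (alpha M q)"
      and d: "d \<in> digit_seqs M" "doubly_infinite M d" "seq_value q d = seq_value q c" for c d n
  proof safe
    assume n: "agree n c d" "c n < d n"
    have "seq_value q c < seq_value q d"
      using V_adm_value(1)[OF c, of n "Suc n"] n digit_seqs_le[OF d(1), of n] d(2)
        infinite_seq_tail_pos[OF q(1) d(1), of n] V_admD(1)[OF c] d(1) q(1)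
      by (intro value_less_of_digit_less[of q c M d n]) (auto simp: doubly_infinite_iff)
    then show False using d by simp
  qed
  assume "d \<noteq> c"
  then obtain n where n: "agree n c d" "c n \<noteq> d n" by (metis first_difference)
  have "\<not> c n < d n" using nl[OF c d, of n] n by blast
  then have "refl_seq M c n < refl_seq M d n"
    using n(2) digit_seqs_le[OF V_admD(1)[OF c], of n] by (auto simp: refl_seq_def)
  moreover have "seq_value q (refl_seq M d) = seq_value q (refl_seq M c)"
    using d q V_admD(1)[OF c] by (simp add: value_refl_seq)
  ultimately show False
    using nl[OF refl_seq_in_V_adm[OF c] digit_seqs_refl_seq doubly_infinite_refl_seq[OF d(1,2)], of n] n
      agree_refl_seq by blast
qed

lemma inj_on_value: "inj_on (seq_value q) (V_adm M (alpha M q))"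
  by (intro inj_onI V_adm_unique) (auto simp: V_adm_doubly_infinite V_admD(1))

text \<open>The quasi-greedy expansion of \<open>x\<close> and the reflection of that of
  \<open>M / (q - 1) - x\<close> are both doubly infinite expansions of \<open>x\<close>. If both
  are \<open>c\<close>, the remainder bounds of each apply to it.\<close>

lemma unique_doubly_infinite_iff:
  assumes c: "is_expansion M q x c" "doubly_infinite M c"
  shows "(\<exists>!c. is_expansion M q x c \<and> doubly_infinite M c) \<longleftrightarrow> c \<in> V_adm M (alpha M q)"
proof
  have cM: "c \<in> digit_seqs M" using c by (simp add: is_expansion_def)
  assume "\<exists>!c. is_expansion M q x c \<and> doubly_infinite M c"
  then have uniq: "d = c" if "is_expansion M q x d" "doubly_infinite M d" for d using c that by blast
  have x: "x \<in> J M q" using is_expansion_in_J c q by blast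
  let ?y = "real M / (q - 1) - x"
  have y: "?y \<in> J M q" using is_expansion_in_J is_expansion_refl_seq[OF q(1) c(1)] q by blast
  note g = quasi_greedy_props[OF q x] and h = quasi_greedy_props[OF q y]
  have gc: "quasi_greedy M q x = c" using uniq[OF g(1) quasi_greedy_doubly_infinite[OF x]] .
  have hM: "quasi_greedy M q ?y \<in> digit_seqs M" using h(1) by (simp add: is_expansion_def)
  have "refl_seq M (quasi_greedy M q ?y) = c"
    using uniq[OF _ doubly_infinite_refl_seq[OF hM quasi_greedy_doubly_infinite[OF y]]]
      is_expansion_refl_seq[OF q(1) h(1)] by simp
  then have hc: "quasi_greedy M q ?y = refl_seq M c" using hM by auto
  show "c \<in> V_adm M (alpha M q)"
    using g(3)[unfolded gc] h(3)[unfolded hc] cM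
    by (intro V_adm_of_value cM c(2)) (auto simp: refl_seq_less_iff_pos tail_refl_seq)
next
  assume "c \<in> V_adm M (alpha M q)"
  then show "\<exists>!c. is_expansion M q x c \<and> doubly_infinite M c"
    using c V_adm_unique by (intro ex1I[of _ c]) (auto simp: is_expansion_def)
qed

lemma V_set_eq: "V_set M q = seq_value q ` V_adm M (alpha M q)"
proof (intro subset_antisym subsetI)
  fix x assume x: "x \<in> V_set M q"
  then obtain c where "is_expansion M q x c" "doubly_infinite M c" using q_less by (auto simp: V_set_def)
  then show "x \<in> seq_value q ` V_adm M (alpha M q)"
    using x q_less unique_doubly_infinite_iff by (auto simp: V_set_def is_expansion_def)
next
  fix x assume "x \<in> seq_value q ` V_adm M (alpha M q)"
  then obtain c where c: "c \<in> V_adm M (alpha M q)" "x = seq_value q c" by blast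
  then have "is_expansion M q x c" by (auto simp: is_expansion_def dest: V_admD)
  then show "x \<in> V_set M q"
    using unique_doubly_infinite_iff c is_expansion_in_J q(1) q_less V_adm_doubly_infinite
    by (auto simp: V_set_def)
qed

lemma quasi_greedy_value:
  assumes "c \<in> V_adm M (alpha M q)"
  shows "quasi_greedy M q (seq_value q c) = c"
  using assms V_adm_value(1) V_adm_infinite V_admD(1) q(1)
  by (intro quasi_greedy_eqI) (auto simp: is_expansion_def)

lemma V_seqs_eq: "V_seqs M q = V_adm M (alpha M q)"
  by (force simp: V_seqs_def V_set_eq quasi_greedy_value image_image)

lemma U_seqs_eq: "U_seqs M q = U_adm M (alpha M q)"
  using U_adm_subset_V_adm[of M "alpha M q"]
  by (force simp: U_seqs_def U_set_eq quasi_greedy_value image_image subset_iff)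

lemma V_bases_iff:
  "q \<in> V_bases M \<longleftrightarrow> (\<forall>k\<ge>1. refl_seq M (tail k (alpha M q)) \<sqsubseteq> alpha M q)"
proof -
  have "q \<in> V_bases M \<longleftrightarrow> alpha M q \<in> V_adm M (alpha M q)"
    using unique_doubly_infinite_iff[of 1 "alpha M q"] quasi_greedy_doubly_infinite[OF one_in_J] q(1)
    by (simp add: V_bases_def is_expansion_def)
  also have "\<dots> \<longleftrightarrow> (\<forall>k\<ge>1. refl_seq M (tail k (alpha M q)) \<sqsubseteq> alpha M q)"
  proof
    show "\<forall>k\<ge>1. refl_seq M (tail k (alpha M q)) \<sqsubseteq> alpha M q" if "alpha M q \<in> V_adm M (alpha M q)"
      using V_admD(3)[OF that, of 0] alpha_0_pos by auto
  qed (auto intro!: V_admI alpha_tail_le)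
  finally show ?thesis .
qed

end

lemma U_V_bases_le:
  assumes "q \<in> U_bases M \<union> V_bases M"
  shows "1 < q" "q \<le> real M + 1"
proof -
  show q: "1 < q" using assms by (auto simp: U_bases_def V_bases_def)
  obtain c where "is_expansion M q 1 c" using assms by (auto simp: U_bases_def V_bases_def)
  then have "1 \<le> real M / (q - 1)" using is_expansion_in_J[OF q] by (auto simp: J_def)
  then show "q \<le> real M + 1" using q by (simp add: field_simps)
qed

section \<open>Admissible sequences and their extremal tails\<close>

text \<open>Intermediate value theorem in the base: two nonzero digits push the value above 1 near
  base 1, and no value exceeds 1 in base \<open>M + 1\<close>.\<close>

lemma alpha_surj:
  assumes "M > 0" "b \<in> digit_seqs M" "infinite_seq b" "b 0 > 0" "\<And>n. tail n b \<sqsubseteq> b"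
  obtains p where "1 < p" "p \<le> real M + 1" "alpha M p = b"
proof -
  obtain m where m: "m > 0" "b m > 0" using assms(3,4) by (auto simp: infinite_seq_iff)
  have "((\<lambda>p::real. 1 / p + 1 / p ^ Suc m) \<longlongrightarrow> 1 / 1 + 1 / 1 ^ Suc m) (at_right 1)"
    by (intro tendsto_intros) auto
  then have "eventually (\<lambda>p::real. 1 < 1 / p + 1 / p ^ Suc m) (at_right 1)"
    by (rule order_tendstoD) simp
  moreover have "eventually (\<lambda>p::real. p \<in> {1<..<real M + 1}) (at_right 1)"
    using assms(1) by (intro eventually_at_right_real) simp
  ultimately have "eventually (\<lambda>p::real. 1 < 1 / p + 1 / p ^ Suc m \<and> p \<in> {1<..<real M + 1}) (at_right 1)"
    by (rule eventually_conj)
  then obtain p1 :: real where p1: "1 < 1 / p1 + 1 / p1 ^ Suc m" "1 < p1" "p1 < real M + 1"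
    using eventually_happens'[OF trivial_limit_at_right_real] by fastforce
  have "1 / p1 + 1 / p1 ^ Suc m \<le> (\<Sum>i\<in>{0, m}. real (b i) / p1 ^ Suc i)"
    using m assms(4) p1(2) by (auto intro!: add_mono divide_right_mono simp del: power_Suc)
  also have "\<dots> \<le> seq_value p1 b"
    unfolding seq_value_def using p1(2) assms(2)
    by (intro sum_le_suminf summable_value) auto
  finally have ge: "1 \<le> seq_value p1 b" using p1 by simp
  have le: "seq_value (real M + 1) b \<le> 1" using value_le[of "real M + 1" b M] assms(1,2) by simp
  have "\<exists>p\<ge>p1. p \<le> real M + 1 \<and> seq_value p b = 1"
    by (rule IVT2) (use le ge p1 value_isCont_base[OF _ assms(2)] in auto)
  then obtain p where p: "p1 \<le> p" "p \<le> real M + 1" "seq_value p b = 1" by blast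
  interpret base M p using p p1 by unfold_locales auto
  show ?thesis using that[of p] q alpha_eqI[OF assms(2,3) p(3) assms(5)] by blast
qed

text \<open>The set \<open>T\<close> of relevant tails and reflected tails is closed under shifts
  and, from members with positive first digit, under reflected shifts. Both properties pass to the
  supremum \<open>b\<close> through its prefixes, although \<open>b\<close> need not belong to
  \<open>T\<close>.\<close>

lemma lex_supremum_of_tails:
  assumes c: "c \<in> digit_seqs M" "c \<noteq> (\<lambda>_. 0)" "c \<noteq> (\<lambda>_. M)"
  obtains b where "b \<in> digit_seqs M" "b 0 > 0" "c \<in> V_adm M b"
    "\<And>a. c \<in> V_adm M a \<Longrightarrow> b \<sqsubseteq> a"
    "\<And>n. tail n b \<sqsubseteq> b" "\<And>n. n \<ge> 1 \<Longrightarrow> refl_seq M (tail n b) \<sqsubseteq> b"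
    "\<And>k. k \<ge> 1 \<Longrightarrow> tail k b = refl_seq M b \<Longrightarrow>
      \<exists>n. \<exists>i<n. c i < M \<and> tail n c = b \<or> 0 < c i \<and> refl_seq M (tail n c) = b"
proof -
  define T where "T = {d. \<exists>n. \<exists>i<n. c i < M \<and> d = tail n c \<or> 0 < c i \<and> d = refl_seq M (tail n c)}"
  have TI: "i < n \<Longrightarrow> c i < M \<Longrightarrow> tail n c \<in> T" "i < n \<Longrightarrow> 0 < c i \<Longrightarrow> refl_seq M (tail n c) \<in> T" for i n
    by (auto simp: T_def)
  have TD: "T \<subseteq> digit_seqs M" using c(1) by (auto simp: T_def)
  have T_tail: "tail k d \<in> T" if dT: "d \<in> T" for k d
  proof -
    obtain n i where i: "i < n" "c i < M \<and> d = tail n c \<or> 0 < c i \<and> d = refl_seq M (tail n c)"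
      using dT by (auto simp: T_def)
    then show ?thesis using TI[of i "n + k"] by (auto simp: tail_refl_seq)
  qed
  have T_refl: "refl_seq M (tail k d) \<in> T" if d: "d \<in> T" "d 0 > 0" "k \<ge> 1" for k d
  proof -
    obtain n i where "d = tail n c \<or> d = refl_seq M (tail n c)" using d(1) by (auto simp: T_def)
    then show ?thesis
    proof
      assume "d = tail n c"
      then show ?thesis using TI(2)[of n "n + k"] d by (simp add: tail_apply)
    next
      assume "d = refl_seq M (tail n c)"
      then show ?thesis using TI(1)[of n "n + k"] d c(1)
        by (simp add: tail_refl_seq) (simp add: refl_seq_def tail_apply)
    qed
  qed
  \<comment> \<open>Here \<open>c\<close> must differ from the constants 0 and \<open>M\<close>. A
    positive first digit passes to \<open>b\<close> and then to the members of \<open>T\<close>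
    approximating it, where \<open>T_refl\<close> needs it.\<close>
  have ex_pos: "\<exists>d\<in>T. d 0 > 0"
  proof (cases "c 0 < M")
    case True
    show ?thesis
    proof (cases "\<exists>n>0. c n > 0")
      case True
      then obtain n where "0 < n" "tail n c 0 > 0" by (auto simp: tail_apply)
      then show ?thesis using TI(1)[of 0 n] \<open>c 0 < M\<close> by blast
    next
      case False
      then have "c 0 > 0" using c(2) by (metis gr0I ext)
      moreover have "c 1 = 0" using False by (metis gr0I zero_less_one)
      ultimately have "refl_seq M (tail 1 c) 0 > 0" "0 < c 0"
        using \<open>c 0 < M\<close> by (auto simp: tail_apply refl_seq_def)
      moreover from this have "refl_seq M (tail 1 c) \<in> T" by (intro TI(2)[of 0]) auto
      ultimately show ?thesis by blast
    qed
  next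
    case False
    then have "c 0 = M" using digit_seqs_le[OF c(1), of 0] by simp
    moreover obtain n where "c n \<noteq> M" using c(3) by auto
    moreover have "c n < M" using digit_seqs_le[OF c(1), of n] \<open>c n \<noteq> M\<close> by simp
    ultimately have "0 < n" "0 < c 0" "refl_seq M (tail n c) 0 > 0"
      by (auto simp: tail_apply refl_seq_def intro: gr0I)
    then show ?thesis using TI(2)[of 0 n] by blast
  qed
  then obtain b where b: "b \<in> digit_seqs M" "\<And>d. d \<in> T \<Longrightarrow> d \<sqsubseteq> b" "\<And>N. \<exists>d\<in>T. agree N d b"
    using lex_supremum[OF _ TD] by (metis empty_iff)
  have b0: "b 0 > 0" using ex_pos b(2) lex_le_agree_le[of _ b 0] by (fastforce simp: agree_def)
  have ex: "\<exists>d\<in>T. agree N d b \<and> d 0 > 0" for N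
    using b(3)[of "Suc N"] b0 agree_mono[of "Suc N" _ b N] by (metis agreeD le_SucI le_refl zero_less_Suc)
  show ?thesis
  proof (rule that[OF b(1) b0])
    show "c \<in> V_adm M b" using c(1) b(2) TI by (intro V_admI) auto
    show "b \<sqsubseteq> a" if "c \<in> V_adm M a" for a
    proof (rule lex_le_closed)
      fix N
      obtain d where d: "d \<in> T" "agree N d b" using b(3) by blast
      then have "d \<sqsubseteq> a" using V_admD[OF that] by (auto simp: T_def)
      then show "\<exists>c' d'. agree N c' b \<and> agree N d' a \<and> c' \<sqsubseteq> d'" using d by (meson agree_refl)
    qed
    show "tail n b \<sqsubseteq> b" for n
    proof (rule lex_le_closed)
      fix N
      obtain d where d: "d \<in> T" "agree (n + N) d b" using b(3) by blast
      then show "\<exists>c' d'. agree N c' (tail n b) \<and> agree N d' b \<and> c' \<sqsubseteq> d'"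
        using agree_tail b(2)[OF T_tail] by (meson agree_refl)
    qed
    show "refl_seq M (tail n b) \<sqsubseteq> b" if "n \<ge> 1" for n
    proof (rule lex_le_closed)
      fix N
      obtain d where d: "d \<in> T" "agree (n + N) d b" "d 0 > 0" using ex by blast
      then show "\<exists>c' d'. agree N c' (refl_seq M (tail n b)) \<and> agree N d' b \<and> c' \<sqsubseteq> d'"
        using agree_refl_seq[OF agree_tail] b(2)[OF T_refl[OF _ _ that]] by (meson agree_refl)
    qed
    fix k :: nat assume k: "k \<ge> 1" "tail k b = refl_seq M b"
    obtain d where d: "d \<in> T" "agree k d b" "d 0 > 0" using ex by blast
    have dM: "d \<in> digit_seqs M" using d(1) TD by blast
    \<comment> \<open>A member of \<open>T\<close> sharing \<open>k\<close> digits with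
      \<open>b\<close> is squeezed between the two bounds after them, hence equals \<open>b\<close>:
      the supremum is attained.\<close>
    have "tail k d \<sqsubseteq> refl_seq M b" using lex_le_tail_iff[OF d(2)] b(2)[OF d(1)] k(2) by simp
    moreover have "refl_seq M b \<sqsubseteq> tail k d"
      using b(2)[OF T_refl[OF d(1,3) k(1)]] refl_seq_swap(2)[of "tail k d" M b] dM b(1) by simp
    ultimately have "tail k d = tail k b" using k(2) lex_le_antisym by metis
    then have "b \<in> T" using agree_tail_eqI d(1,2) by blast
    then show "\<exists>n. \<exists>i<n. c i < M \<and> tail n c = b \<or> 0 < c i \<and> refl_seq M (tail n c) = b"
      by (auto simp: T_def)
  qed
qed

section \<open>Extremal bases, boundary sequences and their isolation\<close>

context small_base
begin

text \<open>\<open>alpha M p\<close> is the supremum of the relevant tails of \<open>c\<close>. It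
  is infinite: after a last nonzero digit its reflected tail would be constantly \<open>M\<close>,
  which is not below \<open>alpha M q\<close>.\<close>

lemma V_adm_extremal_base:
  assumes c: "c \<in> V_adm M (alpha M q)" "c \<noteq> (\<lambda>_. 0)" "c \<noteq> (\<lambda>_. M)"
  obtains p where "p \<in> V_bases M" "1 < p" "p \<le> q" "c \<in> V_adm M (alpha M p)"
    "\<And>k. k \<ge> 1 \<Longrightarrow> tail k (alpha M p) = refl_seq M (alpha M p) \<Longrightarrow>
      \<exists>n. \<exists>i<n. c i < M \<and> tail n c = alpha M p \<or> 0 < c i \<and> refl_seq M (tail n c) = alpha M p"
proof -
  obtain b where b: "b \<in> digit_seqs M" "b 0 > 0" "c \<in> V_adm M b"
    "\<And>a. c \<in> V_adm M a \<Longrightarrow> b \<sqsubseteq> a"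
    "\<And>n. tail n b \<sqsubseteq> b" "\<And>n. n \<ge> 1 \<Longrightarrow> refl_seq M (tail n b) \<sqsubseteq> b"
    "\<And>k. k \<ge> 1 \<Longrightarrow> tail k b = refl_seq M b \<Longrightarrow>
      \<exists>n. \<exists>i<n. c i < M \<and> tail n c = b \<or> 0 < c i \<and> refl_seq M (tail n c) = b"
    using lex_supremum_of_tails[OF V_admD(1)[OF c(1)] c(2,3)] by blast
  have ba: "b \<sqsubseteq> alpha M q" using b(4) c(1) by blast
  have "infinite_seq b"
    unfolding infinite_seq_iff
  proof (intro allI impI, rule ccontr)
    fix n assume n: "b n \<noteq> 0" "\<not> (\<exists>m>n. b m \<noteq> 0)"
    then have "refl_seq M (tail (Suc n) b) = (\<lambda>_. M)" by (auto simp: refl_seq_def tail_def)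
    then show False using b(6)[of "Suc n"] ba const_not_le_alpha lex_le_trans by simp
  qed
  then obtain p where p: "1 < p" "p \<le> real M + 1" "alpha M p = b"
    using alpha_surj[OF M_pos b(1) _ b(2,5)] by blast
  have pq: "p \<le> q" using alpha_le_iff[OF p(1) q(1) p(2) q(2)] ba p(3) by simp
  then interpret p: small_base M p using p q_less by unfold_locales auto
  have "p \<in> V_bases M" using p.V_bases_iff p(3) b(6) by simp
  then show ?thesis using that[of p] p(1,3) pq b(3,7) by blast
qed

text \<open>The sequence \<open>c\<close> is cut at a position \<open>m\<close> from which the
  window of the first \<open>N\<close> digits agrees with \<open>alpha M q\<close>, and is continued
  by \<open>alpha M q\<close>. This changes nothing in the window. As \<open>m\<close> is the
  earliest such position, constrained tails starting before it differ from \<open>alpha M q\<close>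
  inside the window and so remain strictly smaller.\<close>

lemma V_adm_approx:
  assumes "c \<in> U_adm M (alpha M q)" "q \<in> V_bases M"
  obtains d where "d \<in> V_adm M (alpha M q) - U_adm M (alpha M q)" "agree N d c"
proof -
  let ?a = "alpha M q"
  have *: "\<exists>d. d \<in> V_adm M ?a - U_adm M ?a \<and> agree N d c"
    if c: "c \<in> U_adm M ?a" and i: "i < N" "c i < M" for c i N
  proof -
    define P where "P = (\<lambda>m. m \<le> N \<and> (\<exists>i<m. c i < M) \<and> agree (N - m) (tail m c) ?a)"
    define m where "m = (LEAST m. P m)"
    have "P N" using i by (auto simp: P_def agree_def)
    then have m: "P m" unfolding m_def by (rule LeastI)
    have least: "\<not> P n" if "n < m" for n using that not_less_Least by (simp add: m_def)
    have lt: "tail m c \<sqsubset> ?a" using m U_admD(2)[OF c] by (auto simp: P_def)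
    have cM: "c \<in> digit_seqs M" using c by (rule U_admD)
    define d where "d = glue m c ?a"
    have dc: "agree m d c" and tm: "tail m d = ?a" by (auto simp: d_def)
    have dM: "d \<in> digit_seqs M" using cM by (simp add: d_def digit_seqs_glue)
    have "agree (m + (N - m)) (glue m c ?a) (glue m c (tail m c))"
      using m by (intro agree_glue_cong) (auto simp: P_def agree_sym)
    then have dcN: "agree N d c" using m by (simp add: P_def d_def)
    have less: "c \<sqsubset> d" using lex_less_tail_iff[OF agree_sym[OF dc]] lt tm by simp
    have "d \<in> V_adm M ?a"
    proof (rule V_admI[OF dM])
      fix n j :: nat assume j: "j < n"
      show "tail n d \<sqsubseteq> ?a" if "d j < M"
      proof (cases "n < m")
        case False
        then show ?thesis using tail_glue_ge[of m n c ?a] alpha_tail_le by (simp add: d_def)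
      next
        case True
        have cj: "c j < M" using that agreeD[OF dc] j True by simp
        obtain k where k: "agree k (tail n c) ?a" "tail n c k < ?a k"
          using U_admD(2)[OF c j cj] by (rule lex_lessE)
        have "\<not> agree (N - n) (tail n c) ?a"
          using least[OF True] j cj True m by (auto simp: P_def)
        then have "k < N - n" using k(1) agree_mono by (meson not_le)
        then have "agree (Suc k) (tail n d) (tail n c)"
          using dcN agree_mono[of N d c "n + Suc k"] by (intro agree_tail) auto
        then have "tail n d \<sqsubset> ?a"
          using k by (intro lex_lessI[of k]) (auto simp: agree_def)
        then show ?thesis by (rule lex_less_imp_le)
      qed
      show "refl_seq M (tail n d) \<sqsubseteq> ?a" if "d j > 0"
      proof (cases "n \<le> m")
        case False
        then have "tail n d = tail (n - m) ?a" using tail_glue_ge[of m n c ?a] by (simp add: d_def)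
        then show ?thesis using V_bases_iff assms(2) False by simp
      next
        case True
        have "c j > 0" using that agreeD[OF dc] j True by simp
        then have "refl_seq M (tail n c) \<sqsubset> ?a" using U_admD(3)[OF c j] by simp
        \<comment> \<open>The new end raises the sequence and hence lowers its reflected
          tails.\<close>
        moreover have "tail n c \<sqsubset> tail n d"
          using less lex_less_tail_iff[of n c d] agree_mono[OF dc True] agree_sym by blast
        then have "refl_seq M (tail n d) \<sqsubset> refl_seq M (tail n c)"
          using refl_seq_less_iff[of "tail n d" M "tail n c"] cM dM by simp
        ultimately show ?thesis using less_fun_trans lex_less_imp_le by blast
      qed
    qed
    moreover have "d \<notin> U_adm M ?a"
    proof
      assume d: "d \<in> U_adm M ?a"
      obtain j where "j < m" "c j < M" using m by (auto simp: P_def)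
      then have "tail m d \<sqsubset> ?a" using U_admD(2)[OF d] agreeD[OF dc] by metis
      then show False using tm by simp
    qed
    ultimately show ?thesis using dcN by blast
  qed
  show ?thesis
  proof (cases "c 0 < M")
    case True
    then obtain d where "d \<in> V_adm M ?a - U_adm M ?a" "agree (Suc N) d c"
      using *[OF assms(1), of 0 "Suc N"] by blast
    then show ?thesis using that agree_mono by (meson le_SucI le_refl)
  next
    case False
    \<comment> \<open>Without a digit below \<open>M\<close> at the start, the reflected sequence
      has one; \<open>Suc N\<close> keeps position 0 inside the window.\<close>
    then have "refl_seq M c 0 < M" using M_pos by (simp add: refl_seq_def)
    then obtain d where d: "d \<in> V_adm M ?a - U_adm M ?a" "agree (Suc N) d (refl_seq M c)"
      using *[OF refl_seq_in_U_adm[OF assms(1)], of 0 "Suc N"] by blast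
    have "refl_seq M d \<in> V_adm M ?a - U_adm M ?a"
      using d(1) refl_seq_in_U_adm[of "refl_seq M d" M ?a] refl_seq_refl_seq[OF V_admD(1)[of d M ?a]]
      by auto
    moreover have "agree N (refl_seq M d) c"
      using agree_refl_seq[OF d(2), of M] U_admD(1)[OF assms(1)] agree_mono by fastforce
    ultimately show ?thesis using that by blast
  qed
qed

text \<open>Some relevant tail or reflected tail of \<open>c\<close> equals
  \<open>alpha M q\<close>. Any \<open>d\<close> agreeing with \<open>c\<close> through the next
  \<open>k\<close> digits is then squeezed: its following tail is at most the reflection of
  \<open>alpha M q\<close> by the first bound and at least that by the second.\<close>

lemma V_adm_isolated:
  assumes c: "c \<in> V_adm M (alpha M q) - U_adm M (alpha M q)"
    and k: "k \<ge> 1" "tail k (alpha M q) = refl_seq M (alpha M q)"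
  obtains N where "\<And>d. d \<in> V_adm M (alpha M q) \<Longrightarrow> agree N d c \<Longrightarrow> d = c"
proof -
  let ?a = "alpha M q"
  have *: "d = c" if i: "i < n" "c i < M" "tail n c = ?a"
      and d: "d \<in> V_adm M ?a" "agree (n + k) d c" for c d n i
  proof -
    have cd: "c j = d j" if "j < n + k" for j using agreeD[OF d(2) that] by simp
    have dM: "d \<in> digit_seqs M" using d(1) by (rule V_admD)
    have "tail n d \<sqsubseteq> ?a" using V_admD(2)[OF d(1) i(1)] cd i by simp
    moreover have agr: "agree k (tail n d) ?a" using agree_tail[OF d(2)] i(3) by simp
    ultimately have "tail (n + k) d \<sqsubseteq> refl_seq M ?a" using lex_le_tail_iff k(2) by fastforce
    moreover have "?a 0 = c n" using i(3) tail_apply[of n c 0] by simp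
    then have "d n > 0" using cd[of n] k(1) alpha_0_pos by simp
    then have "refl_seq M (tail (n + k) d) \<sqsubseteq> ?a" using V_admD(3)[OF d(1), of n "n + k"] k(1) by simp
    then have "refl_seq M ?a \<sqsubseteq> tail (n + k) d" using refl_seq_swap(2)[of "tail (n + k) d"] dM by simp
    ultimately have "tail (n + k) d = refl_seq M ?a" by (rule lex_le_antisym)
    moreover have "tail (n + k) c = refl_seq M ?a" using k(2) i(3) tail_tail[of k n c] by simp
    ultimately show ?thesis using agree_tail_eqI[OF d(2)] by simp
  qed
  have cV: "c \<in> V_adm M ?a" using c by simp
  have cM: "c \<in> digit_seqs M" using cV by (rule V_admD)
  obtain n i where ni: "i < n" "c i < M \<and> \<not> tail n c \<sqsubset> ?a \<or> 0 < c i \<and> \<not> refl_seq M (tail n c) \<sqsubset> ?a"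
    using c cM by (auto simp: U_adm_def)
  from ni(2) show ?thesis
  proof
    assume ci: "c i < M \<and> \<not> tail n c \<sqsubset> ?a"
    then have "tail n c = ?a" using V_admD(2)[OF cV ni(1)] lex_le_antisym by simp
    then show ?thesis using that *[OF ni(1)] ci by blast
  next
    assume ci: "0 < c i \<and> \<not> refl_seq M (tail n c) \<sqsubset> ?a"
    then have "refl_seq M (tail n c) = ?a" "0 < c i"
      using V_admD(3)[OF cV ni(1)] lex_le_antisym by auto
    then have "d = c" if "d \<in> V_adm M ?a" "agree (n + k) d c" for d
      using *[OF ni(1), of "refl_seq M c" "refl_seq M d"] that cM V_admD(1)[OF that(1)]
        refl_seq_less_iff_pos(1)[OF cM] agree_refl_seq[OF that(2)]
      by (metis refl_seq_in_V_adm refl_seq_refl_seq tail_refl_seq)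
    then show ?thesis using that by blast
  qed
qed

end

section \<open>Approximation by periodic sequences\<close>

text \<open>Every nonempty final segment of \<open>a 0, \<dots>, a (n - 1)\<close> differs from the reflection of the initial
  segment of \<open>a\<close> of the same length.\<close>

definition good_prefix :: "nat \<Rightarrow> (nat \<Rightarrow> nat) \<Rightarrow> nat \<Rightarrow> bool"
  where "good_prefix M a n \<longleftrightarrow> (\<forall>k<n. \<not> agree (n - k) (refl_seq M (tail k a)) a)"

text \<open>A bad length is repaired by lengthening. Take the least \<open>k\<close> whose final
  segment matches the reflection, and stop right after the first position where
  \<open>tail k a\<close> deviates from the reflection of \<open>a\<close>.\<close>

lemma good_prefix_exists:
  assumes a: "a \<in> digit_seqs M" "\<And>n. tail n a \<sqsubseteq> a" "\<And>n. refl_seq M (tail n a) \<sqsubset> a"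
  obtains n where "n > N" "good_prefix M a n"
proof (cases "good_prefix M a (Suc N)")
  case False
  define P where "P = (\<lambda>k. k < Suc N \<and> agree (Suc N - k) (refl_seq M (tail k a)) a)"
  define k where "k = (LEAST k. P k)"
  have "\<exists>k. P k" using False by (auto simp: good_prefix_def P_def)
  then have k: "P k" unfolding k_def by (rule LeastI_ex)
  have least: "\<not> P n" if "n < k" for n using that not_less_Least by (simp add: k_def)
  obtain l where l: "agree l (refl_seq M (tail k a)) a" "refl_seq M (tail k a) l < a l"
    using a(3)[of k] by (rule lex_lessE)
  have kl: "Suc N \<le> k + l"
  proof (rule ccontr)
    assume "\<not> ?thesis"
    then have "l < Suc N - k" by simp
    then show False using k l(2) by (auto simp: P_def agree_def)
  qed
  have "good_prefix M a (Suc (k + l))"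
    unfolding good_prefix_def
  proof (intro allI impI notI)
    fix j assume j: "j < Suc (k + l)" "agree (Suc (k + l) - j) (refl_seq M (tail j a)) a"
    consider "j < k" | "j = k" | "k < j" by linarith
    then show False
    proof cases
      case 1
      then have "P j" using k kl agree_mono[OF j(2), of "Suc N - j"] by (simp add: P_def)
      then show False using least 1 by blast
    next
      case 2
      then have "refl_seq M (tail k a) l = a l" using agreeD[OF j(2), of l] by simp
      then show False using l(2) by simp
    next
      case 3
      \<comment> \<open>A later match would compose with the one starting at \<open>k\<close>: the
        two reflections cancel, and \<open>tail m a\<close> would exceed \<open>a\<close>.\<close>
      define m where "m = j - k"
      have m: "j = k + m" "m \<le> l" using 3 j(1) by (auto simp: m_def)
      have aM: "a i \<le> M" for i using a(1) by (rule digit_seqs_le)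
      have e1: "M - a (k + i) = a i" if "i < l" for i
        using agreeD[OF l(1) that] by (simp add: refl_seq_def tail_apply)
      have e2: "M - a (k + m + i) = a i" if "i \<le> l - m" for i
        using agreeD[OF j(2), of i] that m by (simp add: refl_seq_def tail_apply)
      have "agree (l - m) a (tail m a)"
        unfolding agree_def
      proof (intro allI impI)
        fix i assume "i < l - m"
        then show "a i = tail m a i" using e1[of "m + i"] e2[of i] by (simp add: tail_apply add.assoc)
      qed
      moreover have "a (l - m) < tail m a (l - m)"
        using e2[of "l - m"] l(2) m by (simp add: tail_apply refl_seq_def)
      ultimately have "a \<sqsubset> tail m a" by (rule lex_lessI)
      then show False using a(2)[of m] not_lex_le by blast
    qed
  qed
  then show ?thesis using that[of "Suc (k + l)"] kl by simp
qed (use that[of "Suc N"] in simp)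

text \<open>With \<open>u\<close> a good prefix of length \<open>n\<close>, \<open>s\<close> repeats
  \<open>u\<close> followed by its reflection. Goodness places the first difference between a
  reflected tail and \<open>a\<close> inside the current block, so the strict inequalities for
  \<open>a\<close> carry over to \<open>s\<close>.\<close>

lemma periodic_below:
  assumes a: "a \<in> digit_seqs M" "\<And>n. tail n a \<sqsubseteq> a" "\<And>n. refl_seq M (tail n a) \<sqsubset> a"
  obtains s where "s \<in> digit_seqs M" "agree N s a" "s \<sqsubset> a"
    "\<And>k. tail k s \<sqsubseteq> s" "\<And>k. refl_seq M (tail k s) \<sqsubseteq> s"
proof -
  obtain n where n: "n > N" "good_prefix M a n" by (rule good_prefix_exists[OF a])
  define s where "s = (\<lambda>i. if even (i div n) then a (i mod n) else M - a (i mod n))"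
  have aM: "a i \<le> M" for i using a(1) by (rule digit_seqs_le)
  have sM: "s \<in> digit_seqs M" using aM by (auto simp: digit_seqs_def s_def)
  have per: "tail n s = refl_seq M s"
  proof
    show "tail n s i = refl_seq M s i" for i
      using n(1) aM[of "i mod n"] by (simp add: tail_apply refl_seq_def s_def div_add_self1)
  qed
  have sa: "agree n s a" by (auto simp: agree_def s_def)
  have sm: "s (n + i) = M - s i" for i using per by (metis refl_seq_def tail_apply)
  have agr: "agree (n - k) (tail k s) (tail k a)" "agree (n - k) s a" if "k < n" for k
    using agree_tail[of k "n - k" s a] agree_mono[OF sa, of "n - k"] that sa by auto
  have refl_less: "refl_seq M (tail k s) \<sqsubset> s" if k: "k < n" for k
  proof -
    obtain l where l: "agree l (refl_seq M (tail k a)) a" "refl_seq M (tail k a) l < a l"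
      using a(3)[of k] by (rule lex_lessE)
    have "\<not> agree (n - k) (refl_seq M (tail k a)) a" using n(2) k by (simp add: good_prefix_def)
    then have "l < n - k" using l(1) agree_mono by (meson not_le)
    then show ?thesis
      using l agr[OF k] by (intro lex_lessI[of l]) (auto simp: agree_def refl_seq_def)
  qed
  have le: "tail k s \<sqsubseteq> s" if k: "k < n" for k
  proof (cases "agree (n - k) (tail k a) a")
    case True
    \<comment> \<open>If the block ends undecided, the comparison continues between the reflection
      of \<open>s\<close> and \<open>tail (n - k) s\<close>, where the bound on reflected tails
      settles it.\<close>
    then have agr': "agree (n - k) (tail k s) s" using agr[OF k] agree_sym agree_trans by blast
    show ?thesis
    proof (cases "k = 0")
      case False
      then have "refl_seq M (tail (n - k) s) \<sqsubset> s" using refl_less k by simp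
      then have "refl_seq M s \<sqsubset> tail (n - k) s" using refl_seq_swap(1)[of "tail (n - k) s"] sM by simp
      then have "tail k s \<sqsubset> s" using lex_less_tail_iff[OF agr'] per k by simp
      then show ?thesis by (rule lex_less_imp_le)
    qed simp
  next
    case False
    then have "tail k a \<noteq> a" by auto
    then obtain l where l: "agree l (tail k a) a" "tail k a l < a l"
      using a(2)[of k] by (auto simp: lex_le_def elim: lex_lessE)
    have "l < n - k" using False l(1) agree_mono by (meson not_le)
    then have "tail k s \<sqsubset> s"
      using l agr[OF k] by (intro lex_lessI[of l]) (auto simp: agree_def)
    then show ?thesis by (rule lex_less_imp_le)
  qed
  have all: "tail k s \<sqsubseteq> s \<and> refl_seq M (tail k s) \<sqsubseteq> s" for k
  proof (induction k rule: less_induct)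
    case (less k)
    show ?case
    proof (cases "k < n")
      case True
      then show ?thesis using le refl_less lex_less_imp_le by blast
    next
      case False
      then have "tail k s = tail (k - n) (tail n s)" by simp
      also have "\<dots> = refl_seq M (tail (k - n) s)" by (simp only: per tail_refl_seq)
      finally show ?thesis using less[of "k - n"] False n(1) sM by simp
    qed
  qed
  have "s \<noteq> a"
  proof
    assume "s = a"
    then have "refl_seq M (tail n a) = a" using per a(1) by simp
    then show False using a(3)[of n] by simp
  qed
  then obtain m where m: "agree m s a" "s m \<noteq> a m" by (rule first_difference)
  have nm: "n \<le> m" using sa m(2) by (meson agree_def not_le)
  have eqs: "s i = a i" if "i < m" for i using agreeD[OF m(1) that] .
  \<comment> \<open>Up to \<open>m\<close> the sequence \<open>a\<close> satisfies the same
    reflection rule with shift \<open>n\<close> as \<open>s\<close>. It first breaks the rule at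
    \<open>m\<close>, and the strict bound on its reflected tail says in which direction.\<close>
  have "agree (m - n) (refl_seq M (tail n a)) a"
    unfolding agree_def
  proof (intro allI impI)
    fix i assume i: "i < m - n"
    then have "M - a (n + i) = M - (M - a i)" using eqs[of "n + i"] eqs[of i] sm[of i] nm by simp
    then show "refl_seq M (tail n a) i = a i" using aM[of i] by (simp add: refl_seq_def tail_apply)
  qed
  moreover have smm: "s m = M - a (m - n)" using sm[of "m - n"] eqs[of "m - n"] nm n(1) by simp
  then have "refl_seq M (tail n a) (m - n) \<noteq> a (m - n)"
    using m(2) nm aM[of m] aM[of "m - n"] by (auto simp: refl_seq_def tail_apply)
  ultimately have "refl_seq M (tail n a) (m - n) < a (m - n)"
    using a(3)[of n] lex_less_agree_iff by blast
  then have "s m < a m" using smm nm aM[of m] aM[of "m - n"] by (simp add: refl_seq_def tail_apply)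
  then have "s \<sqsubset> a" using m(1) by (intro lex_lessI)
  then show ?thesis using that[of s] sM agree_mono[OF sa, of N] n(1) all by simp
qed

section \<open>Density of \<open>U_adm\<close> and gaps of \<open>V_bases\<close>\<close>

context small_base
begin

text \<open>The case \<open>k = 0\<close> follows from \<open>k = 1\<close>: otherwise
  \<open>tail 1\<close> of \<open>alpha M q\<close> would exceed \<open>alpha M q\<close>.\<close>

lemma refl_less_alpha:
  assumes B: "\<And>k. k \<ge> 1 \<Longrightarrow> refl_seq M (tail k (alpha M q)) \<sqsubset> alpha M q"
  shows "refl_seq M (tail k (alpha M q)) \<sqsubset> alpha M q"
proof (cases "k = 0")
  case True
  show ?thesis
  proof (rule ccontr)
    assume "\<not> ?thesis"
    then have "alpha M q \<sqsubseteq> refl_seq M (alpha M q)" using True by simp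
    then have "refl_seq M (tail 1 (alpha M q)) \<sqsubset> refl_seq M (alpha M q)"
      using B[of 1] lex_less_le_trans by simp
    then have "alpha M q \<sqsubset> tail 1 (alpha M q)"
      using refl_seq_less_iff[of "tail 1 (alpha M q)" M "alpha M q"] by simp
    then show False using alpha_tail_le[of 1] not_lex_le by blast
  qed
qed (use B in simp)

text \<open>At the first place where \<open>c\<close> or its reflection attains
  \<open>alpha M q\<close>, that tail is replaced by a periodic sequence just below it, all of whose
  tails and reflected tails stay strictly below \<open>alpha M q\<close>.\<close>

lemma U_adm_approx:
  assumes B: "\<And>k. k \<ge> 1 \<Longrightarrow> refl_seq M (tail k (alpha M q)) \<sqsubset> alpha M q"
    and c: "c \<in> V_adm M (alpha M q)"
  obtains d where "d \<in> U_adm M (alpha M q)" "agree N d c"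
proof -
  let ?a = "alpha M q"
  have *: "\<exists>d. d \<in> U_adm M ?a \<and> agree N d c"
    if c: "c \<in> V_adm M ?a" "tail n c = ?a"
      and strict: "\<And>m i. m < n \<Longrightarrow> i < m \<Longrightarrow>
        (c i < M \<longrightarrow> tail m c \<sqsubset> ?a) \<and> (0 < c i \<longrightarrow> refl_seq M (tail m c) \<sqsubset> ?a)" for c n
  proof -
    have cM: "c \<in> digit_seqs M" using c(1) by (rule V_admD)
    have loc: "\<exists>K. \<forall>d. agree K d c \<longrightarrow> (\<forall>i<m. (c i < M \<longrightarrow> tail m d \<sqsubset> ?a) \<and>
        (0 < c i \<longrightarrow> refl_seq M (tail m d) \<sqsubset> ?a))" if m: "m < n" for m
    proof -
      have e1: "\<exists>K. \<forall>d. agree K d c \<longrightarrow> tail m d \<sqsubset> ?a" if lt: "tail m c \<sqsubset> ?a"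
      proof -
        obtain K where "\<And>c' d'. agree K c' (tail m c) \<Longrightarrow> agree K d' ?a \<Longrightarrow> c' \<sqsubset> d'"
          using lex_less_locally_constant[OF lt] by metis
        then have "\<forall>d. agree (m + K) d c \<longrightarrow> tail m d \<sqsubset> ?a" using agree_tail agree_refl by blast
        then show ?thesis by blast
      qed
      have e2: "\<exists>K. \<forall>d. agree K d c \<longrightarrow> refl_seq M (tail m d) \<sqsubset> ?a" if lt: "refl_seq M (tail m c) \<sqsubset> ?a"
      proof -
        obtain K where "\<And>c' d'. agree K c' (refl_seq M (tail m c)) \<Longrightarrow> agree K d' ?a \<Longrightarrow> c' \<sqsubset> d'"
          using lex_less_locally_constant[OF lt] by metis
        then have "\<forall>d. agree (m + K) d c \<longrightarrow> refl_seq M (tail m d) \<sqsubset> ?a"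
          using agree_tail agree_refl agree_refl_seq by blast
        then show ?thesis by blast
      qed
      obtain K1 where K1: "tail m c \<sqsubset> ?a \<Longrightarrow> agree K1 d c \<Longrightarrow> tail m d \<sqsubset> ?a" for d
        using e1 by blast
      obtain K2 where K2: "refl_seq M (tail m c) \<sqsubset> ?a \<Longrightarrow> agree K2 d c \<Longrightarrow> refl_seq M (tail m d) \<sqsubset> ?a" for d
        using e2 by blast
      show ?thesis
        by (rule exI[of _ "max K1 K2"]) (use K1 K2 strict[OF m] agree_mono in \<open>meson max.cobounded1 max.cobounded2\<close>)
    qed
    then obtain K where K: "\<And>m d i. m < n \<Longrightarrow> agree (K m) d c \<Longrightarrow> i < m \<Longrightarrow>
        (c i < M \<longrightarrow> tail m d \<sqsubset> ?a) \<and> (0 < c i \<longrightarrow> refl_seq M (tail m d) \<sqsubset> ?a)"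
      by metis
    \<comment> \<open>Only finitely many strict inequalities lie before \<open>n\<close>, each
      stable under agreement of \<open>K m\<close> digits; the sum dominates all of them.\<close>
    define L where "L = N + (\<Sum>m<n. K m)"
    have KL: "K m \<le> L" if "m < n" for m
      using that member_le_sum[of m "{..<n}" K] by (simp add: L_def)
    obtain s where s: "s \<in> digit_seqs M" "agree L s ?a" "s \<sqsubset> ?a"
      "\<And>k. tail k s \<sqsubseteq> s" "\<And>k. refl_seq M (tail k s) \<sqsubseteq> s"
      using periodic_below[OF alpha_digits alpha_tail_le refl_less_alpha[OF B]] by metis
    define d where "d = glue n c s"
    have "agree (n + L) (glue n c s) (glue n c (tail n c))"
      using s(2) c(2) by (intro agree_glue_cong) auto
    then have dc: "agree (n + L) d c" by (simp add: d_def)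
    have "d \<in> U_adm M ?a"
    proof (rule U_admI)
      show "d \<in> digit_seqs M" using cM s(1) by (simp add: d_def digit_seqs_glue)
      fix m i :: nat assume i: "i < m"
      have ge: "tail m d = tail (m - n) s" if "\<not> m < n" using that tail_glue_ge[of n m c s] by (simp add: d_def)
      have ci: "c i = d i" if "m < n" using agreeD[OF dc, of i] that i by simp
      have K': "(c i < M \<longrightarrow> tail m d \<sqsubset> ?a) \<and> (0 < c i \<longrightarrow> refl_seq M (tail m d) \<sqsubset> ?a)" if "m < n"
        using K[OF that _ i] agree_mono[OF dc, of "K m"] KL[OF that] by simp
      show "tail m d \<sqsubset> ?a" if "d i < M"
        using K' ci ge that s(3,4) lex_le_less_trans by (cases "m < n") auto
      show "refl_seq M (tail m d) \<sqsubset> ?a" if "0 < d i"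
        using K' ci ge that s(3,5) lex_le_less_trans by (cases "m < n") auto
    qed
    then show ?thesis using agree_mono[OF dc, of N] by (auto simp: L_def)
  qed
  show ?thesis
  proof (cases "c \<in> U_adm M ?a")
    case True
    then show ?thesis using that[of c] by simp
  next
    case False
    have cM: "c \<in> digit_seqs M" using c by (rule V_admD)
    define P where "P = (\<lambda>n. \<exists>i<n. c i < M \<and> tail n c = ?a \<or> 0 < c i \<and> refl_seq M (tail n c) = ?a)"
    have less: "(c i < M \<longrightarrow> tail m c \<sqsubset> ?a) \<and> (0 < c i \<longrightarrow> refl_seq M (tail m c) \<sqsubset> ?a)"
      if "i < m" "\<not> P m" for i m
      using that V_admD(2,3)[OF c that(1)] by (auto simp: P_def lex_le_def)
    have "\<exists>n. P n"
    proof (rule ccontr)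
      assume "\<not> ?thesis"
      then have "c \<in> U_adm M ?a" using less cM by (intro U_admI) auto
      then show False using False by blast
    qed
    define n where "n = (LEAST n. P n)"
    have n: "P n" unfolding n_def by (rule LeastI_ex) fact
    have strict: "(c i < M \<longrightarrow> tail m c \<sqsubset> ?a) \<and> (0 < c i \<longrightarrow> refl_seq M (tail m c) \<sqsubset> ?a)"
      if "m < n" "i < m" for i m
      using less[OF that(2)] not_less_Least[of m P] that(1) by (simp add: n_def)
    consider "tail n c = ?a" | "refl_seq M (tail n c) = ?a" using n by (auto simp: P_def)
    then show ?thesis
    proof cases
      case 1
      then show ?thesis using *[OF c 1 strict] that by blast
    next
      case 2
      have "\<exists>d. d \<in> U_adm M ?a \<and> agree N d (refl_seq M c)"
      proof (rule *)
        show "refl_seq M c \<in> V_adm M ?a" using c by simp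
        show "tail n (refl_seq M c) = ?a" using 2 by (simp add: tail_refl_seq)
        show "(refl_seq M c i < M \<longrightarrow> tail m (refl_seq M c) \<sqsubset> ?a) \<and>
            (0 < refl_seq M c i \<longrightarrow> refl_seq M (tail m (refl_seq M c)) \<sqsubset> ?a)"
          if "m < n" "i < m" for m i
          using strict[OF that] cM by (simp add: tail_refl_seq refl_seq_less_iff_pos)
      qed
      then obtain d where "d \<in> U_adm M ?a" "agree N d (refl_seq M c)" by blast
      then show ?thesis using that[of "refl_seq M d"] agree_refl_seq[of N d "refl_seq M c" M] cM by simp
    qed
  qed
qed

text \<open>Otherwise \<open>periodic_below\<close> supplies a sequence below
  \<open>alpha M q\<close> that agrees with it long enough to stay above \<open>alpha M p\<close>.
  It is the quasi-greedy expansion of 1 in a base of \<open>V_bases M\<close> strictly between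
  \<open>p\<close> and \<open>q\<close>.\<close>

lemma V_bases_left_gap:
  assumes "q \<in> V_bases M" "1 < p" "p < q" "V_bases M \<inter> {p<..<q} = {}"
  shows "\<exists>k\<ge>1. tail k (alpha M q) = refl_seq M (alpha M q)"
proof (rule ccontr)
  assume n: "\<not> ?thesis"
  have B: "refl_seq M (tail k (alpha M q)) \<sqsubset> alpha M q" if "k \<ge> 1" for k
  proof -
    have "refl_seq M (tail k (alpha M q)) \<noteq> alpha M q"
      using n that refl_seq_refl_seq[OF digit_seqs_tail[OF alpha_digits], of k] by metis
    moreover have "refl_seq M (tail k (alpha M q)) \<sqsubseteq> alpha M q"
      using assms(1) V_bases_iff that by blast
    ultimately show ?thesis by (simp add: lex_le_def)
  qed
  have pq: "alpha M p \<sqsubset> alpha M q" using alpha_strict_mono assms q by blast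
  obtain N where N: "\<And>c' d'. agree N c' (alpha M p) \<Longrightarrow> agree N d' (alpha M q) \<Longrightarrow> c' \<sqsubset> d'"
    using lex_less_locally_constant[OF pq] by metis
  obtain s where s: "s \<in> digit_seqs M" "agree N s (alpha M q)" "s \<sqsubset> alpha M q"
    "\<And>k. tail k s \<sqsubseteq> s" "\<And>k. refl_seq M (tail k s) \<sqsubseteq> s"
    using periodic_below[OF alpha_digits alpha_tail_le refl_less_alpha[OF B]] by metis
  have ps: "alpha M p \<sqsubset> s" using N s(2) by simp
  interpret p: base M p using assms q by unfold_locales auto
  have "alpha M p 0 \<le> s 0" using lex_le_agree_le[of "alpha M p" s 0] ps by (simp add: lex_le_def agree_def)
  then have s0: "s 0 > 0" using p.alpha_0_pos by simp
  have "infinite_seq s"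
    unfolding infinite_seq_iff
  proof (intro allI impI, rule ccontr)
    fix n assume n: "s n \<noteq> 0" "\<not> (\<exists>m>n. s m \<noteq> 0)"
    then have "refl_seq M (tail (Suc n) s) = (\<lambda>_. M)" by (auto simp: refl_seq_def tail_def)
    then show False using s(3) s(5)[of "Suc n"] const_not_le_alpha lex_le_less_trans lex_less_imp_le by metis
  qed
  then obtain r where r: "1 < r" "r \<le> real M + 1" "alpha M r = s"
    using alpha_surj[OF M_pos s(1) _ s0 s(4)] by blast
  have rq: "r < q" using alpha_le_iff[OF q(1) r(1) q(2) r(2)] s(3) r(3) by (metis not_le not_lex_le)
  have pr: "p < r" using alpha_le_iff[OF r(1) assms(2) r(2) p.q(2)] ps r(3) by (metis not_le not_lex_le)
  interpret r: small_base M r using r rq q_less by unfold_locales auto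
  have "r \<in> V_bases M" using r.V_bases_iff r(3) s(5) by simp
  then show False using assms(4) pr rq by auto
qed

text \<open>The extremal base cannot be \<open>q\<close>: the gap would make the supremum of the
  relevant tails attained, whereas those of \<open>c\<close> are strictly below
  \<open>alpha M q\<close>. The gap then moves the extremal base down to \<open>p0\<close> or
  below.\<close>

lemma U_adm_extremal_base:
  assumes c: "c \<in> U_adm M (alpha M q)" "c \<noteq> (\<lambda>_. 0)" "c \<noteq> (\<lambda>_. M)"
    and gap: "1 \<le> p0" "p0 < q" "V_bases M \<inter> {p0<..<q} = {}"
  obtains p where "1 < p" "p \<le> p0" "c \<in> V_adm M (alpha M p)" "p \<in> V_bases M"
proof -
  have "c \<in> V_adm M (alpha M q)" using c(1) U_adm_subset_V_adm by blast
  then obtain p where p: "p \<in> V_bases M" "1 < p" "p \<le> q" "c \<in> V_adm M (alpha M p)"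
    and att: "\<And>k. k \<ge> 1 \<Longrightarrow> tail k (alpha M p) = refl_seq M (alpha M p) \<Longrightarrow>
      \<exists>n. \<exists>i<n. c i < M \<and> tail n c = alpha M p \<or> 0 < c i \<and> refl_seq M (tail n c) = alpha M p"
    by (rule V_adm_extremal_base[OF _ c(2,3)]) blast
  have "p \<noteq> q"
  proof
    assume "p = q"
    \<comment> \<open>\<open>p0\<close> may be 1, while \<open>V_bases_left_gap\<close> needs a left
      end above 1.\<close>
    define p1 where "p1 = (p0 + q) / 2"
    have p1: "1 < p1" "p1 < q" "p0 < p1" using gap by (auto simp: p1_def)
    have "V_bases M \<inter> {p1<..<q} = {}" using gap(3) p1(3) by force
    then obtain k where "k \<ge> 1" "tail k (alpha M q) = refl_seq M (alpha M q)"
      using V_bases_left_gap[of p1] p(1) p1 \<open>p = q\<close> by blast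
    then obtain n i where "i < n" "c i < M \<and> tail n c = alpha M q \<or> 0 < c i \<and> refl_seq M (tail n c) = alpha M q"
      using att \<open>p = q\<close> by blast
    then show False using U_admD(2,3)[OF c(1)] lex_less_irrefl by metis
  qed
  then have "p \<le> p0" using p gap(3) by force
  then show ?thesis using that p by blast
qed

lemma const_in_V_adm: "(\<lambda>_. 0) \<in> V_adm M a" "(\<lambda>_. M) \<in> V_adm M a"
proof -
  have "(\<lambda>_. 0) \<sqsubseteq> a" for a
    by (metis lex_lessE less_nat_zero_code not_lex_less)
  then show "(\<lambda>_. 0) \<in> V_adm M a" "(\<lambda>_. M) \<in> V_adm M a"
    by (auto simp: V_adm_def digit_seqs_def tail_def refl_seq_def)
qed

lemma U_adm_eq_V_adm:
  assumes "1 < p" "p < q" "V_bases M \<inter> {p<..<q} = {}"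
  shows "U_adm M (alpha M q) = V_adm M (alpha M p)"
proof
  show "V_adm M (alpha M p) \<subseteq> U_adm M (alpha M q)"
    using V_adm_subset_U_adm alpha_strict_mono assms q by blast
  show "U_adm M (alpha M q) \<subseteq> V_adm M (alpha M p)"
  proof
    fix c assume c: "c \<in> U_adm M (alpha M q)"
    show "c \<in> V_adm M (alpha M p)"
    proof (cases "c = (\<lambda>_. 0) \<or> c = (\<lambda>_. M)")
      case False
      then obtain r where r: "1 < r" "r \<le> p" "c \<in> V_adm M (alpha M r)"
        using U_adm_extremal_base[OF c _ _ _ assms(2,3)] assms(1) by (metis less_imp_le)
      then have "alpha M r \<sqsubseteq> alpha M p" using alpha_le_iff assms q by simp
      then show ?thesis using V_adm_mono r(3) by blast
    qed (use const_in_V_adm in auto)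
  qed
qed

lemma U_adm_trivial:
  assumes "V_bases M \<inter> {1<..<q} = {}"
  shows "U_adm M (alpha M q) = {(\<lambda>_. 0), (\<lambda>_. M)}"
proof
  \<comment> \<open>With \<open>p0 = 1\<close> an extremal base would satisfy both
    \<open>1 < p\<close> and \<open>p \<le> 1\<close>.\<close>
  show "U_adm M (alpha M q) \<subseteq> {(\<lambda>_. 0), (\<lambda>_. M)}"
    using U_adm_extremal_base[OF _ _ _ _ q(1) assms] by force
  define p where "p = (1 + q) / 2"
  have p: "1 < p" "p < q" using q by (auto simp: p_def)
  have "alpha M p \<sqsubset> alpha M q" using alpha_strict_mono p q by blast
  then have "V_adm M (alpha M p) \<subseteq> U_adm M (alpha M q)" by (rule V_adm_subset_U_adm)
  then show "{(\<lambda>_. 0), (\<lambda>_. M)} \<subseteq> U_adm M (alpha M q)" using const_in_V_adm by blast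
qed

text \<open>The condition puts the extremal base of \<open>c\<close> into \<open>W\<close>. There
  the supremum is attained, so \<open>c\<close> ends in \<open>alpha M p\<close> or its reflection
  for one of countably many \<open>p\<close>.\<close>

lemma countable_V_adm:
  assumes W: "countable W" "\<And>p. p \<in> W \<Longrightarrow> \<exists>k\<ge>1. tail k (alpha M p) = refl_seq M (alpha M p)"
  shows "countable {c \<in> V_adm M (alpha M q).
    \<forall>p\<in>V_bases M. 1 < p \<and> p \<le> q \<and> c \<in> V_adm M (alpha M p) \<longrightarrow> p \<in> W}"
proof (rule countable_subset)
  let ?E = "\<lambda>p. {c. \<exists>n. tail n c = alpha M p} \<union> {c \<in> digit_seqs M. \<exists>n. refl_seq M (tail n c) = alpha M p}"
  show "countable ({(\<lambda>_. 0), (\<lambda>_. M)} \<union> (\<Union>p\<in>W. ?E p))"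
    using W(1) countable_eventually countable_eventually_refl by auto
  show "{c \<in> V_adm M (alpha M q).
    \<forall>p\<in>V_bases M. 1 < p \<and> p \<le> q \<and> c \<in> V_adm M (alpha M p) \<longrightarrow> p \<in> W}
    \<subseteq> {(\<lambda>_. 0), (\<lambda>_. M)} \<union> (\<Union>p\<in>W. ?E p)"
  proof (intro subsetI, rule ccontr)
    fix c
    assume "c \<in> {c \<in> V_adm M (alpha M q).
        \<forall>p\<in>V_bases M. 1 < p \<and> p \<le> q \<and> c \<in> V_adm M (alpha M p) \<longrightarrow> p \<in> W}"
      and "c \<notin> {(\<lambda>_. 0), (\<lambda>_. M)} \<union> (\<Union>p\<in>W. ?E p)"
    then have c: "c \<in> V_adm M (alpha M q)" "c \<notin> (\<Union>p\<in>W. ?E p)" "c \<noteq> (\<lambda>_. M)" "c \<noteq> (\<lambda>_. 0)"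
      and W': "\<forall>p\<in>V_bases M. 1 < p \<and> p \<le> q \<and> c \<in> V_adm M (alpha M p) \<longrightarrow> p \<in> W" by auto
    obtain p where p: "p \<in> V_bases M" "1 < p" "p \<le> q" "c \<in> V_adm M (alpha M p)"
      and att: "\<And>k. k \<ge> 1 \<Longrightarrow> tail k (alpha M p) = refl_seq M (alpha M p) \<Longrightarrow>
        \<exists>n. \<exists>i<n. c i < M \<and> tail n c = alpha M p \<or> 0 < c i \<and> refl_seq M (tail n c) = alpha M p"
      by (rule V_adm_extremal_base[OF c(1,4,3)]) blast
    have "p \<in> W" using W' p by blast
    then have "c \<in> ?E p" using W(2) att V_admD(1)[OF c(1)] by blast
    then show False using c(2) \<open>p \<in> W\<close> by blast
  qed
qed

end

section \<open>The closure of the univoque bases\<close>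

text \<open>At the first position \<open>m\<close> where \<open>a\<close> and \<open>b\<close> differ, the condition on \<open>tail k a\<close> forces \<open>b m < a m\<close>
  and the one on \<open>tail (2 * k) a\<close> forces \<open>a m \<le> b m\<close>.\<close>

lemma no_nearby_univoque:
  assumes b: "b \<in> digit_seqs M" "k \<ge> 1" "tail k b = refl_seq M b"
    and a: "a \<in> digit_seqs M" "\<And>n. tail n a \<sqsubseteq> a" "\<And>n. n \<ge> 1 \<Longrightarrow> refl_seq M (tail n a) \<sqsubset> a"
  shows "\<not> agree (2 * k) a b"
proof
  assume agr: "agree (2 * k) a b"
  have bM: "b i \<le> M" and aM: "a i \<le> M" for i using b(1) a(1) digit_seqs_le by auto
  have bk: "b (k + i) = M - b i" for i using b(3) by (metis refl_seq_def tail_apply)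
  have b2k: "b (2 * k + i) = b i" for i using bk[of "k + i"] bk[of i] bM[of i] by (simp add: mult_2 add.assoc)
  have "a \<noteq> b"
  proof
    assume "a = b"
    then have "refl_seq M (tail k a) = a" using b by simp
    then show False using a(3)[OF b(2)] by simp
  qed
  then obtain m where m: "agree m a b" "a m \<noteq> b m" by (rule first_difference)
  have km: "2 * k \<le> m" using agr m(2) by (meson agree_def not_le)
  have ab: "a i = b i" if "i < m" for i using agreeD[OF m(1) that] .
  have "agree (m - k) (refl_seq M (tail k a)) a"
    unfolding agree_def
  proof (intro allI impI)
    fix i assume "i < m - k"
    then show "refl_seq M (tail k a) i = a i"
      using ab[of "k + i"] ab[of i] bk[of i] bM[of i] by (simp add: refl_seq_def tail_apply)
  qed
  moreover have mk: "b m = M - a (m - k)" using bk[of "m - k"] ab[of "m - k"] km b(2) by simp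
  then have "refl_seq M (tail k a) (m - k) \<noteq> a (m - k)"
    using m(2) km aM[of m] aM[of "m - k"] by (auto simp: refl_seq_def tail_apply)
  ultimately have "refl_seq M (tail k a) (m - k) < a (m - k)"
    using a(3)[OF b(2)] lex_less_agree_iff by blast
  then have "b m < a m" using mk km aM[of m] aM[of "m - k"] by (simp add: refl_seq_def tail_apply)
  moreover have "agree (m - 2 * k) (tail (2 * k) a) a"
    unfolding agree_def
  proof (intro allI impI)
    fix i assume "i < m - 2 * k"
    then show "tail (2 * k) a i = a i" using ab[of "2 * k + i"] ab[of i] b2k[of i] by (simp add: tail_apply)
  qed
  then have "tail (2 * k) a (m - 2 * k) \<le> a (m - 2 * k)" by (rule lex_le_agree_le[OF a(2)])
  then have "a m \<le> b m" using b2k[of "m - 2 * k"] ab[of "m - 2 * k"] km b(2) by (simp add: tail_apply)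
  ultimately show False by simp
qed

text \<open>Keeps limits of univoque bases away from 1, where the weak inequality would fail. It
  expresses that the reflected tail after the first digit has value below 1.\<close>

lemma U_bases_lower_bound:
  assumes "p \<in> U_bases M"
  shows "real M \<le> p * (p - 1)"
proof -
  interpret base M p using U_V_bases_le assms by unfold_locales auto
  have "is_expansion M p 1 (alpha M p)" by (simp add: is_expansion_def)
  then have "alpha M p \<in> U_adm M (alpha M p)"
    using assms unique_expansion_iff by (simp add: U_bases_def)
  then have "seq_value p (refl_seq M (tail (Suc 0) (alpha M p))) < 1"
    using U_adm_value(2)[of _ 0 "Suc 0"] alpha_0_pos by simp
  moreover have "real (alpha M p 0) \<ge> 1" using alpha_0_pos by simp
  ultimately have "real M / (p - 1) \<le> p"
    using value_refl_seq[OF q(1) digit_seqs_tail[OF alpha_digits, of "Suc 0"]]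
      value_tail_Suc[OF q(1) alpha_digits, of 0] by simp
  then show ?thesis using q by (simp add: field_simps)
qed

text \<open>Base and sequence vary together. Monotonicity in the base removes one of them: a fixed
  base \<open>t\<close> slightly on the wrong side of \<open>q\<close> still separates the value of
  \<open>g\<close> from 1, and there long agreement of prefixes gives a contradiction.\<close>

lemma value_cluster_eq_1:
  assumes X: "\<And>j. 1 < X j" "X \<longlonglongrightarrow> q" "1 < q"
    and c: "\<And>j. C j \<in> digit_seqs M" "\<And>j. seq_value (X j) (C j) = 1"
    and g: "g \<in> digit_seqs M" "\<And>N. infinite {j :: nat. agree N (C j) g}"
  shows "seq_value q g = 1"
proof -
  have cont: "((\<lambda>t. seq_value t g) \<longlongrightarrow> seq_value q g) (nhds q)"
    using value_isCont_base[OF X(3) g(1)] unfolding isCont_def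
    by (rule tendsto_at_iff_tendsto_nhds[of "\<lambda>t. seq_value t g" q, THEN iffD1])
  have ev1: "eventually (\<lambda>t. 1 < t) (nhds q)"
    using X(3) eventually_nhds_in_open[of "{1<..}" q] by simp
  have ex: "\<exists>j. agree N (C j) g \<and> P (X j)" if "eventually P (nhds q)" for P N
  proof -
    have "eventually (\<lambda>j. P (X j)) sequentially" using X(2) that by (auto simp: filterlim_iff)
    then obtain j0 where "\<And>j. j \<ge> j0 \<Longrightarrow> P (X j)" by (auto simp: eventually_sequentially)
    moreover obtain j where "j \<ge> j0" "agree N (C j) g"
      using g(2)[of N] by (auto simp: infinite_nat_iff_unbounded_le)
    ultimately show ?thesis by blast
  qed
  have "\<not> seq_value q g < 1"
  proof
    assume "seq_value q g < 1"
    then have "eventually (\<lambda>t. seq_value t g < 1 \<and> 1 < t) (nhds q)"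
      using order_tendstoD(2)[OF cont] ev1 by (intro eventually_conj) auto
    then have "eventually (\<lambda>t. seq_value t g < 1 \<and> 1 < t) (at_left q)"
      by (simp add: eventually_at_filter eventually_mono)
    moreover have "eventually (\<lambda>t. t < q) (at_left q)" by (simp add: eventually_at_filter)
    ultimately obtain t where t: "seq_value t g < 1" "1 < t" "t < q"
      using eventually_happens'[OF trivial_limit_at_left_real] eventually_conj by (metis (mono_tags, lifting))
    obtain N where N: "\<And>c d. c \<in> digit_seqs M \<Longrightarrow> d \<in> digit_seqs M \<Longrightarrow> agree N c d \<Longrightarrow>
        \<bar>seq_value t c - seq_value t d\<bar> < 1 - seq_value t g"
      using value_near[OF t(2), of "1 - seq_value t g"] t(1) by (metis diff_gt_0_iff_gt)
    obtain j where j: "agree N (C j) g" "t < X j"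
      using ex[of "\<lambda>s. t < s"] t(3) eventually_nhds_in_open[of "{t<..}" q] by auto
    have "1 \<le> seq_value t (C j)" using value_base_mono[of t "X j" "C j" M] t j c by simp
    then show False using N[OF c(1) g(1) j(1)] by linarith
  qed
  moreover have "\<not> seq_value q g > 1"
  proof
    assume "seq_value q g > 1"
    then have "eventually (\<lambda>t. seq_value t g > 1) (nhds q)" using order_tendstoD(1)[OF cont] by auto
    then have "eventually (\<lambda>t. seq_value t g > 1) (at_right q)"
      by (simp add: eventually_at_filter eventually_mono)
    moreover have "eventually (\<lambda>t. q < t) (at_right q)" by (simp add: eventually_at_filter)
    ultimately obtain t where t: "seq_value t g > 1" "q < t"
      using eventually_happens'[OF trivial_limit_at_right_real] eventually_conj by (metis (mono_tags, lifting))
    have t1: "1 < t" using t X(3) by simp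
    obtain N where N: "\<And>c d. c \<in> digit_seqs M \<Longrightarrow> d \<in> digit_seqs M \<Longrightarrow> agree N c d \<Longrightarrow>
        \<bar>seq_value t c - seq_value t d\<bar> < seq_value t g - 1"
      using value_near[OF t1, of "seq_value t g - 1"] t(1) by (metis diff_gt_0_iff_gt)
    obtain j where j: "agree N (C j) g" "X j < t"
      using ex[of "\<lambda>s. s < t"] t(2) eventually_nhds_in_open[of "{..<t}" q] by auto
    have "seq_value t (C j) \<le> 1" using value_base_mono[of "X j" t "C j" M] j c X(1) by (metis less_imp_le)
    then show False using N[OF c(1) g(1) j(1)] by linarith
  qed
  ultimately show ?thesis by simp
qed

text \<open>A cluster point of the expansions of 1 in the approximating bases inherits the weak
  inequalities and is thus \<open>alpha M q\<close>. Equality for some \<open>k\<close> is excluded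
  by \<open>no_nearby_univoque\<close>, because the approximating expansions share arbitrarily long
  prefixes with it.\<close>

lemma closure_U_bases:
  assumes "M > 0" "q \<in> closure (U_bases M)" "q \<noteq> real M + 1"
  shows "small_base M q" "q \<in> V_bases M"
    "k \<ge> 1 \<Longrightarrow> refl_seq M (tail k (alpha M q)) \<sqsubset> alpha M q"
proof -
  obtain X where X: "\<And>j. X j \<in> U_bases M" "X \<longlonglongrightarrow> q" using assms(2) closure_sequential by blast
  have X1: "1 < X j" "X j \<le> real M + 1" for j using U_V_bases_le X(1) by blast+
  have "1 \<le> q" by (rule LIMSEQ_le_const[OF X(2)]) (use X1 in \<open>auto intro: less_imp_le\<close>)
  have "q \<le> real M + 1" by (rule LIMSEQ_le_const2[OF X(2)]) (use X1 in auto)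
  have "(\<lambda>j. X j * (X j - 1)) \<longlonglongrightarrow> q * (q - 1)" by (intro tendsto_intros X(2))
  then have "real M \<le> q * (q - 1)"
    by (rule LIMSEQ_le_const) (use U_bases_lower_bound X(1) in auto)
  then have "q \<noteq> 1" using assms(1) by auto
  then show sb: "small_base M q"
    using \<open>1 \<le> q\<close> \<open>q \<le> real M + 1\<close> assms(3) by unfold_locales auto
  interpret small_base M q by fact
  have base: "base M (X j)" for j using X1 by unfold_locales auto
  define C where "C = (\<lambda>j. alpha M (X j))"
  have CM: "C j \<in> digit_seqs M" and Cv: "seq_value (X j) (C j) = 1" for j
    using base.alpha_digits[OF base] base.alpha_value[OF base] by (auto simp: C_def)
  have C_tail: "tail n (C j) \<sqsubseteq> C j" for n j using base.alpha_tail_le[OF base] by (simp add: C_def)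
  have C_refl: "refl_seq M (tail n (C j)) \<sqsubset> C j" if "n \<ge> 1" for n j
    using base.U_bases_alpha[OF base X(1) that] by (simp add: C_def)
  obtain g where g: "g \<in> digit_seqs M" "\<And>N. infinite {j. agree N (C j) g}"
    using cluster_sequence[of C M, OF CM] by auto
  have ex: "\<exists>j. agree N (C j) g" for N using g(2)[of N] by (metis (no_types, lifting) empty_Collect_eq finite.emptyI)
  have g_tail: "tail n g \<sqsubseteq> g" for n
  proof (rule lex_le_closed)
    fix N
    obtain j where "agree (n + N) (C j) g" using ex by blast
    then show "\<exists>c' d'. agree N c' (tail n g) \<and> agree N d' g \<and> c' \<sqsubseteq> d'"
      using C_tail[of n j] agree_tail agree_mono by (meson le_add2)
  qed
  have g_refl: "refl_seq M (tail n g) \<sqsubseteq> g" if "n \<ge> 1" for n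
  proof (rule lex_le_closed)
    fix N
    obtain j where "agree (n + N) (C j) g" using ex by blast
    then show "\<exists>c' d'. agree N c' (refl_seq M (tail n g)) \<and> agree N d' g \<and> c' \<sqsubseteq> d'"
      using lex_less_imp_le[OF C_refl[OF that, of j]] agree_tail agree_mono agree_refl_seq by (meson le_add2)
  qed
  have "infinite_seq g"
    unfolding infinite_seq_iff
  proof (intro allI impI, rule ccontr)
    fix n assume n: "g n \<noteq> 0" "\<not> (\<exists>m>n. g m \<noteq> 0)"
    then have "refl_seq M (tail (Suc n) g) = (\<lambda>_. M)" by (auto simp: refl_seq_def tail_def)
    then have le: "(\<lambda>_. M) \<sqsubseteq> g" using g_refl[of "Suc n"] by simp
    then have "g = (\<lambda>_. M)" using lex_le_const[OF g(1)] lex_le_antisym by blast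
    then show False using n assms(1) by auto
  qed
  then have ag: "alpha M q = g"
    using alpha_eqI[OF g(1) _ value_cluster_eq_1[OF X1(1) X(2) q(1) CM Cv g] g_tail] by blast
  show "q \<in> V_bases M" using V_bases_iff ag g_refl by simp
  show "refl_seq M (tail k (alpha M q)) \<sqsubset> alpha M q" if k: "k \<ge> 1"
  proof (rule ccontr)
    assume "\<not> ?thesis"
    then have "refl_seq M (tail k g) = g" using g_refl[OF k] ag lex_le_antisym by simp
    then have "tail k g = refl_seq M g" using g(1) refl_seq_refl_seq[of "tail k g" M] by simp
    then show False using no_nearby_univoque[OF g(1) k _ CM C_tail C_refl] ex by blast
  qed
qed

section \<open>From sequences to real numbers\<close>

definition seq_closed :: "(nat \<Rightarrow> nat) set \<Rightarrow> bool"
  where "seq_closed S \<longleftrightarrow> (\<forall>c. (\<forall>N. \<exists>d\<in>S. agree N d c) \<longrightarrow> c \<in> S)"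

text \<open>Absence of isolated points in the topology of prefixes; closedness and nonemptiness are
  supplied separately.\<close>

definition seq_perfect :: "(nat \<Rightarrow> nat) set \<Rightarrow> bool"
  where "seq_perfect S \<longleftrightarrow> (\<forall>c\<in>S. \<forall>N. \<exists>d\<in>S. d \<noteq> c \<and> agree N d c)"

lemma seq_closed_V_adm: "seq_closed (V_adm M a)"
  using V_adm_closed by (auto simp: seq_closed_def)

lemma V_adm_digits: "V_adm M a \<subseteq> digit_seqs M"
  using V_admD(1) by blast

text \<open>Compactness turns convergence of values into agreement of prefixes along a subsequence,
  without any injectivity.\<close>

lemma value_limit:
  assumes "q > 1" "S \<subseteq> digit_seqs M" "seq_closed S" "\<And>j. C j \<in> S"
    and lim: "(\<lambda>j. seq_value q (C j)) \<longlonglongrightarrow> x"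
  obtains g where "g \<in> S" "seq_value q g = x" "\<forall>N. infinite {j. agree N (C j) g}"
proof -
  have CM: "C j \<in> digit_seqs M" for j using assms(2,4) by blast
  obtain g where g: "g \<in> digit_seqs M" "\<forall>N. infinite {j. agree N (C j) g}"
    using cluster_sequence[of C M, OF CM] by auto
  have ex: "\<exists>j\<ge>m. agree N (C j) g" for N m
    using g(2) by (auto simp: infinite_nat_iff_unbounded_le)
  then have "g \<in> S" using assms(3,4) unfolding seq_closed_def by meson
  moreover have "seq_value q g = x"
  proof (rule ccontr)
    assume "\<not> ?thesis"
    then have e: "\<bar>seq_value q g - x\<bar> / 2 > 0" by simp
    obtain N where N: "\<And>c d. c \<in> digit_seqs M \<Longrightarrow> d \<in> digit_seqs M \<Longrightarrow> agree N c d \<Longrightarrow>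
        \<bar>seq_value q c - seq_value q d\<bar> < \<bar>seq_value q g - x\<bar> / 2"
      using value_near[OF assms(1) e] by blast
    obtain m where m: "\<bar>seq_value q (C j) - x\<bar> < \<bar>seq_value q g - x\<bar> / 2" if "j \<ge> m" for j
      using LIMSEQ_D[OF lim e] by (auto simp: real_norm_def)
    obtain j where j: "j \<ge> m" "agree N (C j) g" using ex by blast
    have "\<bar>seq_value q g - x\<bar> \<le> \<bar>seq_value q (C j) - x\<bar> + \<bar>seq_value q (C j) - seq_value q g\<bar>"
      by linarith
    also have "\<dots> < \<bar>seq_value q g - x\<bar> / 2 + \<bar>seq_value q g - x\<bar> / 2"
      using m[OF j(1)] N[OF CM g(1) j(2)] by (rule add_strict_mono)
    finally show False by simp
  qed
  ultimately show ?thesis using that g(2) by blast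
qed

lemma closed_image_value:
  assumes "q > 1" "S \<subseteq> digit_seqs M" "seq_closed S"
  shows "closed (seq_value q ` S)"
  unfolding closed_sequential_limits
proof (intro allI impI)
  fix X x assume X: "(\<forall>n. X n \<in> seq_value q ` S) \<and> X \<longlonglongrightarrow> x"
  then have "\<forall>n. \<exists>c. c \<in> S \<and> X n = seq_value q c" by blast
  then obtain C where C: "\<And>n. C n \<in> S" "\<And>n. X n = seq_value q (C n)" by metis
  from C(2) have "X = (\<lambda>j. seq_value q (C j))" by (rule ext)
  then have lim: "(\<lambda>j. seq_value q (C j)) \<longlonglongrightarrow> x" using X by simp
  obtain g where "g \<in> S" "seq_value q g = x" using value_limit[OF assms C(1) lim] by blast
  then show "x \<in> seq_value q ` S" by blast
qed

text \<open>On the compact set \<open>S\<close> the value is continuous and injective, so limit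
  points on the line can be read off from prefixes.\<close>

lemma islimpt_value_iff:
  assumes "q > 1" "S \<subseteq> digit_seqs M" "seq_closed S" "inj_on (seq_value q) S" "R \<subseteq> S" "c \<in> S"
  shows "seq_value q c islimpt seq_value q ` R \<longleftrightarrow> (\<forall>N. \<exists>d\<in>R. d \<noteq> c \<and> agree N d c)"
proof
  assume "seq_value q c islimpt seq_value q ` R"
  then obtain X where X: "\<forall>n. X n \<in> seq_value q ` R - {seq_value q c}" "X \<longlonglongrightarrow> seq_value q c"
    unfolding islimpt_sequential by blast
  then have "\<forall>n. \<exists>d. d \<in> R \<and> d \<noteq> c \<and> X n = seq_value q d" by blast
  then obtain C where C: "\<And>n. C n \<in> R" "\<And>n. C n \<noteq> c" "\<And>n. X n = seq_value q (C n)" by metis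
  from C(3) have "X = (\<lambda>j. seq_value q (C j))" by (rule ext)
  then have lim: "(\<lambda>j. seq_value q (C j)) \<longlonglongrightarrow> seq_value q c" using X(2) by simp
  have CS: "C j \<in> S" for j using C(1) assms(5) by blast
  obtain g where g: "g \<in> S" "seq_value q g = seq_value q c" "\<forall>N. infinite {j. agree N (C j) g}"
    using value_limit[OF assms(1-3) CS lim] by metis
  then have "g = c" using assms(4,6) by (auto dest: inj_onD)
  have ex: "\<exists>j. agree N (C j) c" for N
    using g(3) \<open>g = c\<close> by (auto simp: infinite_nat_iff_unbounded_le)
  then show "\<forall>N. \<exists>d\<in>R. d \<noteq> c \<and> agree N d c" using C(1,2) by blast
next
  assume ex: "\<forall>N. \<exists>d\<in>R. d \<noteq> c \<and> agree N d c"
  show "seq_value q c islimpt seq_value q ` R"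
    unfolding islimpt_approachable
  proof (intro allI impI)
    fix e :: real assume e: "e > 0"
    obtain N where N: "\<And>c d. c \<in> digit_seqs M \<Longrightarrow> d \<in> digit_seqs M \<Longrightarrow> agree N c d \<Longrightarrow>
        \<bar>seq_value q c - seq_value q d\<bar> < e"
      using value_near[OF assms(1) e] by blast
    obtain d where d: "d \<in> R" "d \<noteq> c" "agree N d c" using ex by blast
    have "d \<in> S" using d(1) assms(5) by blast
    then have "seq_value q d \<noteq> seq_value q c" using d(2) assms(4,6) by (auto dest: inj_onD)
    moreover have "dist (seq_value q d) (seq_value q c) < e"
      using N[of d c] d(3) \<open>d \<in> S\<close> assms(2,6) by (auto simp: dist_real_def)
    ultimately show "\<exists>x'\<in>seq_value q ` R. x' \<noteq> seq_value q c \<and> dist x' (seq_value q c) < e"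
      using d(1) by blast
  qed
qed

lemma dense_subset_of_value:
  assumes "q > 1" "S \<subseteq> digit_seqs M" "R \<subseteq> S" "\<And>c N. c \<in> S \<Longrightarrow> \<exists>d\<in>R. agree N d c"
  shows "dense_subset_of (seq_value q ` R) (seq_value q ` S)"
  unfolding dense_subset_of_def
proof (intro conjI subsetI)
  fix x assume "x \<in> seq_value q ` S"
  then obtain c where c: "c \<in> S" "x = seq_value q c" by blast
  show "x \<in> closure (seq_value q ` R)"
    unfolding closure_approachable
  proof (intro allI impI)
    fix e :: real assume e: "e > 0"
    obtain N where N: "\<And>c d. c \<in> digit_seqs M \<Longrightarrow> d \<in> digit_seqs M \<Longrightarrow> agree N c d \<Longrightarrow>
        \<bar>seq_value q c - seq_value q d\<bar> < e"
      using value_near[OF assms(1) e] by blast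
    obtain d where d: "d \<in> R" "agree N d c" using assms(4) c(1) by blast
    then have "dist (seq_value q d) x < e"
      using N[of d c] c assms(2,3) by (auto simp: dist_real_def)
    then show "\<exists>y\<in>seq_value q ` R. dist y x < e" using d(1) by blast
  qed
qed (use assms(3) in blast)

text \<open>The image coincides with its set of limit points, and a nonempty perfect set in a
  completely metrizable space is at least as large as the continuum.\<close>

lemma uncountable_value:
  assumes "q > 1" "S \<subseteq> digit_seqs M" "seq_closed S" "inj_on (seq_value q) S" "S \<noteq> {}" "seq_perfect S"
  shows "uncountable (seq_value q ` S)"
proof
  assume "countable (seq_value q ` S)"
  let ?X = "seq_value q ` S"
  have "x islimpt ?X \<longleftrightarrow> x \<in> ?X" for x
  proof
    show "x \<in> ?X" if "x islimpt ?X"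
      using closed_image_value[OF assms(1-3)] that by (simp add: closed_limpt)
    show "x islimpt ?X" if "x \<in> ?X"
      using that islimpt_value_iff[OF assms(1-4) order_refl] assms(6) by (auto simp: seq_perfect_def)
  qed
  moreover have "euclidean derived_set_of ?X = {x. x islimpt ?X}"
    unfolding derived_set_of_def islimpt_def by (rule set_eqI) (simp, blast)
  ultimately have "euclidean derived_set_of ?X = ?X" by simp
  then have "(UNIV :: real set) \<lesssim> ?X"
    using lepoll_perfect_set[of euclidean ?X] completely_metrizable_space_euclidean assms(5) by blast
  then show False
    using countable_lepoll[OF \<open>countable ?X\<close>] uncountable_UNIV_real by blast
qed

text \<open>The members of \<open>S\<close> sharing a long prefix with \<open>c\<close> form again a
  closed set without isolated points, and their values lie in the given neighbourhood.\<close>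

lemma condensation_points_value:
  assumes "q > 1" "S \<subseteq> digit_seqs M" "seq_closed S" "inj_on (seq_value q) S" "seq_perfect S"
    and "seq_value q ` S \<subseteq> X" "c \<in> S"
  shows "seq_value q c \<in> condensation_points X"
  unfolding condensation_points_def
proof (intro CollectI allI impI)
  fix T assume T: "open T \<and> seq_value q c \<in> T"
  then obtain e where e: "e > 0" "ball (seq_value q c) e \<subseteq> T" by (meson openE)
  obtain N where N: "\<And>c d. c \<in> digit_seqs M \<Longrightarrow> d \<in> digit_seqs M \<Longrightarrow> agree N c d \<Longrightarrow>
      \<bar>seq_value q c - seq_value q d\<bar> < e"
    using value_near[OF assms(1) e(1)] by blast
  define R where "R = {d \<in> S. agree N d c}"
  have "uncountable (seq_value q ` R)"
  proof (rule uncountable_value[OF assms(1)])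
    show "R \<subseteq> digit_seqs M" using assms(2) by (auto simp: R_def)
    show "inj_on (seq_value q) R" using assms(4) by (rule inj_on_subset) (auto simp: R_def)
    show "R \<noteq> {}" using assms(7) by (auto simp: R_def)
    show "seq_closed R"
      unfolding seq_closed_def
    proof (intro allI impI)
      fix b assume b: "\<forall>K. \<exists>d\<in>R. agree K d b"
      then have "b \<in> S" using assms(3) unfolding seq_closed_def R_def by blast
      moreover obtain d where "d \<in> R" "agree N d b" using b by blast
      then have "agree N b d" "agree N d c" by (auto simp: R_def agree_sym)
      then have "agree N b c" by (rule agree_trans)
      ultimately show "b \<in> R" by (simp add: R_def)
    qed
    show "seq_perfect R"
      unfolding seq_perfect_def
    proof (intro ballI allI)
      fix b K assume b: "b \<in> R"
      then obtain d where d: "d \<in> S" "d \<noteq> b" "agree (max K N) d b"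
        using assms(5) unfolding seq_perfect_def R_def by blast
      then have "agree K d b" "agree N d b" using agree_mono by auto
      then show "\<exists>d\<in>R. d \<noteq> b \<and> agree K d b" using d b agree_trans by (auto simp: R_def)
    qed
  qed
  moreover have "seq_value q ` R \<subseteq> X \<inter> T"
  proof safe
    fix d assume d: "d \<in> R"
    then show "seq_value q d \<in> X" using assms(6) by (auto simp: R_def)
    have "dist (seq_value q c) (seq_value q d) < e"
      using N[of c d] d assms(2,7) by (auto simp: R_def dist_real_def agree_sym)
    then show "seq_value q d \<in> T" using e(2) by auto
  qed
  ultimately show "uncountable (X \<inter> T)" using countable_subset by blast
qed

text \<open>A continuation of a prescribed prefix in which 0 and \<open>M\<close> both recur, so the
  result is doubly infinite and none of its tails is constantly 0 or \<open>M\<close>.\<close>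

definition zero_M_tail :: "nat \<Rightarrow> nat \<Rightarrow> (nat \<Rightarrow> nat) \<Rightarrow> (nat \<Rightarrow> nat)"
  where "zero_M_tail M n u = glue n u (\<lambda>i. if even i then 0 else M)"

lemma zero_M_tail:
  assumes "M > 0"
  shows "u \<in> digit_seqs M \<Longrightarrow> zero_M_tail M n u \<in> digit_seqs M"
    and "agree n (zero_M_tail M n u) u"
    and "\<exists>k>m. zero_M_tail M n u k = M"
    and "\<exists>k>m. zero_M_tail M n u k = 0"
    and "doubly_infinite M (zero_M_tail M n u)"
proof -
  show D: "u \<in> digit_seqs M \<Longrightarrow> zero_M_tail M n u \<in> digit_seqs M"
    by (auto simp: zero_M_tail_def digit_seqs_def glue_def)
  show "agree n (zero_M_tail M n u) u" by (simp add: zero_M_tail_def)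
  have M: "\<exists>k>m. zero_M_tail M n u k = M" for m
    by (rule exI[of _ "n + (2 * m + 1)"]) (simp add: zero_M_tail_def glue_def)
  have Z: "\<exists>k>m. zero_M_tail M n u k = 0" for m
    by (rule exI[of _ "n + 2 * (m + 1)"]) (simp add: zero_M_tail_def glue_def)
  show "\<exists>k>m. zero_M_tail M n u k = M" "\<exists>k>m. zero_M_tail M n u k = 0" by (fact M Z)+
  show "doubly_infinite M (zero_M_tail M n u)"
    unfolding doubly_infinite_def infinite_seq_iff using M Z assms
    by (metis diff_zero less_numeral_extra(3))
qed

section \<open>Cantor sets of values\<close>

context small_base
begin

text \<open>Near any admissible \<open>c\<close> there is a doubly infinite sequence with a long
  block of zeros after a nonzero digit. By uniqueness its value could lie in the image only if the
  sequence were admissible, but its reflected tail exceeds \<open>alpha M q\<close>.\<close>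

lemma interior_value_V_adm: "interior (seq_value q ` V_adm M (alpha M q)) = {}"
proof (rule ccontr)
  let ?V = "V_adm M (alpha M q)"
  assume "\<not> ?thesis"
  then obtain x where "x \<in> interior (seq_value q ` ?V)" by blast
  then obtain e where e: "e > 0" "ball x e \<subseteq> seq_value q ` ?V" by (meson mem_interior)
  then have "x \<in> seq_value q ` ?V" by auto
  then obtain c where c: "c \<in> ?V" "x = seq_value q c" by blast
  have cM: "c \<in> digit_seqs M" using c(1) by (rule V_admD)
  have "c \<noteq> (\<lambda>_. 0)"
  proof
    assume "c = (\<lambda>_. 0)"
    then have "x = 0" using c(2) value_const[OF q(1), of 0] by simp
    then have "- (e / 2) \<in> ball x e" using e(1) by (simp add: dist_real_def)
    then obtain d where "d \<in> ?V" "seq_value q d = - (e / 2)" using e(2) by force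
    then show False using value_nonneg[OF q(1) V_admD(1)] e(1) by force
  qed
  then obtain i where i: "c i \<noteq> 0" by auto
  have unb: "\<exists>m\<ge>n. c m > 0" for n
  proof (induction n)
    case 0
    show ?case using i by auto
  next
    case (Suc n)
    then obtain m where "m \<ge> n" "c m > 0" by blast
    moreover obtain k where "k > m" "c k \<noteq> 0"
      using V_adm_infinite[OF c(1)] \<open>c m > 0\<close> by (auto simp: infinite_seq_iff)
    ultimately show ?case by (intro exI[of _ k]) auto
  qed
  obtain N where N: "\<And>c d. c \<in> digit_seqs M \<Longrightarrow> d \<in> digit_seqs M \<Longrightarrow> agree N c d \<Longrightarrow>
      \<bar>seq_value q c - seq_value q d\<bar> < e"
    using value_near[OF q(1) e(1)] by blast
  obtain m where m: "m \<ge> N" "c m > 0" using unb by blast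
  \<comment> \<open>\<open>Suc L\<close> zeros suffice: reflected, they are digits \<open>M\<close>
    up to a position where \<open>alpha M q\<close> is smaller.\<close>
  obtain L where L: "alpha M q L \<noteq> M" using alpha_neq_const by auto
  define u where "u = glue (Suc m) c (\<lambda>_. 0)"
  define d where "d = zero_M_tail M (Suc m + Suc L) u"
  have uM: "u \<in> digit_seqs M" unfolding u_def using cM by (intro digit_seqs_glue) (auto simp: digit_seqs_def)
  note d = zero_M_tail[OF M_pos, where u = u and n = "Suc m + Suc L", folded d_def]
  have dM: "d \<in> digit_seqs M" using d(1) uM by simp
  have du: "agree (Suc m + Suc L) d u" by (fact d(2))
  have uc: "agree (Suc m) u c" by (simp add: u_def)
  have dc: "agree (Suc m) d c" using agree_trans[OF agree_mono[OF du] uc] by simp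
  have "seq_value q d \<in> ball x e"
    using N[OF dM cM agree_mono[OF dc]] m(1) c(2) by (simp add: dist_real_def abs_minus_commute)
  then obtain b where b: "b \<in> ?V" "seq_value q d = seq_value q b" using e(2) by blast
  have "d = b" using V_adm_unique[OF b(1) dM d(5) b(2)] .
  then have le: "refl_seq M (tail (Suc m) d) \<sqsubseteq> alpha M q"
    using V_admD(3)[OF b(1), of m "Suc m"] m(2) agreeD[OF dc, of m] by simp
  have ones: "refl_seq M (tail (Suc m) d) j = M" if "j \<le> L" for j
    using agreeD[OF du, of "Suc m + j"] that by (simp add: refl_seq_def tail_apply u_def glue_def)
  have "alpha M q \<noteq> refl_seq M (tail (Suc m) d)" using ones[of L] L by auto
  then obtain n where n: "agree n (alpha M q) (refl_seq M (tail (Suc m) d))"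
    "alpha M q n \<noteq> refl_seq M (tail (Suc m) d) n" by (rule first_difference)
  have "n \<le> L"
    using agreeD[OF n(1), of L] ones[of L] L by (cases "L < n") auto
  then have "alpha M q n < refl_seq M (tail (Suc m) d) n"
    using ones n(2) digit_seqs_le[OF alpha_digits, of n] by simp
  then have "alpha M q \<sqsubset> refl_seq M (tail (Suc m) d)" using n(1) by (intro lex_lessI)
  then show False using le not_lex_le by blast
qed

lemma cantor_set_value:
  assumes "S \<subseteq> V_adm M (alpha M q)" "seq_closed S" "seq_perfect S" "S \<noteq> {}"
  shows "cantor_set (seq_value q ` S)"
  unfolding cantor_set_def
proof (intro conjI allI)
  have SM: "S \<subseteq> digit_seqs M" using assms(1) V_adm_digits by blast
  have inj: "inj_on (seq_value q) S" using inj_on_value assms(1) by (rule inj_on_subset)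
  show "seq_value q ` S \<noteq> {}" using assms(4) by blast
  show "closed (seq_value q ` S)" using closed_image_value[OF q(1) SM assms(2)] .
  show "interior (seq_value q ` S) = {}"
    using interior_mono[OF image_mono[OF assms(1), of "seq_value q"]] interior_value_V_adm by blast
  show "\<not> x isolated_in seq_value q ` S" for x
    unfolding isolated_in_islimpt_iff
    using islimpt_value_iff[OF q(1) SM assms(2) inj order_refl] assms(3) by (auto simp: seq_perfect_def)
qed

text \<open>Sequences inside \<open>U_adm\<close> are approximated by sequences outside it and
  conversely, so the approximants automatically differ from \<open>c\<close>.\<close>

lemma seq_perfect_V_adm:
  assumes "q \<in> V_bases M" "\<And>k. k \<ge> 1 \<Longrightarrow> refl_seq M (tail k (alpha M q)) \<sqsubset> alpha M q"
  shows "seq_perfect (V_adm M (alpha M q))"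
  unfolding seq_perfect_def
proof (intro ballI allI)
  fix c N assume c: "c \<in> V_adm M (alpha M q)"
  show "\<exists>d\<in>V_adm M (alpha M q). d \<noteq> c \<and> agree N d c"
  proof (cases "c \<in> U_adm M (alpha M q)")
    case True
    then obtain d where "d \<in> V_adm M (alpha M q) - U_adm M (alpha M q)" "agree N d c"
      using V_adm_approx assms(1) by blast
    then show ?thesis using True by (metis DiffD1 DiffD2)
  next
    case False
    obtain d where "d \<in> U_adm M (alpha M q)" "agree N d c" using U_adm_approx[OF assms(2) c] by blast
    then show ?thesis using False U_adm_subset_V_adm by (metis subsetD)
  qed
qed

lemma V_adm_minus_U_adm_dense:
  assumes "q \<in> V_bases M" "c \<in> V_adm M (alpha M q)"
  shows "\<exists>d \<in> V_adm M (alpha M q) - U_adm M (alpha M q). agree N d c"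
proof (cases "c \<in> U_adm M (alpha M q)")
  case True
  then show ?thesis using V_adm_approx[OF True assms(1)] by metis
next
  case False
  then show ?thesis using assms(2) agree_refl by blast
qed

lemma const_in_U_adm: "(\<lambda>_. 0) \<in> U_adm M (alpha M q)"
proof -
  define p where "p = (1 + q) / 2"
  have p: "1 < p" "p < q" using q by (auto simp: p_def)
  have "alpha M p \<sqsubset> alpha M q" using alpha_strict_mono p q by blast
  then show ?thesis using V_adm_subset_U_adm const_in_V_adm by blast
qed

end

section \<open>The base \<open>real M + 1\<close>\<close>

lemma perfect_unit_interval: "perfect_set {0..1}"
  unfolding perfect_set_def isolated_in_islimpt_iff
proof (intro conjI allI)
  fix x :: real
  have "x islimpt {0..1}" if "x \<in> {0..1}"
  proof (rule connected_imp_perfect)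
    show "{0..1} \<noteq> {y}" for y :: real by (metis atLeastAtMost_singleton_iff zero_neq_one)
  qed (use that in auto)
  then show "\<not> (\<not> x islimpt {0..1} \<and> x \<in> {0..1})" by blast
qed auto

text \<open>Every number in \<open>[0, 1]\<close> has an expansion, and any prefix of it can be
  continued with 0 and \<open>M\<close> alternating, which gives a unique expansion.\<close>

lemma closure_U_set_top:
  assumes "M > 0"
  shows "closure (U_set M (real M + 1)) = {0..1}"
proof
  interpret base M "real M + 1" using assms by unfold_locales auto
  have J: "J M (real M + 1) = {0..1}" using assms by (simp add: J_def)
  show "closure (U_set M (real M + 1)) \<subseteq> {0..1}"
    by (rule closure_minimal) (use J in \<open>auto simp: U_set_def\<close>)
  show "{0..1} \<subseteq> closure (U_set M (real M + 1))"
  proof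
    fix x :: real assume "x \<in> {0..1}"
    then have "is_expansion M (real M + 1) x (quasi_greedy M (real M + 1) x)"
      using quasi_greedy_props(1)[OF q] J by simp
    then obtain c where c: "c \<in> digit_seqs M" "seq_value (real M + 1) c = x"
      unfolding is_expansion_def by blast
    show "x \<in> closure (U_set M (real M + 1))"
      unfolding closure_approachable
    proof (intro allI impI)
      fix e :: real assume e: "e > 0"
      obtain N where N: "\<And>c d. c \<in> digit_seqs M \<Longrightarrow> d \<in> digit_seqs M \<Longrightarrow> agree N c d \<Longrightarrow>
          \<bar>seq_value (real M + 1) c - seq_value (real M + 1) d\<bar> < e"
        using value_near[OF q(1) e] by blast
      define d where "d = zero_M_tail M N c"
      note d = zero_M_tail[OF assms, where u = c and n = N, folded d_def]
      have dM: "d \<in> digit_seqs M" using d(1) c(1) by simp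
      have pos: "seq_value (real M + 1) (tail (Suc n) d) > 0" for n
      proof -
        obtain k where "k > n" "d k = M" using d(3) by blast
        then have "tail (Suc n) d (k - Suc n) > 0" using assms by (simp add: tail_apply)
        then show ?thesis using value_pos[OF q(1) digit_seqs_tail[OF dM]] by blast
      qed
      have pos': "seq_value (real M + 1) (refl_seq M (tail (Suc n) d)) > 0" for n
      proof -
        obtain k where "k > n" "d k = 0" using d(4) by blast
        then have "refl_seq M (tail (Suc n) d) (k - Suc n) > 0"
          using assms by (simp add: tail_apply refl_seq_def)
        then show ?thesis using value_pos[OF q(1) digit_seqs_refl_seq] by blast
      qed
      \<comment> \<open>In this base \<open>M / (q - 1)\<close> is 1, so positivity of a tail and of
        its reflection bounds both strictly below 1.\<close>
      have sum: "seq_value (real M + 1) (refl_seq M (tail (Suc n) d))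
          = 1 - seq_value (real M + 1) (tail (Suc n) d)" for n
        using value_refl_seq[OF q(1) digit_seqs_tail[OF dM], of "Suc n"] assms by simp
      have "d \<in> U_adm M (alpha M (real M + 1))"
        using pos pos' sum by (intro U_adm_of_value dM) (smt (verit))+
      then have "seq_value (real M + 1) d \<in> U_set M (real M + 1)" by (simp add: U_set_eq)
      moreover have "dist (seq_value (real M + 1) d) x < e"
        using N[OF dM c(1) d(2)] c(2) by (simp add: dist_real_def)
      ultimately show "\<exists>y\<in>U_set M (real M + 1). dist y x < e" by blast
    qed
  qed
qed

lemma closure_U_bases_V_set:
  assumes "M > 0" "q \<in> closure (U_bases M)" "q \<noteq> real M + 1"
  shows "V_set M q = closure (U_set M q)" "cantor_set (V_set M q)"
proof -
  interpret small_base M q using closure_U_bases(1)[OF assms] .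
  note B = closure_U_bases(3)[OF assms]
  show cantor: "cantor_set (V_set M q)"
    unfolding V_set_eq using const_in_V_adm seq_perfect_V_adm[OF closure_U_bases(2)[OF assms] B]
    by (intro cantor_set_value seq_closed_V_adm) auto
  have "\<exists>d\<in>U_adm M (alpha M q). agree N d c" if "c \<in> V_adm M (alpha M q)" for c N
    using U_adm_approx[OF B that] by metis
  then have "dense_subset_of (U_set M q) (V_set M q)"
    unfolding V_set_eq U_set_eq
    by (intro dense_subset_of_value[OF q(1) V_adm_digits U_adm_subset_V_adm])
  then show "V_set M q = closure (U_set M q)"
    using cantor closure_minimal[of "U_set M q" "V_set M q"]
    by (auto simp: dense_subset_of_def cantor_set_def)
qed

section \<open>Bases between consecutive elements of an associated sequence\<close>

text \<open>The sequences behind \<open>U_set M q\<close> are those of \<open>V_adm\<close> for the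
  base \<open>p\<close>, and agreement of prefixes does not involve a base; so \<open>p\<close>
  alone decides which points are isolated.\<close>

lemma gap_structure:
  assumes "small_base M q" "1 < p" "p < q" "V_bases M \<inter> {p<..<q} = {}" "p \<in> V_bases M"
    and k: "k \<ge> 1" "tail k (alpha M p) = refl_seq M (alpha M p)"
  shows "U_set M q = seq_value q ` V_seqs M p"
    "accumulation_points (U_set M q) = seq_value q ` U_seqs M p"
    "isolated_points (U_set M q) = seq_value q ` (V_seqs M p - U_seqs M p)"
    "dense_subset_of (isolated_points (U_set M q)) (U_set M q)"
    "infinite (U_set M q)"
proof -
  interpret small_base M q by fact
  interpret p: small_base M p using assms(2,3) q q_less by unfold_locales auto
  let ?V = "V_adm M (alpha M p)" and ?U = "U_adm M (alpha M p)"
  have UV: "?U \<subseteq> ?V" by (rule U_adm_subset_V_adm)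
  have U_eq: "U_set M q = seq_value q ` ?V"
    unfolding U_set_eq using U_adm_eq_V_adm[OF assms(2-4)] by simp
  show "U_set M q = seq_value q ` V_seqs M p" by (simp add: U_eq p.V_seqs_eq)
  have VV: "?V \<subseteq> V_adm M (alpha M q)"
    using V_adm_mono[of "alpha M p" "alpha M q" M] alpha_le_iff[OF assms(2) q(1) p.q(2) q(2)] assms(3) by simp
  have inj: "inj_on (seq_value q) ?V" using inj_on_value VV by (rule inj_on_subset)
  note lim = islimpt_value_iff[OF q(1) V_adm_digits seq_closed_V_adm inj order_refl]
  have limpt: "seq_value q c islimpt seq_value q ` ?V \<longleftrightarrow> c \<in> ?U" if c: "c \<in> ?V" for c
  proof
    assume l: "seq_value q c islimpt seq_value q ` ?V"
    show "c \<in> ?U"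
    proof (rule ccontr)
      assume "c \<notin> ?U"
      then obtain N where "\<And>d. d \<in> ?V \<Longrightarrow> agree N d c \<Longrightarrow> d = c"
        using p.V_adm_isolated[OF _ k, of c] c by blast
      then show False using l lim[OF c] by blast
    qed
  next
    assume cU: "c \<in> ?U"
    show "seq_value q c islimpt seq_value q ` ?V"
      unfolding lim[OF c]
    proof
      fix N
      obtain d where "d \<in> ?V - ?U" "agree N d c" using p.V_adm_approx[OF cU assms(5)] by blast
      then show "\<exists>d\<in>?V. d \<noteq> c \<and> agree N d c" using cU by (metis DiffD1 DiffD2)
    qed
  qed
  have closed: "closed (seq_value q ` ?V)"
    using closed_image_value[OF q(1) V_adm_digits seq_closed_V_adm] .
  show acc: "accumulation_points (U_set M q) = seq_value q ` U_seqs M p"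
    unfolding accumulation_points_def U_eq p.U_seqs_eq
    using closed limpt UV by (auto simp: closed_limpt)
  show iso: "isolated_points (U_set M q) = seq_value q ` (V_seqs M p - U_seqs M p)"
    unfolding isolated_points_def isolated_in_islimpt_iff U_eq p.U_seqs_eq p.V_seqs_eq
    using limpt by auto
  show "dense_subset_of (isolated_points (U_set M q)) (U_set M q)"
    unfolding iso unfolding U_eq p.U_seqs_eq p.V_seqs_eq using p.V_adm_minus_U_adm_dense[OF assms(5)]
    by (intro dense_subset_of_value[OF q(1) V_adm_digits]) auto
  \<comment> \<open>The zero sequence always lies in \<open>U_adm\<close>, and a finite set has no
    accumulation point.\<close>
  have "accumulation_points (U_set M q) \<noteq> {}"
    unfolding acc p.U_seqs_eq using p.const_in_U_adm by blast
  then show "infinite (U_set M q)" using islimpt_finite by (auto simp: accumulation_points_def)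
qed

locale associated =
  fixes M :: nat and a b :: real and Q :: "nat \<Rightarrow> real"
  assumes a: "1 \<le> a" and assoc: "associated_sequence M a b Q"
begin

lemma Q_image: "Q ` {1..} = V_bases M \<inter> {a<..<b}"
  and Q_mono: "1 \<le> m \<Longrightarrow> 1 \<le> n \<Longrightarrow> Q m < Q n \<longleftrightarrow> m < n"
  using assoc strict_mono_on_less[of "{1..}" Q m n] by (auto simp: associated_sequence_def)

lemma Q_in:
  assumes "n \<ge> 1"
  shows "Q n \<in> V_bases M" "a < Q n" "Q n < b" "small_base M (Q n)"
proof -
  have "Q n \<in> V_bases M \<inter> {a<..<b}" "Q (Suc n) \<in> V_bases M \<inter> {a<..<b}"
    using Q_image assms by (metis atLeast_iff imageI le_SucI)+
  then show Q: "Q n \<in> V_bases M" "a < Q n" "Q n < b" by auto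
  have "Q n < Q (Suc n)" using Q_mono[of n "Suc n"] assms by simp
  moreover have "Q (Suc n) \<le> real M + 1"
    using U_V_bases_le(2) \<open>Q (Suc n) \<in> V_bases M \<inter> {a<..<b}\<close> by blast
  ultimately show "small_base M (Q n)" using Q a by unfold_locales auto
qed

lemma V_bases_below_Q_1: "V_bases M \<inter> {a<..<Q 1} = {}"
proof (rule ccontr)
  assume "\<not> ?thesis"
  then obtain p where p: "p \<in> V_bases M" "a < p" "p < Q 1" by auto
  then have "p \<in> Q ` {1..}" unfolding Q_image using Q_in(3)[of 1] by auto
  then show False using p(3) Q_mono[of _ 1] by auto
qed

lemma V_bases_between_Q:
  assumes "n \<ge> 1"
  shows "V_bases M \<inter> {Q n<..<Q (Suc n)} = {}"
proof (rule ccontr)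
  assume "\<not> ?thesis"
  then obtain p where p: "p \<in> V_bases M" "Q n < p" "p < Q (Suc n)" by auto
  then have "p \<in> Q ` {1..}" unfolding Q_image using Q_in(2)[of n] Q_in(3)[of "Suc n"] assms by auto
  then obtain m where "m \<ge> 1" "p = Q m" by auto
  then show False using p Q_mono[of n m] Q_mono[of m "Suc n"] assms by simp
qed

text \<open>Each \<open>Q n\<close> ends a gap of \<open>V_bases M\<close>: its predecessor bounds
  the gap on the left, or for \<open>n = 1\<close> the midpoint between \<open>a\<close> and
  \<open>Q 1\<close>, since \<open>a\<close> may be 1.\<close>

lemma Q_antiperiodic:
  assumes "n \<ge> 1"
  shows "\<exists>k\<ge>1. tail k (alpha M (Q n)) = refl_seq M (alpha M (Q n))"
proof -
  interpret small_base M "Q n" using Q_in assms by blast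
  have "\<exists>p. 1 < p \<and> p < Q n \<and> V_bases M \<inter> {p<..<Q n} = {}"
  proof (cases "n = 1")
    case True
    define p where "p = (a + Q n) / 2"
    have p: "a < p" "p < Q n" using Q_in(2)[OF assms] by (auto simp: p_def)
    then have "V_bases M \<inter> {p<..<Q n} = {}" using V_bases_below_Q_1 True by force
    then show ?thesis using p a by (intro exI[of _ p]) auto
  next
    case False
    then have n: "n - 1 \<ge> 1" "Suc (n - 1) = n" using assms by auto
    have "1 < Q (n - 1)" using Q_in(2)[OF n(1)] a by simp
    moreover have "Q (n - 1) < Q n" using Q_mono[of "n - 1" n] n by simp
    ultimately show ?thesis using V_bases_between_Q[OF n(1)] n(2) by auto
  qed
  then show ?thesis using V_bases_left_gap[OF Q_in(1)[OF assms]] by blast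
qed

lemma small_base_le_Q:
  assumes "n \<ge> 1" "a < q" "q \<le> Q n"
  shows "small_base M q"
proof -
  interpret small_base M "Q n" using Q_in assms by blast
  show ?thesis using assms a q q_less by unfold_locales auto
qed

lemma between_Q:
  assumes "n \<ge> 1" "q \<in> {Q n<..Q (Suc n)}"
  shows "U_set M q = seq_value q ` V_seqs M (Q n)"
    "accumulation_points (U_set M q) = seq_value q ` U_seqs M (Q n)"
    "isolated_points (U_set M q) = seq_value q ` (V_seqs M (Q n) - U_seqs M (Q n))"
    "dense_subset_of (isolated_points (U_set M q)) (U_set M q)"
    "infinite (U_set M q)" "small_base M q"
proof -
  have aq: "a < q" using Q_in(2)[of n] assms by simp
  show sb: "small_base M q" using small_base_le_Q[of "Suc n" q] assms aq by simp
  have gap: "V_bases M \<inter> {Q n<..<q} = {}" using V_bases_between_Q[OF assms(1)] assms(2) by force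
  obtain k where k: "k \<ge> 1" "tail k (alpha M (Q n)) = refl_seq M (alpha M (Q n))"
    using Q_antiperiodic[OF assms(1)] by blast
  have "1 < Q n" "Q n < q" using Q_in(2)[OF assms(1)] a assms(2) by auto
  note * = gap_structure[OF sb this gap Q_in(1)[OF assms(1)] k]
  show "U_set M q = seq_value q ` V_seqs M (Q n)"
    "accumulation_points (U_set M q) = seq_value q ` U_seqs M (Q n)"
    "isolated_points (U_set M q) = seq_value q ` (V_seqs M (Q n) - U_seqs M (Q n))"
    "dense_subset_of (isolated_points (U_set M q)) (U_set M q)"
    "infinite (U_set M q)" by (fact *)+
qed

lemma countable_V_adm_Q:
  assumes "n \<ge> 1"
  shows "countable {c \<in> V_adm M (alpha M (Q n)).
    \<forall>p\<in>V_bases M. 1 < p \<and> p \<le> Q n \<and> c \<in> V_adm M (alpha M p) \<longrightarrow> a < p}"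
proof -
  interpret small_base M "Q n" using Q_in assms by blast
  have "countable {c \<in> V_adm M (alpha M (Q n)).
      \<forall>p\<in>V_bases M. 1 < p \<and> p \<le> Q n \<and> c \<in> V_adm M (alpha M p) \<longrightarrow> p \<in> Q ` {1..}}"
    by (rule countable_V_adm) (use Q_antiperiodic in auto)
  then show ?thesis
    unfolding Q_image
    by (rule countable_subset[rotated]) (use Q_in(3)[OF assms] in auto)
qed

end

section \<open>The two kinds of components\<close>

lemma first_component:
  assumes "M > 0" "associated_sequence M 1 b Q"
  shows "q \<in> {1<..Q 1} \<Longrightarrow> card (U_set M q) = 2"
    and "n \<ge> 1 \<Longrightarrow> q \<in> {Q n<..Q (Suc n)} \<Longrightarrow> countable (U_set M q)"
proof -
  interpret associated M 1 b Q using assms by unfold_locales auto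
  show "card (U_set M q) = 2" if "q \<in> {1<..Q 1}"
  proof -
    interpret small_base M q using small_base_le_Q[of 1 q] that by auto
    have "V_bases M \<inter> {1<..<q} = {}" using V_bases_below_Q_1 that by force
    then have "U_set M q = {0, real M / (q - 1)}"
      using U_adm_trivial value_const[OF q(1)] by (simp add: U_set_eq)
    then show ?thesis using assms(1) q(1) by simp
  qed
  show "countable (U_set M q)" if n: "n \<ge> 1" "q \<in> {Q n<..Q (Suc n)}"
  proof -
    interpret Qn: small_base M "Q n" using Q_in n by blast
    \<comment> \<open>Over the component starting at 1 the condition is vacuous, so the whole set is
      countable.\<close>
    have "V_adm M (alpha M (Q n)) = {c \<in> V_adm M (alpha M (Q n)).
      \<forall>p\<in>V_bases M. 1 < p \<and> p \<le> Q n \<and> c \<in> V_adm M (alpha M p) \<longrightarrow> 1 < p}" by auto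
    then have "countable (V_adm M (alpha M (Q n)))" using countable_V_adm_Q[OF n(1)] by metis
    then show ?thesis using between_Q(1)[OF n] by (simp add: Qn.V_seqs_eq)
  qed
qed

text \<open>The sequences of \<open>V_adm\<close> for \<open>q0\<close> persist through the
  component as a perfect part, whose points are all condensation points; the others are only
  countably many.\<close>

lemma later_component:
  assumes "M > 0" "q0 \<in> closure (U_bases M)" "associated_sequence M q0 b Q"
  shows "q \<in> {q0<..Q 1} \<Longrightarrow> U_set M q = closure (U_set M q) \<and> cantor_set (U_set M q) \<and>
      dense_subset_of (seq_value q ` (V_seqs M q0 - U_seqs M q0)) (U_set M q)"
    and "n \<ge> 1 \<Longrightarrow> q \<in> {Q n<..Q (Suc n)} \<Longrightarrow> condensation_points (U_set M q) = seq_value q ` V_seqs M q0"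
    and "n \<ge> 1 \<Longrightarrow> q \<in> {Q n<..Q (Suc n)} \<Longrightarrow> accumulation_points (U_set M q) - condensation_points (U_set M q)
      = seq_value q ` (U_seqs M (Q n) - V_seqs M q0)"
proof -
  have "q0 \<noteq> real M + 1"
  proof
    assume q0: "q0 = real M + 1"
    have "Q 1 \<in> V_bases M \<inter> {q0<..<b}" using assms(3) by (force simp: associated_sequence_def)
    then show False using U_V_bases_le(2)[of "Q 1" M] q0 by auto
  qed
  note closure = closure_U_bases[OF assms(1,2) this]
  interpret q0: small_base M q0 by (fact closure(1))
  interpret associated M q0 b Q using assms q0.q by unfold_locales auto
  let ?W = "V_adm M (alpha M q0)"
  have perfect: "seq_perfect ?W" using q0.seq_perfect_V_adm closure(2,3) by blast
  show "U_set M q = closure (U_set M q) \<and> cantor_set (U_set M q) \<and>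
      dense_subset_of (seq_value q ` (V_seqs M q0 - U_seqs M q0)) (U_set M q)"
    if q: "q \<in> {q0<..Q 1}"
  proof -
    interpret small_base M q using small_base_le_Q[of 1 q] that by auto
    have gap: "V_bases M \<inter> {q0<..<q} = {}" using V_bases_below_Q_1 that by force
    have U: "U_set M q = seq_value q ` ?W"
      unfolding U_set_eq using U_adm_eq_V_adm[OF q0.q(1) _ gap] that by simp
    have "alpha M q0 \<sqsubseteq> alpha M q" using alpha_le_iff[OF q0.q(1) _ q0.q(2)] base.q[OF base_axioms] that by simp
    then have "?W \<subseteq> V_adm M (alpha M q)" by (rule V_adm_mono)
    then have cantor: "cantor_set (U_set M q)"
      unfolding U using const_in_V_adm by (intro cantor_set_value seq_closed_V_adm perfect) auto
    have "dense_subset_of (seq_value q ` (?W - U_adm M (alpha M q0))) (seq_value q ` ?W)"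
      using q0.V_adm_minus_U_adm_dense[OF closure(2)]
      by (intro dense_subset_of_value[OF base.q(1)[OF base_axioms] V_adm_digits]) auto
    then show ?thesis using cantor by (simp add: U q0.V_seqs_eq q0.U_seqs_eq cantor_set_def closure_closed)
  qed
  fix n q assume n: "n \<ge> 1" "q \<in> {Q n<..Q (Suc n)}"
  interpret small_base M q using between_Q(6)[OF n] .
  interpret Qn: small_base M "Q n" using Q_in n by blast
  note bq = base.q[OF base_axioms]
  let ?V = "V_adm M (alpha M (Q n))"
  have U: "U_set M q = seq_value q ` ?V" using between_Q(1)[OF n] by (simp add: Qn.V_seqs_eq)
  have le: "q0 \<le> Q n" "Q n \<le> q" using Q_in(2)[OF n(1)] n(2) by auto
  have WV: "?W \<subseteq> ?V"
    using V_adm_mono alpha_le_iff[OF q0.q(1) Qn.q(1) q0.q(2) Qn.q(2)] le by blast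
  have VV: "?V \<subseteq> V_adm M (alpha M q)"
    using V_adm_mono alpha_le_iff[OF Qn.q(1) bq(1) Qn.q(2) bq(2)] le by blast
  have injV: "inj_on (seq_value q) ?V" using inj_on_value VV by (rule inj_on_subset)
  have inj: "inj_on (seq_value q) ?W" using injV WV by (rule inj_on_subset)
  \<comment> \<open>\<open>V_adm\<close> grows with the base, so a sequence outside
    \<open>?W\<close> is admissible only for bases above \<open>q0\<close>. Those in
    \<open>V_bases M\<close> up to \<open>Q n\<close> belong to the associated sequence.\<close>
  have count: "countable (?V - ?W)"
  proof (rule countable_subset[OF _ countable_V_adm_Q[OF n(1)]])
    show "?V - ?W \<subseteq> {c \<in> ?V. \<forall>p\<in>V_bases M. 1 < p \<and> p \<le> Q n \<and> c \<in> V_adm M (alpha M p) \<longrightarrow> q0 < p}"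
    proof safe
      fix c p assume c: "c \<notin> ?W" "1 < p" "p \<le> Q n" "c \<in> V_adm M (alpha M p)"
      show "q0 < p"
      proof (rule ccontr)
        assume "\<not> q0 < p"
        then have "alpha M p \<sqsubseteq> alpha M q0" using alpha_le_iff[OF c(2) q0.q(1) _ q0.q(2)] q0.q(2) by simp
        then show False using V_adm_mono c(1,4) by blast
      qed
    qed
  qed
  show cond: "condensation_points (U_set M q) = seq_value q ` V_seqs M q0"
    unfolding q0.V_seqs_eq
  proof (intro subset_antisym subsetI)
    fix x assume x: "x \<in> condensation_points (U_set M q)"
    show "x \<in> seq_value q ` ?W"
    proof (rule ccontr)
      assume nx: "x \<notin> seq_value q ` ?W"
      \<comment> \<open>The complement of the perfect part is a neighbourhood of \<open>x\<close>
        meeting \<open>U_set M q\<close> in a countable set.\<close>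
      have "open (- (seq_value q ` ?W))"
        using closed_image_value[OF bq(1) V_adm_digits seq_closed_V_adm] by (simp add: open_Compl)
      then have "uncountable (U_set M q \<inter> - (seq_value q ` ?W))"
        using x nx unfolding condensation_points_def by blast
      moreover have "U_set M q \<inter> - (seq_value q ` ?W) \<subseteq> seq_value q ` (?V - ?W)" unfolding U by blast
      ultimately show False using count countable_subset countable_image by metis
    qed
  next
    fix x assume "x \<in> seq_value q ` ?W"
    then show "x \<in> condensation_points (U_set M q)"
      using condensation_points_value[OF bq(1) V_adm_digits seq_closed_V_adm inj perfect, of "U_set M q"] WV
      by (auto simp: U)
  qed
  have "seq_value q ` (U_adm M (alpha M (Q n)) - ?W) = seq_value q ` U_adm M (alpha M (Q n)) - seq_value q ` ?W"
    by (rule inj_on_image_set_diff[OF injV]) (use U_adm_subset_V_adm WV in blast)+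
  then show "accumulation_points (U_set M q) - condensation_points (U_set M q)
      = seq_value q ` (U_seqs M (Q n) - V_seqs M q0)"
    unfolding cond between_Q(2)[OF n] by (simp add: q0.V_seqs_eq Qn.U_seqs_eq)
qed

theorem theorem1p11:
  fixes M :: nat
  assumes "M > 0"
  shows
    "(\<forall>q \<in> closure (U_bases M).
        (q = real M + 1 \<longrightarrow>
           V_set M q = closure (U_set M q) \<and> closure (U_set M q) = {0..1} \<and>
           perfect_set (V_set M q)) \<and>
        (q \<noteq> real M + 1 \<longrightarrow>
           V_set M q = closure (U_set M q) \<and> cantor_set (V_set M q)))
   \<and> (\<forall>Q. associated_sequence M 1 (q_KL M) Q \<longrightarrow>
        (\<forall>q \<in> {1<..Q 1}. card (U_set M q) = 2) \<and>
        (\<forall>n\<ge>1. \<forall>q \<in> {Q n<..Q (Suc n)}.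
           countable (U_set M q) \<and> infinite (U_set M q) \<and>
           accumulation_points (U_set M q) = seq_value q ` U_seqs M (Q n) \<and>
           isolated_points (U_set M q) = seq_value q ` (V_seqs M (Q n) - U_seqs M (Q n)) \<and>
           dense_subset_of (isolated_points (U_set M q)) (U_set M q)))
   \<and> (\<forall>q0 q0' Q.
        base_component M q0 q0' \<and> q0 \<in> closure (U_bases M) - U_bases M \<and>
        associated_sequence M q0 q0' Q \<longrightarrow>
        (\<forall>q \<in> {q0<..Q 1}.
           U_set M q = closure (U_set M q) \<and> cantor_set (U_set M q) \<and>
           dense_subset_of (seq_value q ` (V_seqs M q0 - U_seqs M q0)) (U_set M q)) \<and>
        (\<forall>n\<ge>1. \<forall>q \<in> {Q n<..Q (Suc n)}.
           condensation_points (U_set M q) = seq_value q ` V_seqs M q0 \<and>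
           accumulation_points (U_set M q) - condensation_points (U_set M q)
             = seq_value q ` (U_seqs M (Q n) - V_seqs M q0) \<and>
           isolated_points (U_set M q) = seq_value q ` (V_seqs M (Q n) - U_seqs M (Q n)) \<and>
           dense_subset_of (isolated_points (U_set M q)) (U_set M q)))"
proof (intro conjI)
  show "\<forall>q \<in> closure (U_bases M).
        (q = real M + 1 \<longrightarrow>
           V_set M q = closure (U_set M q) \<and> closure (U_set M q) = {0..1} \<and>
           perfect_set (V_set M q)) \<and>
        (q \<noteq> real M + 1 \<longrightarrow>
           V_set M q = closure (U_set M q) \<and> cantor_set (V_set M q))"
  proof (intro ballI conjI impI)
    fix q assume "q = real M + 1"
    then have "V_set M q = {0..1}" "closure (U_set M q) = {0..1}"
      using closure_U_set_top[OF assms] by (auto simp: V_set_def)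
    then show "V_set M q = closure (U_set M q)" "closure (U_set M q) = {0..1}" "perfect_set (V_set M q)"
      using perfect_unit_interval by auto
  qed (use closure_U_bases_V_set[OF assms] in auto)
next
  show "\<forall>Q. associated_sequence M 1 (q_KL M) Q \<longrightarrow>
        (\<forall>q \<in> {1<..Q 1}. card (U_set M q) = 2) \<and>
        (\<forall>n\<ge>1. \<forall>q \<in> {Q n<..Q (Suc n)}.
           countable (U_set M q) \<and> infinite (U_set M q) \<and>
           accumulation_points (U_set M q) = seq_value q ` U_seqs M (Q n) \<and>
           isolated_points (U_set M q) = seq_value q ` (V_seqs M (Q n) - U_seqs M (Q n)) \<and>
           dense_subset_of (isolated_points (U_set M q)) (U_set M q))"
  proof (rule allI, rule impI)
    fix Q assume Q: "associated_sequence M 1 (q_KL M) Q"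
    interpret associated M 1 "q_KL M" Q using Q by unfold_locales auto
    show "(\<forall>q \<in> {1<..Q 1}. card (U_set M q) = 2) \<and>
        (\<forall>n\<ge>1. \<forall>q \<in> {Q n<..Q (Suc n)}.
           countable (U_set M q) \<and> infinite (U_set M q) \<and>
           accumulation_points (U_set M q) = seq_value q ` U_seqs M (Q n) \<and>
           isolated_points (U_set M q) = seq_value q ` (V_seqs M (Q n) - U_seqs M (Q n)) \<and>
           dense_subset_of (isolated_points (U_set M q)) (U_set M q))"
      by (intro conjI ballI allI impI; fact first_component[OF assms Q] between_Q)
  qed
next
  show "\<forall>q0 q0' Q.
        base_component M q0 q0' \<and> q0 \<in> closure (U_bases M) - U_bases M \<and>
        associated_sequence M q0 q0' Q \<longrightarrow>
        (\<forall>q \<in> {q0<..Q 1}.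
           U_set M q = closure (U_set M q) \<and> cantor_set (U_set M q) \<and>
           dense_subset_of (seq_value q ` (V_seqs M q0 - U_seqs M q0)) (U_set M q)) \<and>
        (\<forall>n\<ge>1. \<forall>q \<in> {Q n<..Q (Suc n)}.
           condensation_points (U_set M q) = seq_value q ` V_seqs M q0 \<and>
           accumulation_points (U_set M q) - condensation_points (U_set M q)
             = seq_value q ` (U_seqs M (Q n) - V_seqs M q0) \<and>
           isolated_points (U_set M q) = seq_value q ` (V_seqs M (Q n) - U_seqs M (Q n)) \<and>
           dense_subset_of (isolated_points (U_set M q)) (U_set M q))"
  proof (rule allI, rule allI, rule allI, rule impI)
    fix q0 q0' Q
    assume "base_component M q0 q0' \<and> q0 \<in> closure (U_bases M) - U_bases M \<and>
        associated_sequence M q0 q0' Q"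
    then have q0: "q0 \<in> closure (U_bases M)" and Q: "associated_sequence M q0 q0' Q" by auto
    have "closure (U_bases M) \<subseteq> {1..}"
      by (rule closure_minimal) (use U_V_bases_le in \<open>force+\<close>)
    then interpret associated M q0 q0' Q using q0 Q by unfold_locales auto
    show "(\<forall>q \<in> {q0<..Q 1}.
           U_set M q = closure (U_set M q) \<and> cantor_set (U_set M q) \<and>
           dense_subset_of (seq_value q ` (V_seqs M q0 - U_seqs M q0)) (U_set M q)) \<and>
        (\<forall>n\<ge>1. \<forall>q \<in> {Q n<..Q (Suc n)}.
           condensation_points (U_set M q) = seq_value q ` V_seqs M q0 \<and>
           accumulation_points (U_set M q) - condensation_points (U_set M q)
             = seq_value q ` (U_seqs M (Q n) - V_seqs M q0) \<and>
           isolated_points (U_set M q) = seq_value q ` (V_seqs M (Q n) - U_seqs M (Q n)) \<and>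
           dense_subset_of (isolated_points (U_set M q)) (U_set M q))"
      by (intro conjI ballI allI impI; (fact later_component[OF assms q0 Q] between_Q
            | rule later_component(1)[OF assms q0 Q, THEN conjunct1]
              later_component(1)[OF assms q0 Q, THEN conjunct2, THEN conjunct1]
              later_component(1)[OF assms q0 Q, THEN conjunct2, THEN conjunct2], assumption))
  qed
qed

end
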